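(* For all integers $k\ge1$ and $n\ge0$, $$e_6(7^{2k}n+\delta_{7,2k})\equiv0\pmod{7^{2k}}.$$
   Context: $q=e^{2\pi i\tau}$, $(q;q)_\infty=\prod_{n\ge1}(1-q^n)$, $E_6(\tau)=1-504\sum_{n\ge1}\sigma_5(n)q^n$ with $\sigma_5(n)=\sum_{d\mid n}d^5$. The numbers $e_6(n)$ are defined by $\sum_{n\ge0}e_6(n)q^n=E_6(\tau)/(q;q)_\infty$. For a prime $\ell\ge5$ and $k\ge1$, $\delta_{\ell,k}$ is the integer with $0<\delta_{\ell,k}<\ell^k$ and $24\delta_{\ell,k}\equiv1\pmod{\ell^k}$. *)

theory Defs
  imports "HOL-Analysis.Analysis" "HOL-Number_Theory.Number_Theory"
begin

text \<open>
  The q-expansions are treated as formal power series over the integers, the indeterminate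
  \<^term>\<open>fps_X\<close> playing the role of \<open>q\<close>. Infinite products refer to the library's topology
  on formal power series (coefficientwise eventual stabilisation).
\<close>

definition sigma5 :: "nat \<Rightarrow> nat" where
  "sigma5 n = (\<Sum>d | d dvd n. d ^ 5)"

definition E6 :: "int fps" where
  "E6 = Abs_fps (\<lambda>n. if n = 0 then 1 else - 504 * int (sigma5 n))"

definition q_poch :: "int fps" where
  "q_poch = prodinf (\<lambda>n. 1 - fps_X ^ Suc n)"

text \<open>
  The quotient \<open>E6 / (q;q)\<close> as the unique solution of \<open>F * (q;q) = E6\<close> in the ring of integer
  power series, where the operation \<open>/\<close> is not available; see \<open>e6_fps_times_q_poch\<close> below.
\<close>
definition e6_fps :: "int fps" where
  "e6_fps = (THE F. F * q_poch = E6)"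

definition e6 :: "nat \<Rightarrow> int" where
  "e6 n = fps_nth e6_fps n"

definition delta :: "nat \<Rightarrow> nat \<Rightarrow> nat" where
  "delta l k = (THE d. 0 < d \<and> d < l ^ k \<and> [24 * d = 1] (mod (l ^ k)))"

text \<open>The descriptions above denote: the product converges, the quotient exists, and the
  residue \<open>delta l k\<close> exists and is unique.\<close>

lemma q_poch_has_prod: "(\<lambda>n. 1 - fps_X ^ Suc n) has_prod q_poch"
  and q_poch_nth_0: "fps_nth q_poch 0 = 1"
proof -
  define P :: "nat \<Rightarrow> int fps" where "P = (\<lambda>m. \<Prod>i\<le>m. 1 - fps_X ^ Suc i)"
  define L :: "int fps" where "L = Abs_fps (\<lambda>n. fps_nth (P n) n)"
  have step: "fps_nth (P (Suc m)) n = fps_nth (P m) n" if "n \<le> m" for m n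
  proof -
    have "P (Suc m) = P m - P m * fps_X ^ Suc (Suc m)"
      by (simp add: P_def algebra_simps)
    then show ?thesis using that by (simp add: fps_X_power_mult_right_nth del: power_Suc)
  qed
  have stable: "fps_nth (P m) n = fps_nth L n" if "n \<le> m" for m n
    using that by (induction m rule: dec_induct) (auto simp: L_def step)
  have lim: "P \<longlonglongrightarrow> L"
    by (rule tendsto_fpsI) (auto simp: eventually_sequentially intro!: stable)
  have L0: "fps_nth L 0 = 1"
    by (simp add: L_def P_def)
  then have "L \<noteq> 0" by auto
  with lim have *: "(\<lambda>n. 1 - fps_X ^ Suc n) has_prod L"
    by (simp add: has_prod_def raw_has_prod_def P_def)
  then have "q_poch = L"
    unfolding q_poch_def by (rule has_prod_unique[symmetric])
  with * L0 show "(\<lambda>n. 1 - fps_X ^ Suc n) has_prod q_poch" "fps_nth q_poch 0 = 1"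
    by simp_all
qed

lemma e6_fps_times_q_poch: "e6_fps * q_poch = E6"
  unfolding e6_fps_def
proof (rule theI)
  have "q_poch * fps_right_inverse q_poch 1 = 1"
    by (rule fps_right_inverse) (simp add: q_poch_nth_0)
  then show "(E6 * fps_right_inverse q_poch 1) * q_poch = E6"
    by (simp add: mult.assoc mult.commute)
  then show "F = E6 * fps_right_inverse q_poch 1" if "F * q_poch = E6" for F
    using that q_poch_nth_0 by (metis fps_zero_nth mult_right_cancel zero_neq_one)
qed

lemma delta_props:
  assumes "prime l" "l \<ge> 5" "k \<ge> 1"
  shows "0 < delta l k \<and> delta l k < l ^ k \<and> [24 * delta l k = 1] (mod (l ^ k))"
  unfolding delta_def
proof (rule theI')
  have "\<not> l dvd 24"
  proof
    assume "l dvd 24"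
    have "(24::nat) = 2 ^ 3 * 3" by simp
    with \<open>l dvd 24\<close> have "l dvd 2 \<or> l dvd 3"
      using assms(1) by (metis prime_dvd_mult_iff prime_dvd_power)
    with assms(2) show False by (auto dest: dvd_imp_le)
  qed
  then have cop: "coprime 24 (l ^ k)"
    using assms(1) by (metis coprime_commute coprime_power_right_iff prime_imp_coprime)
  have "l ^ 1 \<le> l ^ k"
    using assms by (intro power_increasing) auto
  then have gt: "1 < l ^ k" using assms by simp
  obtain x where x: "[24 * x = 1] (mod (l ^ k))"
    using cong_solve_coprime_nat[OF cop] by auto
  have "[24 * (x mod l ^ k) = 1] (mod (l ^ k))"
    using x by (simp add: cong_def mod_mult_right_eq)
  moreover have "x mod l ^ k < l ^ k" using gt by (intro mod_less_divisor) linarith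
  moreover have "d = e" if "d < l ^ k" "e < l ^ k"
    "[24 * d = 1] (mod (l ^ k))" "[24 * e = 1] (mod (l ^ k))" for d e
    using that cop by (metis cong_less_modulus_unique_nat cong_mult_lcancel_nat cong_sym cong_trans)
  moreover have "d > 0" if "[24 * d = 1] (mod (l ^ k))" for d
    using that gt assms by (cases "d = 0") (auto simp: cong_def)
  ultimately show "\<exists>!d. 0 < d \<and> d < l ^ k \<and> [24 * d = 1] (mod (l ^ k))"
    by blast
qed

end

theory Submission
  imports Defs "HOL-Complex_Analysis.Complex_Analysis"
begin

text \<open>
  Write \<open>f = E\<^sub>6 / \<eta>\<close>, whose coefficient at \<open>q\<^bsup>n - 1/24\<^esup>\<close> is \<open>e\<^sub>6(n)\<close>. It transforms with weight \<open>11/2\<close>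
  under the full modular group, and so do the products of \<open>f\<close> with the integer polynomials in
  \<open>E\<^sub>6\<^sup>2 / \<eta>\<^sup>2\<^sup>4\<close>; there is exactly one such form \<open>F\<^sub>j\<close> with principal part
  \<open>q\<close> to the power \<open>- 49\<^sup>j / 24\<close>, and \<open>F\<^sub>0 = f\<close>. The Hecke operator for \<open>7\<^sup>2\<close> acts on coefficients by
  \<open>a(n) \<mapsto> a(49 n) + w(n) a(n) + 7\<^sup>9 a(n / 49)\<close> (exponents scaled by \<open>24\<close>), with \<open>w(n) \<in> {0, \<plusminus> 7\<^sup>4}\<close>.
  Comparing principal parts gives \<open>T F\<^sub>j = F\<^bsub>j-1\<^esub> + \<epsilon>\<^sub>j F\<^sub>j + 7\<^sup>9 F\<^bsub>j+1\<^esub>\<close> with \<open>7\<^sup>4\<close> dividing \<open>\<epsilon>\<^sub>j\<close>, and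
  induction on \<open>k\<close> shows that \<open>7\<^bsup>2k - 2j\<^esup>\<close> divides the coefficients of \<open>F\<^sub>j\<close> at exponents divisible by \<open>49\<^sup>k\<close>.

  The transformation laws of \<open>E\<^sub>2\<close> and \<open>E\<^sub>6\<close> are read off the Taylor coefficients at \<open>0\<close> of the
  Weierstrass zeta function, written as a sum over powers of \<open>q\<close>; the one of \<open>\<eta>\<close> follows because
  its logarithmic derivative is a multiple of \<open>E\<^sub>2\<close>.
\<close>

text \<open>In the induction on k the term F_(j-1) needs no power of 7, because 2k - 2j is unchanged
  when k and j both drop by 1; every other term carries more than its induction hypothesis lacks.
  The gain starts at j = 0, where no F_(-1) exists: its principal part would have exponent
  -1/(24*49), which is not of the form n - 1/24. The powers of 7 are those of a Hecke operator in
  weight l + 1/2 with l = 5, namely 7^(l-1) = 7^4 and 7^(2l-1) = 7^9; half-integral weight is the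
  reason for working with 7^2. The obstacle is that T has to respect the eta multiplier together
  with a choice of square root. Under translation this can be read off the exponents. Under
  inversion each summand is moved by its own matrix of the modular group, whose multiplier must be
  known; it is computed along explicit continued fractions, in place of a general formula with
  Dedekind sums.\<close>

section \<open>Lambert sums\<close>

definition ee :: "complex \<Rightarrow> complex" where
  "ee x = exp (2 * of_real pi * \<i> * x)"

lemma ee_nonzero [simp]: "ee x \<noteq> 0"
  by (simp add: ee_def)

lemma ee_0 [simp]: "ee 0 = 1"
  by (simp add: ee_def)

lemma ee_add: "ee (x + y) = ee x * ee y"
  by (simp add: ee_def exp_add ring_distribs)

lemma ee_minus: "ee (- x) = inverse (ee x)"
  by (simp add: ee_def exp_minus)

lemma ee_of_nat_mult: "ee (of_nat n * x) = ee x ^ n"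
  by (simp add: ee_def exp_of_nat_mult[symmetric] mult_ac)

lemma norm_ee: "norm (ee x) = exp (- 2 * pi * Im x)"
  by (simp add: ee_def)

lemma ee_eq_1_iff: "ee x = 1 \<longleftrightarrow> x \<in> \<int>"
proof -
  have "ee x = 1 \<longleftrightarrow> (\<exists>n::int. x = of_int n)"
    unfolding ee_def exp_eq_1 by (auto simp: complex_eq_iff)
  thus ?thesis by (auto elim: Ints_cases)
qed

lemma ee_of_int [simp]: "ee (of_int n) = 1"
  by (simp add: ee_eq_1_iff)

lemma ee_1 [simp]: "ee 1 = 1"
  by (simp add: ee_eq_1_iff)

lemma has_field_derivative_ee [derivative_intros]:
  assumes "(f has_field_derivative f') (at x within A)"
  shows "((\<lambda>x. ee (f x)) has_field_derivative (2 * of_real pi * \<i> * f' * ee (f x))) (at x within A)"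
  unfolding ee_def by (rule derivative_eq_intros assms refl | simp)+

lemma holomorphic_on_ee [holomorphic_intros]:
  "f holomorphic_on A \<Longrightarrow> (\<lambda>x. ee (f x)) holomorphic_on A"
  unfolding ee_def by (intro holomorphic_intros)

lemma continuous_on_ee [continuous_intros]:
  "continuous_on A f \<Longrightarrow> continuous_on A (\<lambda>x. ee (f x))"
  unfolding ee_def by (intro continuous_intros)

text \<open>Minus \<open>y\<close> times the logarithmic derivative in \<open>y\<close> of the
  product of \<open>1 - y * q ^ n\<close> over positive \<open>n\<close>, that is, of one half of
  the Jacobi theta product.\<close>

definition lambert :: "complex \<Rightarrow> complex \<Rightarrow> complex" where
  "lambert q y = (\<Sum>n. y * q ^ Suc n / (1 - y * q ^ Suc n))"

text \<open>On a disc of radius \<open>K\<close> only finitely many denominators can vanish: past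
  \<open>N\<close> they stay at least 1/2 away from 0. One \<open>N\<close> serves all
  \<open>y\<close> there, as both the openness of the domain and the Weierstrass test
  require.\<close>

lemma lambert_term_bound:
  assumes "norm (q::complex) < 1"
  obtains N where "\<And>n y. n \<ge> N \<Longrightarrow> norm y \<le> K \<Longrightarrow> norm (y * q ^ Suc n) \<le> 1 / 2"
    "\<And>n y. n \<ge> N \<Longrightarrow> norm y \<le> K \<Longrightarrow>
       norm (y * q ^ Suc n / (1 - y * q ^ Suc n)) \<le> 2 * K * norm q ^ n"
proof -
  have "(\<lambda>n. K * norm q ^ n) \<longlonglongrightarrow> K * 0"
    by (intro tendsto_intros LIMSEQ_realpow_zero) (use assms in auto)
  hence "eventually (\<lambda>n. K * norm q ^ n < 1 / 2) sequentially"
    by (rule order_tendstoD) auto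
  then obtain N where N: "\<And>n. n \<ge> N \<Longrightarrow> K * norm q ^ n < 1 / 2"
    by (auto simp: eventually_sequentially)
  have 1: "norm (y * q ^ Suc n) \<le> K * norm q ^ n" if "norm y \<le> K" for n y
  proof -
    have "norm (y * q ^ Suc n) = norm y * norm q ^ Suc n"
      by (simp add: norm_mult norm_power)
    also have "\<dots> \<le> K * norm q ^ n"
      by (intro mult_mono that power_decreasing) (use assms order_trans[OF norm_ge_zero that] in auto)
    finally show ?thesis .
  qed
  have 2: "norm (y * q ^ Suc n) \<le> 1 / 2" if "n \<ge> N" "norm y \<le> K" for n y
    using 1[OF that(2), of n] N[OF that(1)] by linarith
  have 3: "norm (y * q ^ Suc n / (1 - y * q ^ Suc n)) \<le> 2 * K * norm q ^ n"
    if "n \<ge> N" "norm y \<le> K" for n y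
  proof -
    have "1 / 2 \<le> norm (1 - y * q ^ Suc n)"
      using 2[OF that] norm_triangle_ineq2[of 1 "y * q ^ Suc n"] by simp
    hence "norm (y * q ^ Suc n) / norm (1 - y * q ^ Suc n) \<le> (K * norm q ^ n) / (1 / 2)"
      using order_trans[OF norm_ge_zero that(2)] by (intro frac_le 1 that) auto
    thus ?thesis by (simp add: norm_divide)
  qed
  show ?thesis using that 2 3 by blast
qed

lemma summable_lambert:
  assumes "norm (q::complex) < 1"
  shows "summable (\<lambda>n. y * q ^ Suc n / (1 - y * q ^ Suc n))"
proof -
  obtain N where N: "\<And>n y'. n \<ge> N \<Longrightarrow> norm y' \<le> norm y \<Longrightarrow>
       norm (y' * q ^ Suc n / (1 - y' * q ^ Suc n)) \<le> 2 * norm y * norm q ^ n"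
    using lambert_term_bound[OF assms, of "norm y"] by metis
  show ?thesis
    by (rule summable_comparison_test'[where N = N and g = "\<lambda>n. 2 * norm y * norm q ^ n"])
       (use N assms in \<open>auto intro!: summable_mult summable_geometric\<close>)
qed

lemma lambert_shift:
  assumes "norm q < 1"
  shows "lambert q y = y * q / (1 - y * q) + lambert q (y * q)"
  unfolding lambert_def using suminf_split_head[OF summable_lambert[OF assms, of y]]
  by (simp add: mult_ac)

lemma lambert_0 [simp]: "lambert q 0 = 0"
  by (simp add: lambert_def)

lemma open_lambert_domain:
  assumes "norm (q::complex) < 1"
  shows "open {y. \<forall>n. y * q ^ Suc n \<noteq> 1}"
proof (rule Topological_Spaces.openI)
  fix x assume x: "x \<in> {y. \<forall>n. y * q ^ Suc n \<noteq> 1}"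
  obtain N where N: "\<And>n y. n \<ge> N \<Longrightarrow> norm y \<le> norm x + 1 \<Longrightarrow> norm (y * q ^ Suc n) \<le> 1 / 2"
    using lambert_term_bound[OF assms, of "norm x + 1"] by metis
  define T where "T = ball x 1 \<inter> (\<Inter>n<N. {y. y * q ^ Suc n \<noteq> 1})"
  have "open T"
    unfolding T_def by (intro open_Int open_INT ballI open_Collect_neq continuous_intros) auto
  moreover have "x \<in> T" using x by (auto simp: T_def)
  moreover have "T \<subseteq> {y. \<forall>n. y * q ^ Suc n \<noteq> 1}"
  proof safe
    fix y n assume y: "y \<in> T" "y * q ^ Suc n = 1"
    have "norm y \<le> norm x + 1"
      using y(1) norm_triangle_ineq2[of y x] by (auto simp: T_def dist_norm norm_minus_commute)
    hence "n < N" using N[of n y] y(2) by (cases "n < N") auto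
    thus False using y by (auto simp: T_def)
  qed
  ultimately show "\<exists>T. open T \<and> x \<in> T \<and> T \<subseteq> {y. \<forall>n. y * q ^ Suc n \<noteq> 1}" by blast
qed

lemma holomorphic_on_lambert:
  assumes "norm q < 1"
  shows "lambert q holomorphic_on {y. \<forall>n. y * q ^ Suc n \<noteq> 1}"
proof (rule holomorphic_uniform_sequence)
  show "open {y. \<forall>n. y * q ^ Suc n \<noteq> 1}" by (rule open_lambert_domain) fact
next
  show "(\<lambda>y. \<Sum>n<N. y * q ^ Suc n / (1 - y * q ^ Suc n)) holomorphic_on
          {y. \<forall>n. y * q ^ Suc n \<noteq> 1}" for N
    by (intro holomorphic_intros) auto
next
  fix x assume x: "x \<in> {y. \<forall>n. y * q ^ Suc n \<noteq> 1}"
  obtain d where d: "d > 0" "cball x d \<subseteq> {y. \<forall>n. y * q ^ Suc n \<noteq> 1}"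
    using open_lambert_domain[OF assms] x open_contains_cball by blast
  obtain N where N: "\<And>n y. n \<ge> N \<Longrightarrow> norm y \<le> norm x + d \<Longrightarrow>
       norm (y * q ^ Suc n / (1 - y * q ^ Suc n)) \<le> 2 * (norm x + d) * norm q ^ n"
    using lambert_term_bound[OF assms, of "norm x + d"] by metis
  have "uniform_limit (cball x d) (\<lambda>n y. \<Sum>i<n. y * q ^ Suc i / (1 - y * q ^ Suc i))
     (\<lambda>y. \<Sum>i. y * q ^ Suc i / (1 - y * q ^ Suc i)) sequentially"
  proof (rule Weierstrass_m_test_ev)
    show "\<forall>\<^sub>F n in sequentially. \<forall>y\<in>cball x d. norm (y * q ^ Suc n / (1 - y * q ^ Suc n)) \<le>
        2 * (norm x + d) * norm q ^ n"
      unfolding eventually_sequentially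
    proof (intro exI[of _ N] allI impI ballI N)
      fix y assume "y \<in> cball x d"
      thus "norm y \<le> norm x + d"
        using norm_triangle_ineq2[of y x] by (auto simp: dist_norm norm_minus_commute)
    qed auto
    show "summable (\<lambda>n. 2 * (norm x + d) * norm q ^ n)"
      using assms by (intro summable_mult summable_geometric) auto
  qed
  thus "\<exists>d>0. cball x d \<subseteq> {y. \<forall>n. y * q ^ Suc n \<noteq> 1} \<and>
      uniform_limit (cball x d) (\<lambda>N y. \<Sum>n<N. y * q ^ Suc n / (1 - y * q ^ Suc n)) (lambert q) sequentially"
    using d unfolding lambert_def[abs_def] by blast
qed

lemma holomorphic_on_lambert' [holomorphic_intros]:
  assumes "norm q < 1" "f holomorphic_on A" "\<And>x n. x \<in> A \<Longrightarrow> f x * q ^ Suc n \<noteq> 1"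
  shows "(\<lambda>x. lambert q (f x)) holomorphic_on A"
  using holomorphic_on_compose_gen[OF assms(2) holomorphic_on_lambert[OF assms(1)]] assms(3)
  by (auto simp: o_def)

text \<open>At \<open>n = 0\<close> division by zero yields 0, the correct constant
  coefficient.\<close>

definition lambert_fps :: "complex \<Rightarrow> complex fps" where
  "lambert_fps q = Abs_fps (\<lambda>n. q ^ n / (1 - q ^ n))"

lemma power_eq_1_disc: "norm (q::complex) < 1 \<Longrightarrow> q ^ Suc n \<noteq> 1"
  by (metis norm_one norm_power power_Suc_less_one norm_ge_zero less_irrefl power_0_Suc zero_neq_one
       norm_eq_zero order_le_less)

text \<open>
  The functional equation \<open>lambert q y - lambert q (q y) = q y / (1 - q y)\<close> determines the coefficients.
\<close>

lemma lambert_has_fps_expansion: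
  assumes q: "norm q < 1"
  shows "lambert q has_fps_expansion lambert_fps q"
proof -
  define D where "D = {y. \<forall>n. y * q ^ Suc n \<noteq> 1}"
  have D: "open D" "0 \<in> D" "lambert q holomorphic_on D"
    using open_lambert_domain[OF q] holomorphic_on_lambert[OF q] by (auto simp: D_def)
  define F where "F = fps_expansion (lambert q) 0"
  have F: "lambert q has_fps_expansion F"
    unfolding F_def using D by blast
  have F0: "fps_nth F 0 = 0"
    using fps_nth_fps_expansion[OF F, of 0] by simp
  have lin: "(\<lambda>y. y * q) has_fps_expansion (fps_X * fps_const q)"
    by (intro fps_expansion_intros)
  have 0: "(\<lambda>y. lambert q (y * q)) has_fps_expansion (F oo (fps_X * fps_const q))"
    using has_fps_expansion_compose[OF F lin] by (simp add: o_def)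
  have 1: "(\<lambda>y. lambert q y - lambert q (y * q)) has_fps_expansion (F - (F oo (fps_X * fps_const q)))"
    by (intro has_fps_expansion_diff F 0)
  have 2: "(\<lambda>y. y * q / (1 - y * q)) has_fps_expansion
      (fps_X * fps_const q / (1 - fps_X * fps_const q))"
    by (intro has_fps_expansion_divide' fps_expansion_intros) auto
  have eq: "(\<lambda>y. lambert q y - lambert q (y * q)) = (\<lambda>y. y * q / (1 - y * q))"
    by (rule ext, subst lambert_shift[OF q]) simp
  have 3: "F - (F oo (fps_X * fps_const q)) = fps_X * fps_const q / (1 - fps_X * fps_const q)"
    using fps_expansion_unique_complex[OF 1] 2 unfolding eq by blast
  have 4: "fps_X * fps_const q / (1 - fps_X * fps_const q) = Abs_fps (\<lambda>n. if n = 0 then 0 else q ^ n)"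
  proof -
    have "Abs_fps (\<lambda>n. if n = 0 then 0 else q ^ n) * (1 - fps_X * fps_const q) = fps_X * fps_const q"
    proof (rule fps_ext)
      fix n
      show "fps_nth (Abs_fps (\<lambda>n. if n = 0 then 0 else q ^ n) * (1 - fps_X * fps_const q)) n
        = fps_nth (fps_X * fps_const q) n"
        by (cases n) (auto simp: ring_distribs mult.assoc[symmetric])
    qed
    note eq = this
    have "fps_nth (1 - fps_X * fps_const q) 0 \<noteq> 0" by simp
    hence "1 - fps_X * fps_const q \<noteq> 0" by (metis fps_zero_nth)
    hence "Abs_fps (\<lambda>n. if n = 0 then 0 else q ^ n) * (1 - fps_X * fps_const q)
        / (1 - fps_X * fps_const q) = Abs_fps (\<lambda>n. if n = 0 then 0 else q ^ n)"
      by (rule nonzero_mult_div_cancel_right)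
    thus ?thesis unfolding eq .
  qed
  have "fps_nth F n = q ^ n / (1 - q ^ n)" for n
  proof (cases "n = 0")
    case False
    have "fps_nth F n - fps_nth F n * q ^ n = q ^ n"
    proof -
      have X: "fps_X * fps_const q = fps_const q * fps_X" by (simp add: mult.commute)
      have "fps_nth (F oo (fps_X * fps_const q)) n = fps_nth F n * q ^ n"
        unfolding X fps_compose_linear by simp
      moreover have "fps_nth (F - (F oo (fps_X * fps_const q))) n = q ^ n"
        unfolding 3 4 using False by simp
      ultimately show ?thesis by simp
    qed
    moreover have "1 - q ^ n \<noteq> 0" using power_eq_1_disc[OF q, of "n - 1"] False by auto
    ultimately show ?thesis by (simp add: field_simps)
  qed (use F0 in auto)
  hence "F = lambert_fps q" by (simp add: lambert_fps_def fps_eq_iff)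
  thus ?thesis using F by simp
qed

text \<open>The pole nearest to 0 is at \<open>1 / q\<close>, outside the closed unit disc. Hence
  the expansion is still valid around \<open>y = ee 0 = 1\<close>, where it will be differentiated
  in \<open>z\<close>.\<close>

lemma fps_conv_radius_lambert_fps:
  assumes "norm q < 1" "q \<noteq> 0"
  shows "fps_conv_radius (lambert_fps q) \<ge> 1 / norm q"
    and "\<And>y. norm y < 1 / norm q \<Longrightarrow> lambert q y = eval_fps (lambert_fps q) y"
proof -
  have hol: "lambert q holomorphic_on ball 0 (1 / norm q)"
  proof (rule holomorphic_on_subset[OF holomorphic_on_lambert[OF assms(1)]], safe)
    fix y n assume y: "y \<in> ball 0 (1 / norm q)" "y * q ^ Suc n = 1"
    have "1 = norm (y * q) * norm q ^ n"
      by (metis y(2) norm_mult norm_power norm_one power_Suc mult.assoc)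
    also have "\<dots> \<le> norm (y * q) * 1"
      using assms by (intro mult_left_mono power_le_one) auto
    also have "\<dots> < 1" using y(1) assms by (simp add: norm_mult field_simps)
    finally show False by simp
  qed
  show "fps_conv_radius (lambert_fps q) \<ge> 1 / norm q"
    using holomorphic_on_imp_fps_conv_radius_ge[OF lambert_has_fps_expansion[OF assms(1)], of "ereal (1 / norm q)"] hol
    by simp
  show "lambert q y = eval_fps (lambert_fps q) y" if "norm y < 1 / norm q" for y
    using has_fps_expansion_imp_eval_fps_eq[OF lambert_has_fps_expansion[OF assms(1)] that hol] by simp
qed

text \<open>With \<open>x = ee z\<close>, differentiation in \<open>z\<close> is 2 pi i times
  \<open>x * d/dx\<close>, which multiplies coefficient \<open>n\<close> by \<open>n\<close>. These
  powers of \<open>n\<close> become the powers of divisors in \<open>sigma_series\<close>.\<close>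

lemma higher_deriv_eval_fps_ee:
  fixes F :: "complex fps"
  assumes "ereal (norm (ee z)) < fps_conv_radius F"
  shows "(deriv ^^ k) (\<lambda>z. eval_fps F (ee z)) z =
           (2 * of_real pi * \<i>) ^ k * eval_fps (Abs_fps (\<lambda>n. of_nat n ^ k * fps_nth F n)) (ee z)"
  using assms
proof (induction k arbitrary: F)
  case 0
  have "Abs_fps (\<lambda>n. fps_nth F n) = F" by (simp add: fps_eq_iff)
  thus ?case by simp
next
  case (Suc k)
  define G where "G = fps_X * fps_deriv F"
  have Gn: "fps_nth G n = of_nat n * fps_nth F n" for n
    by (cases n) (auto simp: G_def)
  have "fps_conv_radius F \<le> min (fps_conv_radius (fps_X :: complex fps)) (fps_conv_radius (fps_deriv F))"
    using fps_conv_radius_deriv[of F] by simp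
  also have "\<dots> \<le> fps_conv_radius G"
    unfolding G_def by (rule fps_conv_radius_mult)
  finally have GF: "fps_conv_radius F \<le> fps_conv_radius G" .
  define D where "D = {z. ee z \<in> eball 0 (fps_conv_radius F)}"
  have D: "open D"
  proof -
    have "D = ee -` eball 0 (fps_conv_radius F)" by (auto simp: D_def)
    thus ?thesis using continuous_on_ee[of UNIV "\<lambda>x. x"]
      by (auto intro!: open_vimage continuous_intros)
  qed
  have zD: "z \<in> D" using Suc.prems by (simp add: D_def)
  have der: "deriv (\<lambda>z. eval_fps F (ee z)) w = (2 * of_real pi * \<i>) * eval_fps G (ee w)" if "w \<in> D" for w
  proof (rule DERIV_imp_deriv)
    have w: "ereal (norm (ee w)) < fps_conv_radius F" using that by (simp add: D_def)
    have w': "ereal (norm (ee w)) < fps_conv_radius (fps_deriv F)"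
      using w fps_conv_radius_deriv[of F] by (rule less_le_trans)
    have "eval_fps G (ee w) = ee w * eval_fps (fps_deriv F) (ee w)"
      unfolding G_def by (subst eval_fps_mult) (use w' in auto)
    moreover have "((\<lambda>z. eval_fps F (ee z)) has_field_derivative
       (eval_fps (fps_deriv F) (ee w) * (2 * of_real pi * \<i> * 1 * ee w))) (at w)"
      by (rule DERIV_chain2[where f = "eval_fps F" and g = ee, OF has_field_derivative_eval_fps[OF w]])
         (rule derivative_eq_intros refl | simp)+
    ultimately show "((\<lambda>z. eval_fps F (ee z)) has_field_derivative
        2 * of_real pi * \<i> * eval_fps G (ee w)) (at w)"
      by (simp add: mult_ac)
  qed
  have "(deriv ^^ Suc k) (\<lambda>z. eval_fps F (ee z)) z = (deriv ^^ k) (deriv (\<lambda>z. eval_fps F (ee z))) z"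
    unfolding funpow_Suc_right o_def ..
  also have "\<dots> = (deriv ^^ k) (\<lambda>w. (2 * of_real pi * \<i>) * eval_fps G (ee w)) z"
    by (intro higher_deriv_cong_ev eventually_mono[OF eventually_nhds_in_open[OF D zD]] der refl)
  also have "\<dots> = (2 * of_real pi * \<i>) * (deriv ^^ k) (\<lambda>w. eval_fps G (ee w)) z"
  proof (rule higher_deriv_cmult[OF _ zD D])
    have "eval_fps G holomorphic_on eball 0 (fps_conv_radius F)"
      by (rule holomorphic_on_eval_fps) (use GF in \<open>auto intro: less_le_trans\<close>)
    moreover have "ee holomorphic_on D" using holomorphic_on_ee[of "\<lambda>x. x"] by simp
    moreover have "ee ` D \<subseteq> eball 0 (fps_conv_radius F)" by (auto simp: D_def)
    ultimately show "(\<lambda>w. eval_fps G (ee w)) holomorphic_on D"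
      using holomorphic_on_compose_gen[of ee D "eval_fps G" "eball 0 (fps_conv_radius F)"]
      by (simp add: o_def)
  qed
  also have "(deriv ^^ k) (\<lambda>w. eval_fps G (ee w)) z =
      (2 * of_real pi * \<i>) ^ k * eval_fps (Abs_fps (\<lambda>n. of_nat n ^ k * fps_nth G n)) (ee z)"
    by (rule Suc.IH) (use Suc.prems GF in \<open>auto intro: less_le_trans\<close>)
  finally show ?case by (simp add: Gn mult_ac)
qed

section \<open>Lambert series as divisor sums\<close>

lemma summable_nat_power_times_power:
  fixes x :: real
  assumes "norm x < 1"
  shows "summable (\<lambda>n. of_nat n ^ k * x ^ n)"
  using assms
proof (induction k arbitrary: x)
  case (Suc k)
  have "summable (\<lambda>n. diffs (\<lambda>n. of_nat n ^ k) n * x ^ n)"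
    by (rule termdiff_converges[OF Suc.prems]) (use Suc.IH in auto)
  hence "summable (\<lambda>n. x * (of_nat (Suc n) ^ Suc k * x ^ n))"
    unfolding diffs_def by (intro summable_mult) simp
  hence "summable (\<lambda>n. of_nat (Suc n) ^ Suc k * x ^ Suc n)"
    by (simp add: mult_ac)
  thus ?case by (subst (asm) summable_Suc_iff)
qed (auto intro: summable_geometric)

text \<open>One absolutely convergent double series over pairs \<open>(d, m)\<close> of positive
  integers, summed over \<open>m\<close> first or grouped by \<open>n = d * m\<close>. At
  \<open>n = 0\<close> every number is a divisor, the sum over this infinite set is 0 by convention,
  and on the right division by zero gives 0, so neither side has a constant term.\<close>

lemma lambert_sums:
  fixes q :: complex
  assumes q: "norm q < 1"
  shows "(\<lambda>n. of_nat (\<Sum>d | d dvd n. d ^ k) * q ^ n) sums (\<Sum>n. of_nat n ^ k * (q ^ n / (1 - q ^ n)))"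
proof -
  define f where "f = (\<lambda>(d::nat, m::nat). of_nat d ^ k * q ^ (d * m))"
  define A :: "nat set" where "A = {1..}"
  have A: "A = range Suc" unfolding A_def by (auto simp: image_iff Suc_le_eq gr0_conv_Suc)
  have geo: "((\<lambda>m. x ^ m) has_sum (x / (1 - x))) A" if "norm x < 1"
    for x :: "'a :: {banach, real_normed_field}"
  proof -
    have "((\<lambda>m. x * x ^ m) has_sum (x * (1 / (1 - x)))) UNIV"
    proof (intro has_sum_cmult_right norm_summable_imp_has_sum)
      show "summable (\<lambda>n. norm (x ^ n))"
        using that by (simp add: norm_power)
      show "(\<lambda>n. x ^ n) sums (1 / (1 - x))"
        by (rule geometric_sums[OF that])
    qed
    hence "((\<lambda>m. x ^ Suc m) has_sum (x / (1 - x))) UNIV" by simp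
    thus ?thesis unfolding A by (subst has_sum_reindex) (auto simp: o_def)
  qed
  have small: "norm (q ^ d) < 1" if "d \<in> A" for d
    using that q by (simp add: norm_power A_def power_Suc_less_one power_less_one_iff)
  have small': "norm q ^ d \<le> norm q" if "d \<in> A" for d
    using that q power_decreasing[of 1 d "norm q"] by (simp add: A_def)
  have inner: "((\<lambda>m. f (d, m)) has_sum (of_nat d ^ k * (q ^ d / (1 - q ^ d)))) A" if "d \<in> A" for d
    unfolding f_def prod.case power_mult
    by (intro has_sum_cmult_right geo small that)
  have inner': "((\<lambda>m. norm (f (d, m))) has_sum (of_nat d ^ k * (norm q ^ d / (1 - norm q ^ d)))) A"
    if "d \<in> A" for d
    unfolding f_def prod.case power_mult norm_mult norm_power norm_of_nat
    using small[OF that] by (intro has_sum_cmult_right geo) (auto simp: norm_power)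
  have poly: "summable (\<lambda>d. of_nat d ^ k * norm q ^ d)"
  proof -
    show ?thesis by (rule summable_nat_power_times_power) (use q in auto)
  qed
  have abs: "(\<lambda>x. norm (f x)) summable_on (A \<times> A)"
    unfolding Infinite_Sum.abs_summable_on_Sigma_iff
  proof safe
    show "(\<lambda>m. norm (f (d, m))) summable_on A" if "d \<in> A" for d
      using inner'[OF that] has_sum_imp_summable by blast
    have "(\<lambda>d. of_nat d ^ k * norm q ^ d * (1 / (1 - norm q))) summable_on A"
    proof (rule summable_on_subset_banach[where A = UNIV])
      show "(\<lambda>d. of_nat d ^ k * norm q ^ d * (1 / (1 - norm q))) summable_on UNIV"
        using summable_mult2[OF poly, of "1 / (1 - norm q)"] q
        by (subst summable_on_UNIV_nonneg_real_iff) auto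
    qed auto
    hence "(\<lambda>d. of_nat d ^ k * (norm q ^ d / (1 - norm q ^ d))) summable_on A"
    proof (rule summable_on_comparison_test)
      fix d assume d: "d \<in> A"
      have "norm q ^ d / (1 - norm q ^ d) \<le> norm q ^ d / (1 - norm q)"
        using small'[OF d] q by (intro divide_left_mono mult_pos_pos) auto
      hence "of_nat d ^ k * (norm q ^ d / (1 - norm q ^ d)) \<le> of_nat d ^ k * (norm q ^ d / (1 - norm q))"
        by (rule mult_left_mono) simp
      thus "of_nat d ^ k * (norm q ^ d / (1 - norm q ^ d)) \<le> of_nat d ^ k * norm q ^ d * (1 / (1 - norm q))"
        by simp
      show "0 \<le> of_nat d ^ k * (norm q ^ d / (1 - norm q ^ d))"
        using small'[OF d] q by (intro mult_nonneg_nonneg divide_nonneg_nonneg) auto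
    qed
    moreover have "(\<Sum>\<^sub>\<infinity>y\<in>A. norm (f (d, y))) = of_nat d ^ k * (norm q ^ d / (1 - norm q ^ d))" if "d \<in> A" for d
      using inner'[OF that] by (rule infsumI)
    ultimately have "(\<lambda>x. \<Sum>\<^sub>\<infinity>y\<in>A. norm (f (x, y))) summable_on A"
      by (subst summable_on_cong) auto
    thus "(\<lambda>x. norm (\<Sum>\<^sub>\<infinity>y\<in>A. norm (f (x, y)))) summable_on A"
      by (simp add: infsum_nonneg)
  qed
  define t where "t = infsum f (A \<times> A)"
  have t: "(f has_sum t) (A \<times> A)"
    unfolding t_def using abs_summable_summable[OF abs] by simp
  have 1: "((\<lambda>d. of_nat d ^ k * (q ^ d / (1 - q ^ d))) has_sum t) A"
    using t inner by (rule has_sum_SigmaD)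
  define B where "B = Sigma A (\<lambda>n. {d. d dvd n})"
  have "(f has_sum t) (A \<times> A) \<longleftrightarrow> ((\<lambda>(n, d). of_nat d ^ k * q ^ n) has_sum t) B"
    by (rule has_sum_reindex_bij_witness[of _ "\<lambda>(n, d). (d, n div d)" "\<lambda>(d, m). (d * m, d)"])
       (auto simp: f_def A_def B_def Suc_le_eq elim!: dvdE)
  hence t2: "((\<lambda>(n, d). of_nat d ^ k * q ^ n) has_sum t) B" using t by simp
  have "((\<lambda>n. of_nat (\<Sum>d | d dvd n. d ^ k) * q ^ n) has_sum t) A"
  proof (rule has_sum_SigmaD[OF t2[unfolded B_def]])
    fix n assume "n \<in> A"
    hence "finite {d. d dvd n}" by (simp add: A_def)
    thus "((\<lambda>d. case (n, d) of (n, d) \<Rightarrow> of_nat d ^ k * q ^ n) has_sum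
        of_nat (\<Sum>d | d dvd n. d ^ k) * q ^ n) {d. d dvd n}"
      by (intro has_sum_finiteI) (auto simp: sum_distrib_right)
  qed
  hence "((\<lambda>n. of_nat (\<Sum>d | d dvd n. d ^ k) * q ^ n) has_sum t) UNIV"
    by (subst (asm) has_sum_cong_neutral[where T = UNIV and g = "\<lambda>n. of_nat (\<Sum>d | d dvd n. d ^ k) * q ^ n"])
       (auto simp: A_def not_le)
  hence 2: "(\<lambda>n. of_nat (\<Sum>d | d dvd n. d ^ k) * q ^ n) sums t"
    by (rule has_sum_imp_sums)
  have "((\<lambda>d. of_nat d ^ k * (q ^ d / (1 - q ^ d))) has_sum t) UNIV"
    using 1 by (subst (asm) has_sum_cong_neutral[where T = UNIV and g = "\<lambda>d. of_nat d ^ k * (q ^ d / (1 - q ^ d))"])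
       (auto simp: A_def not_le)
  hence "(\<lambda>d. of_nat d ^ k * (q ^ d / (1 - q ^ d))) sums t"
    by (rule has_sum_imp_sums)
  thus ?thesis using 2 by (simp add: sums_iff)
qed

section \<open>Doubly periodic functions\<close>

definition lattice :: "complex \<Rightarrow> complex set" where
  "lattice \<tau> = {of_int a + of_int b * \<tau> | a b. True}"

lemma lattice_I [intro]: "of_int a + of_int b * \<tau> \<in> lattice \<tau>"
  by (auto simp: lattice_def)

lemma lattice_add: "x \<in> lattice \<tau> \<Longrightarrow> y \<in> lattice \<tau> \<Longrightarrow> x + y \<in> lattice \<tau>"
proof -
  assume "x \<in> lattice \<tau>" "y \<in> lattice \<tau>"
  then obtain a b c d where "x = of_int a + of_int b * \<tau>" "y = of_int c + of_int d * \<tau>"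
    unfolding lattice_def by blast
  hence "x + y = of_int (a + c) + of_int (b + d) * \<tau>" by (simp add: algebra_simps)
  thus ?thesis by (metis lattice_I)
qed

lemma lattice_minus: "x \<in> lattice \<tau> \<Longrightarrow> - x \<in> lattice \<tau>"
proof -
  assume "x \<in> lattice \<tau>"
  then obtain a b where "x = of_int a + of_int b * \<tau>" unfolding lattice_def by blast
  hence "- x = of_int (- a) + of_int (- b) * \<tau>" by simp
  thus ?thesis by (metis lattice_I)
qed

lemma lattice_diff: "x \<in> lattice \<tau> \<Longrightarrow> y \<in> lattice \<tau> \<Longrightarrow> x - y \<in> lattice \<tau>"
  using lattice_add[of x \<tau> "- y"] lattice_minus by simp

lemma lattice_0 [simp]: "0 \<in> lattice \<tau>" using lattice_I[of 0 0 \<tau>] by simp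
lemma lattice_1 [simp]: "1 \<in> lattice \<tau>" using lattice_I[of 1 0 \<tau>] by simp
lemma lattice_tau [simp]: "\<tau> \<in> lattice \<tau>" using lattice_I[of 0 1 \<tau>] by simp

lemma lattice_discrete:
  assumes "x \<in> lattice \<tau>" "y \<in> lattice \<tau>" "dist x y < min 1 \<bar>Im \<tau>\<bar>"
  shows "x = y"
proof -
  obtain a b where ab: "x - y = of_int a + of_int b * \<tau>"
    using lattice_diff[OF assms(1,2)] unfolding lattice_def by blast
  have n: "norm (x - y) < 1" "norm (x - y) < \<bar>Im \<tau>\<bar>" using assms(3) by (auto simp: dist_norm)
  have "b = 0"
  proof (rule ccontr)
    assume "b \<noteq> 0"
    hence "\<bar>Im \<tau>\<bar> * 1 \<le> \<bar>Im \<tau>\<bar> * \<bar>of_int b\<bar>" by (intro mult_left_mono) auto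
    also have "\<dots> = \<bar>Im (x - y)\<bar>" by (simp add: ab abs_mult)
    also have "\<dots> \<le> norm (x - y)" by (rule abs_Im_le_cmod)
    finally show False using n by simp
  qed
  hence "norm (x - y) = \<bar>of_int a\<bar>" by (simp add: ab)
  hence "a = 0" using n(1) by (metis of_int_abs of_int_less_1_iff zero_less_abs_iff linorder_not_less int_one_le_iff_zero_less)
  thus ?thesis using ab \<open>b = 0\<close> by simp
qed

lemma closed_lattice_subset:
  assumes "Im \<tau> \<noteq> 0" "S \<subseteq> lattice \<tau>"
  shows "closed S"
proof (rule discrete_imp_closed)
  show "0 < min 1 \<bar>Im \<tau>\<bar>" using assms by simp
  show "\<forall>x\<in>S. \<forall>y\<in>S. dist y x < min 1 \<bar>Im \<tau>\<bar> \<longrightarrow> y = x"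
    using assms(2) lattice_discrete by blast
qed

text \<open>
  Periodicity is only assumed off the lattice: at nonzero lattice points the values of \<open>f\<close> are arbitrary.
\<close>

lemma doubly_periodic_constant:
  assumes im: "Im \<tau> \<noteq> 0"
    and hol: "f holomorphic_on - (lattice \<tau> - {0})"
    and per1: "\<And>z. z \<notin> lattice \<tau> \<Longrightarrow> f (z + 1) = f z"
    and per2: "\<And>z. z \<notin> lattice \<tau> \<Longrightarrow> f (z + \<tau>) = f z"
  obtains c where "\<And>z. z \<notin> lattice \<tau> - {0} \<Longrightarrow> f z = c"
proof -
  \<comment> \<open>Overwriting every lattice value by \<open>f 0\<close> gives periodicity
    everywhere; near a lattice point \<open>F\<close> is then a translate of \<open>F\<close> near
    0, where it agrees with \<open>f\<close>. This makes \<open>F\<close> entire.\<close>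
  define F where "F = (\<lambda>z. if z \<in> lattice \<tau> then f 0 else f z)"
  have mem: "z + l \<in> lattice \<tau> \<longleftrightarrow> z \<in> lattice \<tau>" if "l \<in> lattice \<tau>" for z l
    using that lattice_add lattice_diff by fastforce
  have F1: "F (z + 1) = F z" for z using per1 mem[of 1 z] by (simp add: F_def)
  have F2: "F (z + \<tau>) = F z" for z using per2 mem[of \<tau> z] by (simp add: F_def)
  have F1': "F (z + of_int a) = F z" for z and a :: int
  proof (induction a arbitrary: z rule: int_induct[where k = 0])
    case (step1 i) thus ?case using F1[of "z + of_int i"] by (simp add: add_ac)
  next
    case (step2 i) thus ?case using F1[of "z + of_int (i - 1)"] by (simp add: add_ac)
  qed auto
  have F2': "F (z + of_int a * \<tau>) = F z" for z and a :: int
  proof (induction a arbitrary: z rule: int_induct[where k = 0])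
    case (step1 i) thus ?case using F2[of "z + of_int i * \<tau>"] by (simp add: algebra_simps)
  next
    case (step2 i) thus ?case using F2[of "z + of_int (i - 1) * \<tau>"] by (simp add: algebra_simps)
  qed auto
  have per: "F (z + l) = F z" if "l \<in> lattice \<tau>" for z l
    using that F1' F2' unfolding lattice_def by (auto simp flip: add.assoc)
  define W where "W = - (lattice \<tau> - {0})"
  have W: "open W" unfolding W_def by (rule open_Compl, rule closed_lattice_subset[OF im]) auto
  have FW: "F holomorphic_on W"
    by (rule holomorphic_transform[OF hol[folded W_def]]) (auto simp: F_def W_def)
  have "F holomorphic_on UNIV"
  proof (subst holomorphic_on_def, safe)
    fix z0 :: complex
    define l where "l = (if z0 \<in> lattice \<tau> then z0 else 0)"
    have l: "l \<in> lattice \<tau>" by (simp add: l_def)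
    have "z0 - l \<in> W" by (auto simp: l_def W_def)
    hence "F field_differentiable at (z0 - l)"
      using FW W holomorphic_on_imp_differentiable_at by blast
    hence "(F \<circ> (\<lambda>z. z - l)) field_differentiable at z0"
      by (intro field_differentiable_compose) (auto intro!: derivative_intros simp: field_differentiable_diff)
    moreover have "F \<circ> (\<lambda>z. z - l) = F"
      using per[OF lattice_minus[OF l]] by (auto simp: fun_eq_iff)
    ultimately show "F field_differentiable at z0 within UNIV" by simp
  qed
  moreover have "bounded (range F)"
  proof -
    define P where "P = (\<lambda>(s, t). complex_of_real s + of_real t * \<tau>) ` ({0..1} \<times> {0..1})"
    have "compact P" unfolding P_def
      by (intro compact_continuous_image compact_Times) (auto intro!: continuous_intros simp: case_prod_unfold)
    moreover have "continuous_on P F"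
      using \<open>F holomorphic_on UNIV\<close> holomorphic_on_imp_continuous_on continuous_on_subset by blast
    ultimately have "bounded (F ` P)" using compact_continuous_image compact_imp_bounded by blast
    moreover have "F z \<in> F ` P" for z
    proof -
      define t where "t = Im z / Im \<tau>"
      define s where "s = Re z - t * Re \<tau>"
      have z: "z = of_real s + of_real t * \<tau>" using im by (simp add: complex_eq_iff s_def t_def)
      define w where "w = of_real (frac s) + of_real (frac t) * \<tau>"
      have "w \<in> P" unfolding P_def w_def
        by (rule image_eqI[of _ _ "(frac s, frac t)"]) (auto simp: frac_ge_0 less_imp_le[OF frac_lt_1])
      moreover have "z = w + (of_int \<lfloor>s\<rfloor> + of_int \<lfloor>t\<rfloor> * \<tau>)"
        by (simp add: z w_def frac_def algebra_simps)
      hence "F z = F w" using per[OF lattice_I] by metis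
      ultimately show ?thesis by simp
    qed
    ultimately show ?thesis by (meson bounded_subset image_subsetI)
  qed
  ultimately have "F constant_on UNIV" by (rule Liouville_theorem)
  then obtain c where c: "\<And>z. F z = c" by (auto simp: constant_on_def)
  have "f z = c" if "z \<notin> lattice \<tau> - {0}" for z using that c[of z] by (cases "z = 0") (auto simp: F_def split: if_splits)
  thus ?thesis using that by blast
qed

section \<open>Quasi-periodicity and the transformation of E_2 and E_6\<close>

lemma ee_im_lt_1: "Im \<tau> > 0 \<Longrightarrow> norm (ee \<tau>) < 1"
  by (simp add: norm_ee)

text \<open>The expansion of \<open>(1 + exp w) / (2 * (1 - exp w)) + 1 / w\<close>, with
  coefficient \<open>- B_(2m) / (2m)!\<close> (Bernoulli numbers) at \<open>w ^ (2m - 1)\<close>. It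
  is put over a common denominator because each summand alone has a pole.\<close>

definition cot_fps :: "complex fps" where
  "cot_fps = (fps_X * (1 + fps_exp 1) + fps_const 2 * (1 - fps_exp 1)) / (fps_const 2 * fps_X * (1 - fps_exp 1))"

text \<open>The numerator vanishes to at least the order 2 of the denominator, so the quotient is a
  genuine power series. The vanishing of \<open>fps_nth N 2\<close> makes its constant term 0, the
  value that \<open>cot_reg\<close> has at 0.\<close>

lemma cot_fps_quotient:
  defines "N \<equiv> fps_X * (1 + fps_exp 1) + fps_const 2 * (1 - fps_exp 1) :: complex fps"
  defines "D \<equiv> fps_const 2 * fps_X * (1 - fps_exp 1) :: complex fps"
  shows "subdegree D = 2" "D \<noteq> 0" "N \<noteq> 0" "2 \<le> subdegree N" "fps_nth N 2 = 0" "cot_fps * D = N"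
proof -
  have D: "fps_nth D (Suc n) = 2 * (if n = 0 then 0 else - 1 / fact n)" for n
    by (simp add: D_def mult.assoc)
  have D0: "fps_nth D 0 = 0" by (simp add: D_def)
  show 1: "subdegree D = 2"
  proof (rule subdegreeI)
    show "fps_nth D 2 \<noteq> 0" using D[of 1] by (simp add: numeral_2_eq_2)
    show "fps_nth D i = 0" if "i < 2" for i using D[of 0] D0 that by (cases i) auto
  qed
  show 2: "D \<noteq> 0" using 1 by auto
  have N: "fps_nth N (Suc n) = (if n = 0 then 1 else 0) + 1 / fact n - 2 / fact (Suc n)" for n
    by (simp add: N_def ring_distribs)
  have N0: "fps_nth N 0 = 0" by (simp add: N_def)
  show N2: "fps_nth N 2 = 0" using N[of 1] by (simp add: numeral_2_eq_2)
  show 3: "N \<noteq> 0"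
  proof
    assume "N = 0"
    hence "fps_nth N (Suc 2) = 0" by simp
    thus False unfolding N by (simp add: fact_numeral)
  qed
  show 4: "2 \<le> subdegree N"
  proof (rule subdegree_geI[OF 3])
    show "fps_nth N i = 0" if "i < 2" for i using N[of 0] N0 that by (cases i) auto
  qed
  have "D dvd N" using 1 2 3 4 by (simp add: fps_dvd_iff)
  thus "cot_fps * D = N" unfolding cot_fps_def N_def[symmetric] D_def[symmetric] by simp
qed

text \<open>The values are \<open>- B_2 / 2!\<close> and \<open>- B_6 / 6!\<close>; relative to the
  divisor sums they produce the 24 and 504 of the Eisenstein series. Since the denominator has order
  2, comparison at degree \<open>n + 2\<close> determines coefficient \<open>n\<close>.\<close>

lemma cot_fps_nth: "fps_nth cot_fps 1 = - 1 / 12" "fps_nth cot_fps 5 = - 1 / 30240"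
proof -
  define D where "D = (fps_const 2 * fps_X * (1 - fps_exp 1) :: complex fps)"
  define N where "N = (fps_X * (1 + fps_exp 1) + fps_const 2 * (1 - fps_exp 1) :: complex fps)"
  have D: "fps_nth D n = (if n \<le> 1 then 0 else - 2 / fact (n - 1))" for n
    by (cases n) (auto simp: D_def mult.assoc ring_distribs)
  have N: "fps_nth N n = (if n \<le> 1 then 0 else 1 / fact (n - 1) - 2 / fact n)" for n
    by (cases n) (auto simp: N_def ring_distribs)
  have eq: "(\<Sum>i=0..n. fps_nth cot_fps i * fps_nth D (n - i)) = fps_nth N n" for n
    unfolding fps_mult_nth[symmetric] N_def D_def cot_fps_quotient(6) ..
  have 0: "fps_nth cot_fps 0 = 0" using eq[of 2] unfolding D N
    by (simp add: numeral_eq_Suc)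
  have 1: "fps_nth cot_fps 1 = -1/12" using eq[of 3] 0 unfolding D N
    by (simp add: numeral_eq_Suc field_simps) (metis add.inverse_inverse)
  note r1 = 0 1[unfolded One_nat_def]
  have 2: "fps_nth cot_fps 2 = 0" using eq[of 4] unfolding D N
    by (simp add: numeral_eq_Suc r1)
  note r2 = r1 2[unfolded numeral_2_eq_2]
  have 3: "fps_nth cot_fps 3 = 1/720" using eq[of 5] unfolding D N
    by (simp add: numeral_eq_Suc r2 field_simps)
  note r3 = r2 3[unfolded numeral_3_eq_3]
  have 4: "fps_nth cot_fps 4 = 0" using eq[of 6] unfolding D N
    by (simp add: numeral_eq_Suc r3)
  have "(4::nat) = Suc (Suc (Suc (Suc 0)))" by simp
  note r4 = r3 4[unfolded this]
  have lin: "x = - 1 / 30240" if "72 + x * 2177280 = 0" for x :: complex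
  proof -
    have "x * 2177280 = - 72" using that by (simp add: add_eq_0_iff)
    hence "x * 2177280 / 2177280 = - 72 / 2177280" by (simp only:)
    thus ?thesis by simp
  qed
  have 5: "fps_nth cot_fps 5 = - 1 / 30240" using eq[of 7] unfolding D N
    by (intro lin) (simp add: numeral_eq_Suc r4 field_simps)
  show "fps_nth cot_fps 1 = - 1 / 12" "fps_nth cot_fps 5 = - 1 / 30240" by fact+
qed

definition two_pi_i :: complex where "two_pi_i = 2 * of_real pi * \<i>"

lemma two_pi_i_nonzero [simp]: "two_pi_i \<noteq> 0" by (simp add: two_pi_i_def)

lemma ee_eq_exp: "ee z = exp (two_pi_i * z)" by (simp add: ee_def two_pi_i_def)

text \<open>
  Up to the factor \<open>- 2 \<pi> i\<close> this is \<open>\<pi> cot (\<pi> z) - 1 / z\<close>.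
\<close>

definition cot_reg :: "complex \<Rightarrow> complex" where
  "cot_reg z = (if z = 0 then 0 else (1 + ee z) / (2 * (1 - ee z)) + 1 / (two_pi_i * z))"

lemma cot_reg_has_fps_expansion: "cot_reg has_fps_expansion (cot_fps oo (fps_const two_pi_i * fps_X))"
proof -
  define f where "f = (\<lambda>w::complex. if w = 0 then 0 else (w * (1 + exp w) + 2 * (1 - exp w)) / (2 * w * (1 - exp w)))"
  have "f has_fps_expansion cot_fps"
    unfolding f_def cot_fps_def
    using cot_fps_quotient by (intro has_fps_expansion_divide fps_expansion_intros has_fps_expansion_exp1) auto
  moreover have "(\<lambda>z. two_pi_i * z) has_fps_expansion (fps_const two_pi_i * fps_X)"
    by (intro fps_expansion_intros)
  ultimately have "(f \<circ> (\<lambda>z. two_pi_i * z)) has_fps_expansion (cot_fps oo (fps_const two_pi_i * fps_X))"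
    by (rule has_fps_expansion_compose) auto
  moreover have "eventually (\<lambda>z. (f \<circ> (\<lambda>z. two_pi_i * z)) z = cot_reg z) (nhds 0)"
  proof (rule eventually_mono[OF eventually_nhds_in_open[of "ball 0 1"]])
    fix z :: complex assume z: "z \<in> ball 0 1"
    have "ee z \<noteq> 1" if "z \<noteq> 0"
    proof
      assume "ee z = 1"
      then obtain n where n: "z = of_int n" by (auto simp: ee_eq_1_iff elim: Ints_cases)
      hence "\<bar>real_of_int n\<bar> < 1" using z by simp
      hence "n = 0" by linarith
      thus False using n that by simp
    qed
    thus "(f \<circ> (\<lambda>z. two_pi_i * z)) z = cot_reg z"
      by (auto simp: f_def cot_reg_def ee_eq_exp field_simps)
  qed auto
  ultimately show ?thesis by (simp add: has_fps_expansion_cong)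
qed

lemma holomorphic_cot_reg: "cot_reg holomorphic_on - (\<int> - {0})"
proof -
  obtain s where s: "open s" "0 \<in> s" "cot_reg holomorphic_on s"
    using has_fps_expansion_imp_holomorphic[OF cot_reg_has_fps_expansion] by metis
  have op: "open (- (\<int>::complex set))" using closed_Ints by auto
  have "(\<lambda>z. (1 + ee z) / (2 * (1 - ee z)) + 1 / (two_pi_i * z)) holomorphic_on - \<int>"
    by (intro holomorphic_intros) (auto simp: ee_eq_1_iff)
  hence 1: "cot_reg holomorphic_on - \<int>"
    by (rule holomorphic_transform) (auto simp: cot_reg_def)
  show ?thesis
  proof (subst holomorphic_on_def, safe)
    fix x :: complex assume "x \<notin> \<int> \<or> x = 0"
  qed (use s 1 op holomorphic_on_imp_differentiable_at field_differentiable_at_within in blast)+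
qed

definition sigma_series :: "nat \<Rightarrow> complex \<Rightarrow> complex" where
  "sigma_series k q = (\<Sum>n. of_nat (\<Sum>d | d dvd n. d ^ k) * q ^ n)"

text \<open>The \<open>n\<close>-th derivative at 0 is \<open>two_pi_i ^ n\<close> times the sum of
  \<open>m ^ n * q ^ m / (1 - q ^ m)\<close>, which is a divisor sum series by
  \<open>lambert_sums\<close>.\<close>

lemma lambert_ee_has_fps_expansion:
  assumes "norm q < 1" "q \<noteq> 0"
  shows "(\<lambda>z. lambert q (ee z)) has_fps_expansion Abs_fps (\<lambda>n. two_pi_i ^ n * sigma_series n q / fact n)"
proof -
  define D where "D = {z. norm (ee z) < 1 / norm q}"
  have D: "open D" unfolding D_def by (intro open_Collect_less continuous_intros)
  have 0: "0 \<in> D" using assms by (auto simp: D_def field_simps)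
  note F = fps_conv_radius_lambert_fps[OF assms]
  have less: "ereal (norm (ee z)) < fps_conv_radius (lambert_fps q)" if "z \<in> D" for z
    by (rule less_le_trans[OF _ F(1)]) (use that in \<open>simp add: D_def\<close>)
  have eq: "lambert q (ee z) = eval_fps (lambert_fps q) (ee z)" if "z \<in> D" for z
    using F(2) that by (simp add: D_def)
  have "(\<lambda>z. eval_fps (lambert_fps q) (ee z)) holomorphic_on D"
  proof -
    have "eval_fps (lambert_fps q) holomorphic_on eball 0 (fps_conv_radius (lambert_fps q))"
      by (rule holomorphic_on_eval_fps) auto
    moreover have "ee holomorphic_on D" using holomorphic_on_ee[of "\<lambda>x. x"] by simp
    moreover have "ee ` D \<subseteq> eball 0 (fps_conv_radius (lambert_fps q))" using less by auto
    ultimately show ?thesis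
      using holomorphic_on_compose_gen[of ee D "eval_fps (lambert_fps q)"] by (simp add: o_def)
  qed
  hence "(\<lambda>z. lambert q (ee z)) holomorphic_on D" by (rule holomorphic_transform) (simp add: eq)
  hence E: "(\<lambda>z. lambert q (ee z)) has_fps_expansion fps_expansion (\<lambda>z. lambert q (ee z)) 0"
    using D 0 by blast
  have "fps_nth (fps_expansion (\<lambda>z. lambert q (ee z)) 0) n = two_pi_i ^ n * sigma_series n q / fact n" for n
  proof -
    have "(deriv ^^ n) (\<lambda>z. lambert q (ee z)) 0 = (deriv ^^ n) (\<lambda>z. eval_fps (lambert_fps q) (ee z)) 0"
      by (intro higher_deriv_cong_ev refl eventually_mono[OF eventually_nhds_in_open[OF D 0]] eq)
    also have "\<dots> = two_pi_i ^ n * eval_fps (Abs_fps (\<lambda>m. of_nat m ^ n * fps_nth (lambert_fps q) m)) (ee 0)"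
      unfolding two_pi_i_def by (rule higher_deriv_eval_fps_ee) (rule less[OF 0])
    also have "eval_fps (Abs_fps (\<lambda>m. of_nat m ^ n * fps_nth (lambert_fps q) m)) (ee 0) = sigma_series n q"
      using lambert_sums[OF assms(1), of n] by (simp add: eval_fps_def lambert_fps_def sigma_series_def sums_iff)
    finally show ?thesis using fps_nth_fps_expansion[OF E, of n] by simp
  qed
  hence "fps_expansion (\<lambda>z. lambert q (ee z)) 0 = Abs_fps (\<lambda>n. two_pi_i ^ n * sigma_series n q / fact n)"
    by (simp add: fps_eq_iff)
  thus ?thesis using E by simp
qed

text \<open>For nonzero \<open>z\<close> this is
  \<open>zeta_mult q (ee z) + 1 / (two_pi_i * z)\<close>: the pole at 0 is cancelled so that there
  are Taylor coefficients to compare.\<close>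

definition zeta_reg :: "complex \<Rightarrow> complex \<Rightarrow> complex" where
  "zeta_reg q z = cot_reg z + lambert q (ee z) - lambert q (ee (- z))"

text \<open>Antisymmetrisation in \<open>z\<close> leaves the odd \<open>n\<close>, whose
  coefficients are multiples of the Eisenstein series of weight \<open>n + 1\<close>.\<close>

definition zeta_fps :: "complex \<Rightarrow> complex fps" where
  "zeta_fps q = Abs_fps (\<lambda>n. two_pi_i ^ n * (fps_nth cot_fps n + (1 - (-1) ^ n) * sigma_series n q / fact n))"

lemma zeta_reg_has_fps_expansion:
  assumes "norm q < 1" "q \<noteq> 0"
  shows "zeta_reg q has_fps_expansion zeta_fps q"
proof -
  define V where "V = Abs_fps (\<lambda>n. two_pi_i ^ n * sigma_series n q / fact n)"
  have V: "(\<lambda>z. lambert q (ee z)) has_fps_expansion V"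
    unfolding V_def by (rule lambert_ee_has_fps_expansion[OF assms])
  have "(\<lambda>z. - 1 * z) has_fps_expansion (fps_const (-1) * fps_X :: complex fps)"
    by (intro fps_expansion_intros)
  with V have "((\<lambda>z. lambert q (ee z)) \<circ> (\<lambda>z. - 1 * z)) has_fps_expansion (V oo (fps_const (-1) * fps_X))"
    by (rule has_fps_expansion_compose) auto
  hence "(\<lambda>z. lambert q (ee (- z))) has_fps_expansion (V oo (fps_const (-1) * fps_X))"
    by (simp add: o_def)
  hence "(\<lambda>z. cot_reg z + lambert q (ee z) - lambert q (ee (- z))) has_fps_expansion
     ((cot_fps oo (fps_const two_pi_i * fps_X)) + V - (V oo (fps_const (-1) * fps_X)))"
    by (intro has_fps_expansion_add has_fps_expansion_diff cot_reg_has_fps_expansion V)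
  also have "(cot_fps oo (fps_const two_pi_i * fps_X)) + V - (V oo (fps_const (-1) * fps_X)) = zeta_fps q"
    unfolding fps_compose_linear by (rule fps_ext) (simp add: V_def zeta_fps_def algebra_simps flip: add_divide_distrib)
  finally show ?thesis by (simp add: zeta_reg_def[abs_def])
qed

text \<open>
  Up to the factor \<open>- 2 \<pi> i\<close> and a linear term in \<open>z\<close>, this is the Weierstrass zeta function of the lattice
  generated by \<open>1\<close> and \<open>\<tau>\<close>, in terms of \<open>q = ee \<tau>\<close> and \<open>x = ee z\<close>.
\<close>

definition zeta_mult :: "complex \<Rightarrow> complex \<Rightarrow> complex" where
  "zeta_mult q x = (1 + x) / (2 * (1 - x)) + lambert q x - lambert q (inverse x)"

text \<open>Each Lambert sum changes by one term, and the rational part absorbs both changes up to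
  \<open>1 / 2 + 1 / 2\<close>. In terms of \<open>z\<close> the function has period 1 and grows by
  1 under translation by \<open>\<tau>\<close>.\<close>

lemma zeta_mult_shift:
  assumes "norm q < 1" "q \<noteq> 0" "x \<noteq> 0" "x \<noteq> 1" "x * q \<noteq> 1"
  shows "zeta_mult q (x * q) = zeta_mult q x + 1"
proof -
  have 1: "lambert q x = x * q / (1 - x * q) + lambert q (x * q)"
    by (rule lambert_shift[OF assms(1)])
  have "lambert q (inverse (x * q)) = inverse (x * q) * q / (1 - inverse (x * q) * q) + lambert q (inverse (x * q) * q)"
    by (rule lambert_shift[OF assms(1)])
  also have "inverse (x * q) * q = inverse x" using assms by (simp add: field_simps)
  finally have 2: "lambert q (inverse (x * q)) = inverse x / (1 - inverse x) + lambert q (inverse x)" .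
  have 3: "inverse x / (1 - inverse x) = 1 / (x - 1)" using assms by (simp add: field_simps)
  define y where "y = x * q"
  have y: "1 - y \<noteq> 0" "x - 1 \<noteq> 0" "1 - x \<noteq> 0" using assms by (auto simp: y_def)
  have "(1 + y) / (2 * (1 - y)) = 1 / 2 + y / (1 - y)" "(1 + x) / (2 * (1 - x)) = - 1 / 2 - 1 / (x - 1)"
    using y by (simp_all add: divide_simps) (simp add: algebra_simps)
  thus ?thesis using 1 2 unfolding zeta_mult_def 3 y_def[symmetric] by (simp add: algebra_simps)
qed

text \<open>Both functions belong to the same lattice, up to scaling by \<open>\<tau>\<close>. Their
  difference has no poles and, after the linear correction, no quasi-periods; so it is constant, and
  it vanishes at 0.\<close>

lemma zeta_reg_transform:
  assumes \<tau>: "Im \<tau> > 0" and z: "z \<notin> lattice \<tau> - {0}"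
  shows "zeta_reg (ee \<tau>) z = zeta_reg (ee (-1/\<tau>)) (z / \<tau>) / \<tau> + z / \<tau>"
proof -
  define q q' where "q = ee \<tau>" and "q' = ee (-1/\<tau>)"
  have t0: "\<tau> \<noteq> 0" using \<tau> by auto
  have im': "Im (-1/\<tau>) > 0" using \<tau> by (simp add: Im_divide_Reals Im_divide power2_eq_square sum_squares_gt_zero_iff)
  have q: "norm q < 1" "norm q' < 1" "q \<noteq> 0" "q' \<noteq> 0"
    unfolding q_def q'_def using ee_im_lt_1 \<tau> im' by auto
  \<comment> \<open>Under \<open>z + 1\<close> the term with \<open>q'\<close> changes by
    \<open>1 / \<tau>\<close>, under \<open>z + \<tau>\<close> the term with \<open>q\<close>
    changes by 1; \<open>z / \<tau>\<close> compensates both.\<close>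
  define E where "E = (\<lambda>z. zeta_reg q z - zeta_reg q' (z / \<tau>) / \<tau> - z / \<tau>)"
  have Int1: "z \<in> lattice \<tau>" if "z + of_nat n * \<tau> \<in> \<int>" for z n
  proof -
    from that obtain a where "z + of_nat n * \<tau> = of_int a" by (auto elim: Ints_cases)
    hence "z = of_int a + of_int (- int n) * \<tau>" by (simp add: algebra_simps)
    thus ?thesis by (metis lattice_I)
  qed
  have Int2: "z \<in> lattice \<tau>" if "z / \<tau> + of_nat n * (-1/\<tau>) \<in> \<int>" for z n
  proof -
    from that obtain a where "z / \<tau> + of_nat n * (-1/\<tau>) = of_int a" by (auto elim: Ints_cases)
    hence "z = of_int (int n) + of_int a * \<tau>" using t0 by (simp add: field_simps)
    thus ?thesis by (metis lattice_I)
  qed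
  have no1: "of_nat (Suc n) * \<tau> \<notin> \<int>" for n
    using \<tau> by (auto elim!: Ints_cases simp: complex_eq_iff simp del: of_nat_Suc)
  have no2: "of_nat (Suc n) * (-1/\<tau>) \<notin> \<int>" for n
  proof
    assume "of_nat (Suc n) * (-1/\<tau>) \<in> \<int>"
    then obtain a where "of_nat (Suc n) * (-1/\<tau>) = of_int a" by (rule Ints_cases)
    hence "Im (of_nat (Suc n) * (-1/\<tau>)) = 0" by simp
    moreover have "Im (of_nat (Suc n) * w) = of_nat (Suc n) * Im w" for w by simp
    ultimately have "of_nat (Suc n) * Im (-1/\<tau>) = 0" by metis
    thus False using im' by (simp del: of_nat_Suc)
  qed
  have minus: "- z \<notin> lattice \<tau> - {0}" if "z \<notin> lattice \<tau> - {0}" for z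
    using that lattice_minus[of "- z"] by auto
  have ok1: "ee z * q ^ Suc n \<noteq> 1" if "z \<notin> lattice \<tau> - {0}" for z n
    using Int1[of z "Suc n"] no1[of n] that unfolding q_def ee_of_nat_mult[symmetric] ee_add[symmetric] ee_eq_1_iff
    by auto
  have ok2: "ee (z / \<tau>) * q' ^ Suc n \<noteq> 1" if "z \<notin> lattice \<tau> - {0}" for z n
    using Int2[of z "Suc n"] no2[of n] that unfolding q'_def ee_of_nat_mult[symmetric] ee_add[symmetric] ee_eq_1_iff
    by auto
  have kok1: "z \<notin> \<int> - {0}" if "z \<notin> lattice \<tau> - {0}" for z
    using Int1[of z 0] that by auto
  have kok2: "z / \<tau> \<notin> \<int> - {0}" if "z \<notin> lattice \<tau> - {0}" for z
    using Int2[of z 0] that by auto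
  have hol: "E holomorphic_on - (lattice \<tau> - {0})"
    unfolding E_def zeta_reg_def
  proof (intro holomorphic_intros)
    show "cot_reg holomorphic_on - (lattice \<tau> - {0})"
      by (rule holomorphic_on_subset[OF holomorphic_cot_reg]) (use kok1 in blast)
    have div: "(\<lambda>z. z / \<tau>) holomorphic_on - (lattice \<tau> - {0})"
      using t0 by (intro holomorphic_on_divide holomorphic_on_ident holomorphic_on_const)
    have "(\<lambda>z. z / \<tau>) ` (- (lattice \<tau> - {0})) \<subseteq> - (\<int> - {0})"
      using kok2 by blast
    hence "(cot_reg \<circ> (\<lambda>z. z / \<tau>)) holomorphic_on - (lattice \<tau> - {0})"
      by (rule holomorphic_on_compose_gen[OF div holomorphic_cot_reg])
    thus "(\<lambda>z. cot_reg (z / \<tau>)) holomorphic_on - (lattice \<tau> - {0})" by (simp add: o_def)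
    show "ee z * q ^ Suc n \<noteq> 1" "ee (- z) * q ^ Suc n \<noteq> 1" "ee (z / \<tau>) * q' ^ Suc n \<noteq> 1"
      "ee (- (z / \<tau>)) * q' ^ Suc n \<noteq> 1" if "z \<in> - (lattice \<tau> - {0})" for z n
      using ok1[of z n] ok1[of "- z" n] ok2[of z n] ok2[of "- z" n] minus[of z] that by auto
  qed (use q t0 in auto)
  \<comment> \<open>After the scaling by \<open>\<tau>\<close> both polar parts are
    \<open>1 / (two_pi_i * z)\<close>, so they cancel in the difference.\<close>
  have zf: "zeta_reg q z - zeta_reg q' (z / \<tau>) / \<tau> = zeta_mult q (ee z) - zeta_mult q' (ee (z / \<tau>)) / \<tau>" if "z \<notin> lattice \<tau>" for z
  proof -
    have "z \<noteq> 0" using that by auto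
    thus ?thesis using t0 by (simp add: zeta_reg_def zeta_mult_def cot_reg_def ee_minus field_simps)
  qed
  have "E (z + 1) = E z" if "z \<notin> lattice \<tau>" for z
  proof -
    have z1: "z + 1 \<notin> lattice \<tau>" using that lattice_diff[of "z + 1" \<tau> 1] by auto
    have "ee (z / \<tau>) = ee ((z + 1) / \<tau>) * q'"
      unfolding q'_def ee_add[symmetric] by (simp add: add_divide_distrib)
    moreover have "zeta_mult q' (ee ((z + 1) / \<tau>) * q') = zeta_mult q' (ee ((z + 1) / \<tau>)) + 1"
    proof (rule zeta_mult_shift)
      show "ee ((z + 1) / \<tau>) \<noteq> 1" using kok2[of "z + 1"] z1 t0 by (auto simp: ee_eq_1_iff)
      show "ee ((z + 1) / \<tau>) * q' \<noteq> 1" using ok2[of "z + 1" 0] z1 by simp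
    qed (use q in auto)
    ultimately show ?thesis
      unfolding E_def zf[OF that] zf[OF z1] using t0 by (simp add: ee_add field_simps)
  qed
  moreover have "E (z + \<tau>) = E z" if "z \<notin> lattice \<tau>" for z
  proof -
    have z1: "z + \<tau> \<notin> lattice \<tau>" using that lattice_diff[of "z + \<tau>" \<tau> \<tau>] by auto
    have "ee (z + \<tau>) = ee z * q" by (simp add: q_def ee_add)
    moreover have "zeta_mult q (ee z * q) = zeta_mult q (ee z) + 1"
    proof (rule zeta_mult_shift)
      show "ee z \<noteq> 1" using kok1[of z] that by (auto simp: ee_eq_1_iff)
      show "ee z * q \<noteq> 1" using ok1[of z 0] that by simp
    qed (use q in auto)
    moreover have "ee ((z + \<tau>) / \<tau>) = ee (z / \<tau>)"
      using t0 by (simp add: add_divide_distrib ee_add)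
    ultimately show ?thesis
      unfolding E_def zf[OF that] zf[OF z1] using t0 by (simp add: field_simps)
  qed
  ultimately obtain c where c: "\<And>z. z \<notin> lattice \<tau> - {0} \<Longrightarrow> E z = c"
    using doubly_periodic_constant[OF _ hol] \<tau> by (metis less_irrefl)
  have "E 0 = 0" by (simp add: E_def zeta_reg_def cot_reg_def)
  hence "E z = 0" using c[of 0] c[OF z] by simp
  thus ?thesis by (simp add: E_def q_def q'_def diff_eq_eq add.commute)
qed

text \<open>The linear term \<open>z / \<tau>\<close> is seen only at \<open>n = 1\<close>: it is
  the quasi-modular defect of E2, while \<open>n = 5\<close> gives E6 without defect.\<close>

lemma zeta_fps_transform:
  assumes \<tau>: "Im \<tau> > 0"
  shows "fps_nth (zeta_fps (ee \<tau>)) n = fps_nth (zeta_fps (ee (-1/\<tau>))) n / \<tau> ^ Suc n + (if n = 1 then 1 / \<tau> else 0)"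
proof -
  have t0: "\<tau> \<noteq> 0" using \<tau> by auto
  have im': "Im (-1/\<tau>) > 0" using \<tau> by (simp add: Im_divide power2_eq_square sum_squares_gt_zero_iff)
  have 1: "zeta_reg (ee \<tau>) has_fps_expansion zeta_fps (ee \<tau>)"
    by (rule zeta_reg_has_fps_expansion) (use ee_im_lt_1 \<tau> in auto)
  have 2: "zeta_reg (ee (-1/\<tau>)) has_fps_expansion zeta_fps (ee (-1/\<tau>))"
    by (rule zeta_reg_has_fps_expansion) (use ee_im_lt_1[OF im'] in auto)
  have "(\<lambda>z. (1/\<tau>) * z) has_fps_expansion (fps_const (1/\<tau>) * fps_X)"
    by (intro fps_expansion_intros)
  hence "(zeta_reg (ee (-1/\<tau>)) \<circ> (\<lambda>z. (1/\<tau>) * z)) has_fps_expansion (zeta_fps (ee (-1/\<tau>)) oo (fps_const (1/\<tau>) * fps_X))"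
    by (intro has_fps_expansion_compose[OF 2]) auto
  hence "(\<lambda>z. (1 / \<tau>) * zeta_reg (ee (-1/\<tau>)) (z / \<tau>) + (1 / \<tau>) * z) has_fps_expansion
     (fps_const (1 / \<tau>) * (zeta_fps (ee (-1/\<tau>)) oo (fps_const (1/\<tau>) * fps_X)) + fps_const (1/\<tau>) * fps_X)"
    by (intro fps_expansion_intros) (simp add: o_def)
  moreover have "eventually (\<lambda>z. (1 / \<tau>) * zeta_reg (ee (-1/\<tau>)) (z / \<tau>) + (1 / \<tau>) * z = zeta_reg (ee \<tau>) z) (nhds 0)"
  proof (rule eventually_mono[OF eventually_nhds_in_open[of "- (lattice \<tau> - {0})"]])
    show "open (- (lattice \<tau> - {0}))"
      by (rule open_Compl, rule closed_lattice_subset) (use \<tau> in auto)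
    fix z assume "z \<in> - (lattice \<tau> - {0})"
    hence "z \<notin> lattice \<tau> - {0}" by blast
    from zeta_reg_transform[OF \<tau> this]
    show "(1 / \<tau>) * zeta_reg (ee (-1/\<tau>)) (z / \<tau>) + (1 / \<tau>) * z = zeta_reg (ee \<tau>) z" by simp
  qed auto
  ultimately have "zeta_reg (ee \<tau>) has_fps_expansion
     (fps_const (1 / \<tau>) * (zeta_fps (ee (-1/\<tau>)) oo (fps_const (1/\<tau>) * fps_X)) + fps_const (1/\<tau>) * fps_X)"
    by (simp add: has_fps_expansion_cong)
  hence "zeta_fps (ee \<tau>) = fps_const (1 / \<tau>) * (zeta_fps (ee (-1/\<tau>)) oo (fps_const (1/\<tau>) * fps_X)) + fps_const (1/\<tau>) * fps_X"
    using 1 fps_expansion_unique_complex by blast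
  thus ?thesis unfolding fps_compose_linear by (simp add: power_one_over field_simps)
qed

definition E2f :: "complex \<Rightarrow> complex" where "E2f q = 1 - 24 * sigma_series 1 q"
definition E6f :: "complex \<Rightarrow> complex" where "E6f q = 1 - 504 * sigma_series 5 q"

theorem E2f_transform:
  assumes "Im \<tau> > 0"
  shows "E2f (ee (-1/\<tau>)) = \<tau> ^ 2 * E2f (ee \<tau>) + 12 * \<tau> / two_pi_i"
proof -
  have t0: "\<tau> \<noteq> 0" using assms by auto
  have "fps_nth (zeta_fps q) 1 = - two_pi_i / 12 * E2f q" for q
    unfolding zeta_fps_def fps_nth_Abs_fps cot_fps_nth by (simp add: E2f_def field_simps)
  hence "- two_pi_i / 12 * E2f (ee \<tau>) = - two_pi_i / 12 * E2f (ee (-1/\<tau>)) / \<tau> ^ Suc 1 + 1 / \<tau>"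
    using zeta_fps_transform[OF assms, of 1] by simp
  thus ?thesis using t0 by (simp add: field_simps power2_eq_square)
qed

theorem E6f_transform:
  assumes "Im \<tau> > 0"
  shows "E6f (ee (-1/\<tau>)) = \<tau> ^ 6 * E6f (ee \<tau>)"
proof -
  have t0: "\<tau> \<noteq> 0" using assms by auto
  have "fps_nth (zeta_fps q) 5 = - (two_pi_i ^ 5) / 30240 * E6f q" for q
    unfolding zeta_fps_def fps_nth_Abs_fps cot_fps_nth by (simp add: E6f_def field_simps fact_numeral)
  hence "- (two_pi_i ^ 5) / 30240 * E6f (ee \<tau>) = - (two_pi_i ^ 5) / 30240 * E6f (ee (-1/\<tau>)) / \<tau> ^ Suc 5"
    using zeta_fps_transform[OF assms, of 5] by simp
  thus ?thesis using t0 by (simp add: field_simps)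
qed

section \<open>The eta function and forms of weight 11/2\<close>

definition uhp :: "complex set" where "uhp = {\<tau>. Im \<tau> > 0}"

lemma open_uhp [simp, intro]: "open uhp"
  unfolding uhp_def by (rule open_halfspace_Im_gt)

lemma connected_uhp: "connected uhp"
  unfolding uhp_def by (intro convex_connected convex_halfspace_Im_gt)

lemma uhp_nonzero [simp]: "\<tau> \<in> uhp \<Longrightarrow> \<tau> \<noteq> 0"
  by (auto simp: uhp_def)

lemma uhp_inv [intro]: "\<tau> \<in> uhp \<Longrightarrow> - 1 / \<tau> \<in> uhp"
  by (simp add: uhp_def Im_divide power2_eq_square sum_squares_gt_zero_iff)

lemma uhp_ee: "\<tau> \<in> uhp \<Longrightarrow> norm (ee \<tau>) < 1"
  by (simp add: uhp_def ee_im_lt_1)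

lemma ee_surj:
  assumes "q \<noteq> 0" "norm q < 1"
  obtains \<tau> where "\<tau> \<in> uhp" "ee \<tau> = q"
proof
  show 1: "ee (Ln q / two_pi_i) = q" using assms by (simp add: ee_eq_exp)
  show "Ln q / two_pi_i \<in> uhp"
  proof (rule ccontr)
    assume "Ln q / two_pi_i \<notin> uhp"
    hence "norm (ee (Ln q / two_pi_i)) \<ge> 1" by (simp add: uhp_def norm_ee mult_nonneg_nonpos)
    thus False using 1 assms by simp
  qed
qed

definition sigma_fps :: "nat \<Rightarrow> complex fps" where
  "sigma_fps k = Abs_fps (\<lambda>n. of_nat (\<Sum>d | d dvd n. d ^ k))"

lemma fps_conv_radius_geI:
  fixes F :: "complex fps"
  assumes "\<And>q. norm q < 1 \<Longrightarrow> summable (\<lambda>n. fps_nth F n * q ^ n)"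
  shows "fps_conv_radius F \<ge> 1"
  unfolding fps_conv_radius_def
proof (rule conv_radius_geI_ex)
  fix r :: real assume r: "0 < r" "ereal r < 1"
  show "\<exists>z. norm z = r \<and> summable (\<lambda>n. fps_nth F n * z ^ n)"
    using r assms[of "of_real r"] by (intro exI[of _ "of_real r"]) auto
qed

lemma norm_less_conv_radius:
  "fps_conv_radius F \<ge> 1 \<Longrightarrow> norm q < 1 \<Longrightarrow> ereal (norm q) < fps_conv_radius F"
  by (metis ereal_less(3) less_le_trans)

lemma sigma_fps: "fps_conv_radius (sigma_fps k) \<ge> 1" "norm q < 1 \<Longrightarrow> eval_fps (sigma_fps k) q = sigma_series k q"
proof -
  show "fps_conv_radius (sigma_fps k) \<ge> 1"
    by (rule fps_conv_radius_geI) (use lambert_sums in \<open>auto simp: sigma_fps_def sums_iff\<close>)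
  show "norm q < 1 \<Longrightarrow> eval_fps (sigma_fps k) q = sigma_series k q"
    by (simp add: eval_fps_def sigma_fps_def sigma_series_def)
qed

text \<open>
  The logarithm of the inverse of the Euler product.
\<close>

definition log_fps :: "complex fps" where
  "log_fps = Abs_fps (\<lambda>n. fps_nth (sigma_fps 1) n / of_nat n)"

lemma fps_conv_radius_log_fps: "fps_conv_radius log_fps \<ge> 1"
proof (rule fps_conv_radius_geI)
  fix q :: complex assume q: "norm q < 1"
  have "summable (\<lambda>n. norm (fps_nth (sigma_fps 1) n * q ^ n))"
    using norm_less_conv_radius[OF sigma_fps(1) q] by (rule norm_summable_fps)
  thus "summable (\<lambda>n. fps_nth log_fps n * q ^ n)"
  proof (rule summable_comparison_test')
    fix n :: nat
    have "norm (fps_nth (sigma_fps 1) n) / real n \<le> norm (fps_nth (sigma_fps 1) n)"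
      by (cases "n = 0") (auto simp: divide_le_eq mult_left_mono[of 1 _ "norm _", simplified])
    hence "norm (fps_nth (sigma_fps 1) n) / real n * norm q ^ n \<le> norm (fps_nth (sigma_fps 1) n) * norm q ^ n"
      by (rule mult_right_mono) simp
    thus "norm (fps_nth log_fps n * q ^ n) \<le> norm (fps_nth (sigma_fps 1) n * q ^ n)"
      by (simp add: log_fps_def norm_mult norm_divide norm_power)
  qed
qed

lemma log_fps_0 [simp]: "fps_nth log_fps 0 = 0" by (simp add: log_fps_def)

lemma X_deriv_log_fps: "fps_X * fps_deriv log_fps = sigma_fps 1"
proof (rule fps_ext)
  fix n show "fps_nth (fps_X * fps_deriv log_fps) n = fps_nth (sigma_fps 1) n"
    by (cases n) (auto simp: log_fps_def sigma_fps_def simp del: of_nat_Suc of_nat_sum)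
qed

text \<open>The exponential of the logarithm, in place of the product, makes nonvanishing and the
  logarithmic derivative immediate. The connection with the Euler product is
  \<open>represents_q_poch_inv\<close>.\<close>

definition eta :: "complex \<Rightarrow> complex" where
  "eta \<tau> = ee (\<tau> / 24) * exp (- eval_fps log_fps (ee \<tau>))"

lemma eta_nonzero [simp]: "eta \<tau> \<noteq> 0" by (simp add: eta_def)

lemma eta_add_1: "eta (\<tau> + 1) = ee (1 / 24) * eta \<tau>"
  by (simp add: eta_def add_divide_distrib ee_add)

lemma eta_has_field_derivative:
  assumes "\<tau> \<in> uhp"
  shows "(eta has_field_derivative two_pi_i / 24 * E2f (ee \<tau>) * eta \<tau>) (at \<tau>)"
proof -
  define s' where "s' = eval_fps (fps_deriv log_fps) (ee \<tau>)"
  have less: "ereal (norm (ee \<tau>)) < fps_conv_radius log_fps"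
    by (rule norm_less_conv_radius[OF fps_conv_radius_log_fps uhp_ee[OF assms]])
  have less': "ereal (norm (ee \<tau>)) < fps_conv_radius (fps_deriv log_fps)"
    using less fps_conv_radius_deriv less_le_trans by blast
  have "eval_fps (fps_X * fps_deriv log_fps) (ee \<tau>) = ee \<tau> * s'"
    unfolding s'_def by (subst eval_fps_mult) (use less' in auto)
  hence s': "ee \<tau> * s' = sigma_series 1 (ee \<tau>)"
    unfolding X_deriv_log_fps using sigma_fps(2)[OF uhp_ee[OF assms]] by simp
  have 1: "((\<lambda>\<tau>. eval_fps log_fps (ee \<tau>)) has_field_derivative (s' * (2 * of_real pi * \<i> * 1 * ee \<tau>))) (at \<tau>)"
    unfolding s'_def
    by (rule DERIV_chain2[where f = "eval_fps log_fps" and g = ee, OF has_field_derivative_eval_fps[OF less]])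
       (rule derivative_eq_intros refl | simp)+
  have "(eta has_field_derivative (2 * of_real pi * \<i> * (1 / 24) * ee (\<tau> / 24)) * exp (- eval_fps log_fps (ee \<tau>))
     + exp (- eval_fps log_fps (ee \<tau>)) * (- (s' * (2 * of_real pi * \<i> * 1 * ee \<tau>))) * ee (\<tau> / 24)) (at \<tau>)"
    unfolding eta_def[abs_def]
    by (rule derivative_eq_intros 1 refl | simp)+
  also have "(2 * of_real pi * \<i> * (1 / 24) * ee (\<tau> / 24)) * exp (- eval_fps log_fps (ee \<tau>))
     + exp (- eval_fps log_fps (ee \<tau>)) * (- (s' * (2 * of_real pi * \<i> * 1 * ee \<tau>))) * ee (\<tau> / 24)
     = eta \<tau> * (two_pi_i / 24 - two_pi_i * (ee \<tau> * s'))"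
    by (simp add: eta_def two_pi_i_def algebra_simps)
  also have "\<dots> = two_pi_i / 24 * E2f (ee \<tau>) * eta \<tau>"
    unfolding s' by (simp add: E2f_def algebra_simps)
  finally show ?thesis .
qed

lemma holomorphic_eta: "eta holomorphic_on uhp"
  unfolding holomorphic_on_open[OF open_uhp] using eta_has_field_derivative by blast

lemma Re_minus_i_mult: "Re (- \<i> * \<tau>) = Im \<tau>" by simp

lemma uhp_nonpos: "\<tau> \<in> uhp \<Longrightarrow> - \<i> * \<tau> \<notin> \<real>\<^sub>\<le>\<^sub>0"
  by (auto simp: uhp_def complex_nonpos_Reals_iff)

theorem eta_transform:
  assumes "\<tau> \<in> uhp"
  shows "eta (- 1 / \<tau>) = csqrt (- \<i> * \<tau>) * eta \<tau>"
proof -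
  define R where "R = (\<lambda>\<tau>. eta (- 1 / \<tau>) / (csqrt (- \<i> * \<tau>) * eta \<tau>))"
  have "(R has_field_derivative 0) (at \<tau>)" if t: "\<tau> \<in> uhp" for \<tau>
  proof -
    define c where "c = csqrt (- \<i> * \<tau>)"
    have c2: "c * c = - \<i> * \<tau>" unfolding c_def power2_eq_square[symmetric] by simp
    have t0: "\<tau> \<noteq> 0" "c \<noteq> 0" using t by (auto simp: c_def)
    have E: "E2f (ee (-1/\<tau>)) = \<tau> ^ 2 * E2f (ee \<tau>) + 12 * \<tau> / two_pi_i"
      by (rule E2f_transform) (use t in \<open>simp add: uhp_def\<close>)
    have 1: "((\<lambda>\<tau>. eta (- 1 / \<tau>)) has_field_derivative
      (two_pi_i / 24 * E2f (ee (-1/\<tau>)) * eta (-1/\<tau>)) * (1 / \<tau> ^ 2)) (at \<tau>)"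
      by (rule DERIV_chain2[where f = eta and g = "\<lambda>\<tau>. -1/\<tau>", OF eta_has_field_derivative[OF uhp_inv[OF t]]])
         (rule derivative_eq_intros refl | use t0 in \<open>simp add: power2_eq_square\<close>)+
    have 2: "((\<lambda>\<tau>. csqrt (- \<i> * \<tau>)) has_field_derivative (- \<i> / (2 * c))) (at \<tau>)"
      unfolding c_def by (rule derivative_eq_intros refl uhp_nonpos[OF t] | simp add: field_simps)+
    have 3: "((\<lambda>\<tau>. csqrt (- \<i> * \<tau>) * eta \<tau>) has_field_derivative
        (- \<i> / (2 * c)) * eta \<tau> + (two_pi_i / 24 * E2f (ee \<tau>) * eta \<tau>) * c) (at \<tau>)"
      unfolding c_def by (rule DERIV_mult[OF 2[unfolded c_def] eta_has_field_derivative[OF t]])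
    have "(R has_field_derivative
      ((two_pi_i / 24 * E2f (ee (-1/\<tau>)) * eta (-1/\<tau>)) * (1 / \<tau> ^ 2) * (c * eta \<tau>) -
       eta (-1/\<tau>) * ((- \<i> / (2 * c)) * eta \<tau> + (two_pi_i / 24 * E2f (ee \<tau>) * eta \<tau>) * c)) / ((c * eta \<tau>) * (c * eta \<tau>))) (at \<tau>)"
      unfolding R_def c_def
      by (rule DERIV_divide[OF 1 3[unfolded c_def]]) (use t0 in \<open>simp add: c_def\<close>)
    moreover have "((two_pi_i / 24 * E2f (ee (-1/\<tau>)) * eta (-1/\<tau>)) * (1 / \<tau> ^ 2) * (c * eta \<tau>) -
       eta (-1/\<tau>) * ((- \<i> / (2 * c)) * eta \<tau> + (two_pi_i / 24 * E2f (ee \<tau>) * eta \<tau>) * c)) = 0"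
    proof -
      \<comment> \<open>The defect of E2 contributes \<open>1 / (2 * \<tau>)\<close>, the
        logarithmic derivative of \<open>csqrt (- \<i> * \<tau>)\<close>; therefore the derivative
        of \<open>R\<close> vanishes.\<close>
      have "two_pi_i / 24 * E2f (ee (-1/\<tau>)) * (1 / \<tau> ^ 2) * c = two_pi_i / 24 * E2f (ee \<tau>) * c + c / (2 * \<tau>)"
        unfolding E using t0 by (simp add: field_simps power2_eq_square)
      moreover have "c / (2 * \<tau>) = - \<i> / (2 * c)"
        using c2 t0 by (simp add: field_simps)
      ultimately have *: "two_pi_i / 24 * E2f (ee (-1/\<tau>)) * (1 / \<tau> ^ 2) * c = two_pi_i / 24 * E2f (ee \<tau>) * c + - \<i> / (2 * c)"
        by simp
      have "(two_pi_i / 24 * E2f (ee (-1/\<tau>)) * eta (-1/\<tau>)) * (1 / \<tau> ^ 2) * (c * eta \<tau>) =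
        (two_pi_i / 24 * E2f (ee (-1/\<tau>)) * (1 / \<tau> ^ 2) * c) * (eta (-1/\<tau>) * eta \<tau>)"
        by (simp only: mult_ac)
      also have "\<dots> = (two_pi_i / 24 * E2f (ee \<tau>) * c + - \<i> / (2 * c)) * (eta (-1/\<tau>) * eta \<tau>)"
        unfolding * ..
      finally show ?thesis by (simp add: algebra_simps)
    qed
    ultimately show ?thesis by simp
  qed
  moreover have "continuous_on uhp R"
    unfolding continuous_on_eq_continuous_at[OF open_uhp] using calculation DERIV_isCont by blast
  ultimately obtain C where C: "\<And>\<tau>. \<tau> \<in> uhp \<Longrightarrow> R \<tau> = C"
    using DERIV_zero_connected_constant[OF connected_uhp open_uhp, of "{}" R] by auto
  \<comment> \<open>The constant is evaluated at the fixed point of the inversion, where the square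
    root is \<open>csqrt 1\<close>.\<close>
  have "\<i> \<in> uhp" by (simp add: uhp_def)
  moreover have "R \<i> = 1" by (simp add: R_def)
  ultimately have "R \<tau> = 1" using C assms by metis
  thus ?thesis using assms by (auto simp: R_def)
qed

text \<open>The laws of E6 / eta under the two generators. The minus sign is the sixth power of
  \<open>\<i>\<close>, from \<open>\<tau> = \<i> * csqrt (- \<i> * \<tau>) ^ 2\<close>. Behaviour at
  infinity is left to \<open>has_qexp\<close>.\<close>

definition weight_11_2 :: "(complex \<Rightarrow> complex) \<Rightarrow> bool" where
  "weight_11_2 \<phi> \<longleftrightarrow> \<phi> holomorphic_on uhp \<and> (\<forall>\<tau>\<in>uhp. \<phi> (\<tau> + 1) = ee (- 1 / 24) * \<phi> \<tau>) \<and>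
     (\<forall>\<tau>\<in>uhp. \<phi> (- 1 / \<tau>) = - (csqrt (- \<i> * \<tau>) ^ 11) * \<phi> \<tau>)"

text \<open>Index \<open>n\<close> stands for the exponent \<open>n - 1 / 24\<close>. Unconditional
  summation over all integers permits reindexing and puts no bound on the pole order.\<close>

definition has_qexp :: "(complex \<Rightarrow> complex) \<Rightarrow> (int \<Rightarrow> complex) \<Rightarrow> bool" where
  "has_qexp \<phi> a \<longleftrightarrow> (\<forall>\<tau>\<in>uhp. ((\<lambda>n. a n * ee ((of_int n - 1 / 24) * \<tau>)) has_sum \<phi> \<tau>) UNIV)"

text \<open>Below height 1/2, a translation to real part at most 1/2 in absolute value makes the
  squared modulus at most 1/2, and inversion then at least doubles the imaginary part. From height
  \<open>(1 / 2) ^ n\<close> on, at most \<open>n\<close> such rounds are needed.\<close>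

lemma reduce_Im:
  assumes per: "\<And>\<tau>. \<tau> \<in> uhp \<Longrightarrow> g (\<tau> + 1) = (g \<tau> :: complex)"
    and inv: "\<And>\<tau>. \<tau> \<in> uhp \<Longrightarrow> g (- 1 / \<tau>) = g \<tau>" and \<tau>: "\<tau> \<in> uhp"
  shows "\<exists>\<tau>'\<in>uhp. Im \<tau>' \<ge> 1 / 2 \<and> g \<tau>' = g \<tau>"
proof -
  have shift: "g (\<tau> + of_int n) = g \<tau>" if "\<tau> \<in> uhp" for \<tau> and n :: int
  proof (induction n rule: int_induct[where k = 0])
    case (step1 i) thus ?case using per[of "\<tau> + of_int i"] that by (simp add: add_ac uhp_def)
  next
    case (step2 i) thus ?case using per[of "\<tau> + of_int (i - 1)"] that by (simp add: add_ac uhp_def)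
  qed auto
  have *: "\<exists>\<tau>'\<in>uhp. Im \<tau>' \<ge> 1 / 2 \<and> g \<tau>' = g \<tau>" if "\<tau> \<in> uhp" "Im \<tau> \<ge> (1 / 2) ^ n" for n \<tau>
    using that
  proof (induction n arbitrary: \<tau>)
    case 0
    thus ?case by (intro bexI[of _ \<tau>]) auto
  next
    case (Suc n)
    show ?case
    proof (cases "Im \<tau> \<ge> 1 / 2")
      case False
      define \<sigma> where "\<sigma> = \<tau> + of_int (- round (Re \<tau>))"
      have \<sigma>: "\<sigma> \<in> uhp" "g \<sigma> = g \<tau>" using Suc.prems(1) shift[OF Suc.prems(1), of "- round (Re \<tau>)"] by (simp_all add: \<sigma>_def uhp_def)
      have im: "Im \<sigma> = Im \<tau>" by (simp add: \<sigma>_def)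
      have "\<bar>Re \<sigma>\<bar> \<le> 1 / 2" using of_int_round_abs_le[of "Re \<tau>"] by (simp add: \<sigma>_def abs_minus_commute)
      hence "(Re \<sigma>)\<^sup>2 \<le> (1 / 2)\<^sup>2" using power_mono[of "\<bar>Re \<sigma>\<bar>" "1 / 2" 2] by simp
      moreover have "(Im \<sigma>)\<^sup>2 \<le> (1 / 2)\<^sup>2"
        using False \<sigma>(1) im by (intro power_mono) (auto simp: uhp_def)
      ultimately have n: "(Re \<sigma>)\<^sup>2 + (Im \<sigma>)\<^sup>2 \<le> 1 / 2" by (simp add: power2_eq_square)
      have pos: "0 < (Re \<sigma>)\<^sup>2 + (Im \<sigma>)\<^sup>2" using \<sigma>(1) by (simp add: uhp_def sum_power2_gt_zero_iff)
      have "Im (- 1 / \<sigma>) = Im \<sigma> / ((Re \<sigma>)\<^sup>2 + (Im \<sigma>)\<^sup>2)" by (simp add: Im_divide)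
      also have "\<dots> \<ge> Im \<sigma> / (1 / 2)"
        using n pos \<sigma>(1) by (intro divide_left_mono mult_pos_pos) (auto simp: uhp_def)
      finally have "Im (- 1 / \<sigma>) \<ge> (1 / 2) ^ n" using Suc.prems(2) im by simp
      then obtain \<tau>' where "\<tau>' \<in> uhp" "Im \<tau>' \<ge> 1 / 2" "g \<tau>' = g (- 1 / \<sigma>)"
        using Suc.IH[OF uhp_inv[OF \<sigma>(1)]] by auto
      thus ?thesis using inv[OF \<sigma>(1)] \<sigma>(2) by auto
    qed (use Suc.prems in auto)
  qed
  obtain n where "(1 / 2) ^ n < Im \<tau>"
    using real_arch_pow_inv[of "Im \<tau>" "1/2"] \<tau> by (auto simp: uhp_def)
  thus ?thesis using *[OF \<tau>, of n] by simp
qed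

text \<open>
  The square of a form divided by \<open>\<eta>\<^sup>2\<^sup>2\<close> has weight \<open>0\<close> and is a holomorphic function of \<open>q\<close> vanishing at
  \<open>q = 0\<close>. By reduction of the imaginary part it attains the maximum of its modulus inside the disc.
\<close>

theorem weight_11_2_zero:
  assumes st: "weight_11_2 \<phi>" and hq: "has_qexp \<phi> a" and a0: "\<And>n. n \<le> 0 \<Longrightarrow> a n = 0"
  shows "a n = 0"
proof -
  define b where "b = (\<lambda>m::nat. a (int m + 1))"
  define A where "A = Abs_fps b"
  have b: "(\<lambda>m. b m * ee \<tau> ^ m) sums (\<phi> \<tau> * ee (- (23 / 24) * \<tau>))" if "\<tau> \<in> uhp" for \<tau>
  proof -
    have "((\<lambda>n. a n * ee ((of_int n - 1 / 24) * \<tau>)) has_sum \<phi> \<tau>) UNIV"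
      using hq that by (auto simp: has_qexp_def)
    hence "((\<lambda>n. a n * ee ((of_int n - 1 / 24) * \<tau>)) has_sum \<phi> \<tau>) {1..}"
      by (rule has_sum_cong_neutral[THEN iffD1, rotated -1]) (auto simp: a0)
    moreover have "bij_betw (\<lambda>m::nat. int m + 1) UNIV {1..}"
      by (rule bij_betwI[of _ _ _ "\<lambda>n. nat (n - 1)"]) auto
    ultimately have "((\<lambda>m. b m * ee ((of_int (int m + 1) - 1 / 24) * \<tau>)) has_sum \<phi> \<tau>) UNIV"
      unfolding b_def by (subst has_sum_reindex_bij_betw[where g = "\<lambda>m::nat. int m + 1" and B = "{1..}"
         and f = "\<lambda>n. a n * ee ((of_int n - 1 / 24) * \<tau>)"]) auto
    hence "((\<lambda>m. b m * ee ((of_int (int m + 1) - 1 / 24) * \<tau>) * ee (- (23 / 24) * \<tau>)) has_sum \<phi> \<tau> * ee (- (23 / 24) * \<tau>)) UNIV"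
      by (rule has_sum_cmult_left)
    also have "(\<lambda>m. b m * ee ((of_int (int m + 1) - 1 / 24) * \<tau>) * ee (- (23 / 24) * \<tau>)) = (\<lambda>m. b m * ee \<tau> ^ m)"
    proof
      fix m
      have "(of_int (int m + 1) - 1 / 24) * \<tau> + - (23 / 24) * \<tau> = of_nat m * \<tau>"
        by (simp add: algebra_simps)
      thus "b m * ee ((of_int (int m + 1) - 1 / 24) * \<tau>) * ee (- (23 / 24) * \<tau>) = b m * ee \<tau> ^ m"
        unfolding mult.assoc ee_add[symmetric] ee_of_nat_mult[symmetric] by simp
    qed
    finally show ?thesis by (rule has_sum_imp_sums)
  qed
  have "summable (\<lambda>n. fps_nth A n * q ^ n)" if q: "norm q < 1" for q
  proof (cases "q = 0")
    case False
    then obtain \<tau> where "\<tau> \<in> uhp" "ee \<tau> = q" using q ee_surj by metis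
    thus ?thesis using b by (auto simp: A_def sums_iff)
  qed auto
  hence rad: "fps_conv_radius A \<ge> 1" by (rule fps_conv_radius_geI)
  have phi: "\<phi> \<tau> = ee (23 / 24 * \<tau>) * eval_fps A (ee \<tau>)" if "\<tau> \<in> uhp" for \<tau>
  proof -
    have "eval_fps A (ee \<tau>) = \<phi> \<tau> * ee (- (23 / 24) * \<tau>)"
      using b[OF that] by (simp add: eval_fps_def A_def sums_iff)
    moreover have "ee (23 / 24 * \<tau>) * ee (- (23 / 24) * \<tau>) = 1" by (simp flip: ee_add)
    ultimately show ?thesis by simp
  qed
  \<comment> \<open>The exponents of \<open>\<phi> ^ 2\<close> start at 46/24 and that of
    \<open>eta ^ 22\<close> is 22/24, whence the explicit factor \<open>q\<close>; both have weight
    11.\<close>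
  define G where "G = (\<lambda>q. q * eval_fps A q ^ 2 * exp (22 * eval_fps log_fps q))"
  have Ghol: "G holomorphic_on ball 0 1"
  proof -
    have "ball 0 1 \<subseteq> eball (0::complex) (fps_conv_radius A)" "ball 0 1 \<subseteq> eball (0::complex) (fps_conv_radius log_fps)"
      by (auto intro!: norm_less_conv_radius rad fps_conv_radius_log_fps)
    thus ?thesis unfolding G_def by (intro holomorphic_intros)
  qed
  have G: "G (ee \<tau>) = \<phi> \<tau> ^ 2 / eta \<tau> ^ 22" if "\<tau> \<in> uhp" for \<tau>
  proof -
    have 1: "eta \<tau> ^ 22 = ee (22 / 24 * \<tau>) * exp (- 22 * eval_fps log_fps (ee \<tau>))"
      using exp_of_nat_mult[of 22 "- eval_fps log_fps (ee \<tau>)"] ee_of_nat_mult[of 22 "\<tau> / 24"]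
      by (simp add: eta_def power_mult_distrib)
    have 2: "\<phi> \<tau> ^ 2 = ee (46 / 24 * \<tau>) * eval_fps A (ee \<tau>) ^ 2"
      using ee_of_nat_mult[of 2 "23 / 24 * \<tau>"] phi[OF that] by (simp add: power_mult_distrib)
    have "ee (46 / 24 * \<tau>) = ee \<tau> * ee (22 / 24 * \<tau>)"
      unfolding ee_add[symmetric] by (rule arg_cong[where f = ee]) (simp add: algebra_simps)
    thus ?thesis unfolding 1 2 G_def by (simp add: exp_minus field_simps)
  qed
  define g where "g = (\<lambda>\<tau>. \<phi> \<tau> ^ 2 / eta \<tau> ^ 22)"
  have per: "g (\<tau> + 1) = g \<tau>" if "\<tau> \<in> uhp" for \<tau>
  proof -
    have "\<tau> + 1 \<in> uhp" using that by (simp add: uhp_def)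
    thus ?thesis using G[OF that] G[of "\<tau> + 1"] by (simp add: g_def ee_add)
  qed
  have inv: "g (- 1 / \<tau>) = g \<tau>" if t: "\<tau> \<in> uhp" for \<tau>
  proof -
    have 1: "\<phi> (- 1 / \<tau>) = - (csqrt (- \<i> * \<tau>) ^ 11) * \<phi> \<tau>" using st t by (auto simp: weight_11_2_def)
    have "csqrt (- \<i> * \<tau>) \<noteq> 0" using t by auto
    moreover have "(c ^ 11) ^ 2 = c ^ 22" for c :: complex by (simp flip: power_mult)
    ultimately show ?thesis
      unfolding g_def 1 eta_transform[OF t] power_mult_distrib by simp
  qed
  \<comment> \<open>The modulus of \<open>ee \<tau>\<close> at height 1/2.\<close>
  define r where "r = exp (- pi)"
  have r: "0 < r" "r < 1" by (simp_all add: r_def)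
  have red: "\<exists>q'\<in>cball 0 r. G q' = G q" if q: "norm q < 1" for q
  proof (cases "q = 0")
    case False
    then obtain \<tau> where \<tau>: "\<tau> \<in> uhp" "ee \<tau> = q" using q ee_surj by metis
    obtain \<tau>' where \<tau>': "\<tau>' \<in> uhp" "Im \<tau>' \<ge> 1 / 2" "g \<tau>' = g \<tau>"
      using reduce_Im[of g, OF per inv \<tau>(1)] by blast
    have "pi * 1 \<le> pi * (2 * Im \<tau>')" using \<tau>'(2) by (intro mult_left_mono) auto
    hence "ee \<tau>' \<in> cball 0 r" by (simp add: norm_ee r_def mult_ac)
    moreover have "G (ee \<tau>') = G q"
      using G[OF \<tau>'(1)] G[OF \<tau>(1)] \<tau>(2) \<tau>'(3) by (simp add: g_def)
    ultimately show ?thesis by blast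
  qed (use r in auto)
  have "continuous_on (cball 0 r) G"
    using holomorphic_on_imp_continuous_on[OF Ghol] r by (rule_tac continuous_on_subset) auto
  hence "continuous_on (cball 0 r) (\<lambda>q. norm (G q))" by (rule continuous_on_norm)
  moreover have "compact (cball (0::complex) r)" "cball (0::complex) r \<noteq> {}" using r by auto
  ultimately obtain \<xi> where \<xi>: "\<xi> \<in> cball 0 r" "\<And>q. q \<in> cball 0 r \<Longrightarrow> norm (G q) \<le> norm (G \<xi>)"
    using continuous_attains_sup[of "cball (0::complex) r" "\<lambda>q. norm (G q)"] by blast
  have "norm (G q) \<le> norm (G \<xi>)" if "q \<in> ball 0 1" for q
  proof -
    have "norm q < 1" using that by simp
    from red[OF this] obtain q' where q': "q' \<in> cball 0 r" "G q' = G q" by blast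
    show ?thesis using \<xi>(2)[OF q'(1)] q'(2) by simp
  qed
  hence "G constant_on ball 0 1"
    by (intro maximum_modulus_principle[OF Ghol, of "ball 0 1" \<xi>]) (use \<xi>(1) r in auto)
  moreover have "G 0 = 0" by (simp add: G_def)
  ultimately have G0: "G q = 0" if "norm q < 1" for q
    using that by (auto simp: constant_on_def)
  \<comment> \<open>The factor \<open>fps_X\<close> takes care of the point 0, where
    \<open>G\<close> vanishes whatever \<open>A\<close> is.\<close>
  have "fps_X * A = 0"
  proof (rule eval_fps_eqD)
    have "1 \<le> min (fps_conv_radius (fps_X :: complex fps)) (fps_conv_radius A)" using rad by simp
    also have "\<dots> \<le> fps_conv_radius (fps_X * A)" by (rule fps_conv_radius_mult)
    finally show "fps_conv_radius (fps_X * A) > 0"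
      by (rule less_le_trans[rotated]) simp
    show "\<forall>\<^sub>F z in nhds 0. eval_fps (fps_X * A) z = eval_fps 0 z"
    proof (rule eventually_mono[OF eventually_nhds_in_open[of "ball 0 1"]])
      fix z :: complex assume z: "z \<in> ball 0 1"
      hence "eval_fps (fps_X * A) z = z * eval_fps A z"
        by (subst eval_fps_mult) (auto intro!: norm_less_conv_radius rad)
      thus "eval_fps (fps_X * A) z = eval_fps 0 z" using G0[of z] z by (auto simp: G_def)
    qed auto
  qed auto
  hence "fps_nth A m = 0" for m by (metis fps_X_neq_zero mult_eq_0_iff fps_zero_nth)
  hence "b m = 0" for m by (simp add: A_def)
  from this[of "nat (n - 1)"] show ?thesis
    using a0[of n] by (cases "n \<le> 0") (auto simp: b_def)
qed

section \<open>Forms with prescribed principal part\<close>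

definition complex_fps :: "int fps \<Rightarrow> complex fps" where
  "complex_fps F = Abs_fps (\<lambda>n. of_int (fps_nth F n))"

lemma complex_fps_mult: "complex_fps (F * G) = complex_fps F * complex_fps G"
  by (rule fps_ext) (simp add: complex_fps_def fps_mult_nth)

lemma complex_fps_1: "complex_fps 1 = 1"
  by (rule fps_ext) (simp add: complex_fps_def)

definition represents :: "int fps \<Rightarrow> (complex \<Rightarrow> complex) \<Rightarrow> bool" where
  "represents F f \<longleftrightarrow> fps_conv_radius (complex_fps F) \<ge> 1 \<and> (\<forall>q. norm q < 1 \<longrightarrow> eval_fps (complex_fps F) q = f q)"

lemma represents_mult: "represents F f \<Longrightarrow> represents G g \<Longrightarrow> represents (F * G) (\<lambda>q. f q * g q)"
  unfolding represents_def complex_fps_mult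
proof safe
  assume "1 \<le> fps_conv_radius (complex_fps F)" "1 \<le> fps_conv_radius (complex_fps G)"
  thus "1 \<le> fps_conv_radius (complex_fps F * complex_fps G)"
    using fps_conv_radius_mult[of "complex_fps F" "complex_fps G"] by (meson min.boundedI order_trans)
qed (auto simp: eval_fps_mult norm_less_conv_radius)

lemma represents_power: "represents F f \<Longrightarrow> represents (F ^ n) (\<lambda>q. f q ^ n)"
proof (induction n)
  case 0 thus ?case by (simp add: represents_def complex_fps_1)
qed (auto intro: represents_mult)

lemma represents_E6: "represents E6 E6f"
proof -
  have "complex_fps E6 = 1 - fps_const 504 * sigma_fps 5"
    by (rule fps_ext) (auto simp: complex_fps_def E6_def sigma_fps_def sigma5_def)
  moreover have "fps_conv_radius (fps_const 504 * sigma_fps 5 :: complex fps) = fps_conv_radius (sigma_fps 5)"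
    by (rule fps_conv_radius_cmult_left) simp
  moreover note sigma_fps(1)[of 5]
  moreover have "min (fps_conv_radius (1 :: complex fps)) (fps_conv_radius (fps_const 504 * sigma_fps 5)) \<le> fps_conv_radius (1 - fps_const 504 * sigma_fps 5)"
    by (rule fps_conv_radius_diff)
  ultimately show ?thesis
    unfolding represents_def
    by (auto simp: E6f_def eval_fps_diff eval_fps_mult norm_less_conv_radius sigma_fps(2))
qed

definition q_poch_inv :: "int fps" where "q_poch_inv = fps_right_inverse q_poch 1"

lemma q_poch_times_inv: "q_poch * q_poch_inv = 1"
  unfolding q_poch_inv_def by (rule fps_right_inverse) (simp add: q_poch_nth_0)

lemma e6_fps_eq: "e6_fps = E6 * q_poch_inv"
  using q_poch_times_inv e6_fps_times_q_poch by (metis mult.assoc mult.right_neutral)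

definition sigma_int_fps :: "int fps" where
  "sigma_int_fps = Abs_fps (\<lambda>n. int (\<Sum>d | d dvd n. d))"

text \<open>Each factor \<open>1 - fps_X ^ m\<close> contributes
  \<open>- m * fps_X ^ m / (1 - fps_X ^ m)\<close> to the logarithmic derivative (\<open>H i\<close>
  below, with \<open>m = Suc i\<close>, up to sign), and these series add up to the divisor sums.
  The passage to the limit is exact: coefficient \<open>n\<close> of the product is that of the
  partial product \<open>P n\<close>.\<close>

lemma X_deriv_q_poch: "fps_X * fps_deriv q_poch = - (sigma_int_fps * q_poch)"
proof -
  define P :: "nat \<Rightarrow> int fps" where "P = (\<lambda>m. \<Prod>i\<le>m. 1 - fps_X ^ Suc i)"
  define H :: "nat \<Rightarrow> int fps" where "H = (\<lambda>i. Abs_fps (\<lambda>n. if n > 0 \<and> Suc i dvd n then int (Suc i) else 0))"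
  have lim: "P \<longlonglongrightarrow> q_poch"
    unfolding P_def by (rule has_prod_imp_tendsto[OF q_poch_has_prod])
  have step: "fps_nth (P (Suc m)) n = fps_nth (P m) n" if "n \<le> m" for m n
  proof -
    have "P (Suc m) = P m - P m * fps_X ^ Suc (Suc m)"
      by (simp add: P_def algebra_simps)
    then show ?thesis using that by (simp add: fps_X_power_mult_right_nth del: power_Suc)
  qed
  have stable: "fps_nth (P m) n = fps_nth (P n) n" if "n \<le> m" for m n
    using that by (induction m rule: dec_induct) (auto simp: step)
  have coeff: "fps_nth (P m) n = fps_nth q_poch n" if "n \<le> m" for m n
  proof -
    have "eventually (\<lambda>m. fps_nth (P m) n = fps_nth q_poch n) sequentially"
      using lim by (simp add: tendsto_fps_iff)
    then obtain N where "\<And>m. m \<ge> N \<Longrightarrow> fps_nth (P m) n = fps_nth q_poch n"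
      by (auto simp: eventually_sequentially)
    from this[of "max n N"] show ?thesis using stable[of n "max n N"] stable[OF that] by simp
  qed
  have H: "H i * (1 - fps_X ^ Suc i) = fps_const (int (Suc i)) * fps_X ^ Suc i" for i
  proof (rule fps_ext)
    fix n
    have "fps_nth (H i * (1 - fps_X ^ Suc i)) n = fps_nth (H i) n - (if n < Suc i then 0 else fps_nth (H i) (n - Suc i))"
      by (simp add: ring_distribs fps_X_power_mult_right_nth del: power_Suc)
    also have "\<dots> = (if n = Suc i then int (Suc i) else 0)"
    proof -
      consider "n < Suc i" | "n = Suc i" | "n > Suc i" by linarith
      thus ?thesis
      proof cases
        case 1 thus ?thesis by (auto simp: H_def dest: dvd_imp_le)
      next
        case 2 thus ?thesis by (simp add: H_def)
      next
        case 3
        hence "Suc i dvd n - Suc i \<longleftrightarrow> Suc i dvd n" by (auto simp: dvd_minus_self)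
        thus ?thesis using 3 by (simp add: H_def)
      qed
    qed
    also have "\<dots> = fps_nth (fps_const (int (Suc i)) * fps_X ^ Suc i) n"
      by (simp del: power_Suc of_nat_Suc)
    finally show "fps_nth (H i * (1 - fps_X ^ Suc i)) n = fps_nth (fps_const (int (Suc i)) * fps_X ^ Suc i) n" .
  qed
  have dX: "fps_X * fps_deriv (1 - fps_X ^ Suc i) = - (H i * (1 - fps_X ^ Suc i))" for i
  proof -
    have "fps_X * fps_deriv (1 - fps_X ^ Suc i) = - (fps_const (int (Suc i)) * (fps_X * fps_X ^ i))"
      by (simp add: fps_deriv_power mult_ac del: power_Suc of_nat_Suc)
    thus ?thesis unfolding H by simp
  qed
  have der: "fps_X * fps_deriv (P m) = - ((\<Sum>i\<le>m. H i) * P m)" for m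
  proof (induction m)
    case 0 show ?case using dX[of 0] by (simp add: P_def)
  next
    case (Suc m)
    define T where "T = (1 - fps_X ^ Suc (Suc m) :: int fps)"
    have P: "P (Suc m) = P m * T" by (simp add: P_def T_def)
    have "fps_X * fps_deriv (P (Suc m)) = (fps_X * fps_deriv (P m)) * T + P m * (fps_X * fps_deriv T)"
      unfolding P by (simp add: algebra_simps)
    also have "\<dots> = - ((\<Sum>i\<le>m. H i) * P m) * T + P m * (- (H (Suc m) * T))"
      unfolding Suc.IH dX[of "Suc m", folded T_def] ..
    finally show ?case by (simp add: P algebra_simps)
  qed
  show ?thesis
  proof (rule fps_ext)
    fix n
    have sig: "fps_nth (\<Sum>i\<le>n. H i) k = fps_nth sigma_int_fps k" if "k \<le> n" for k
    proof (cases "k = 0")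
      case False
      have "fps_nth (\<Sum>i\<le>n. H i) k = (\<Sum>i\<le>n. if Suc i dvd k then int (Suc i) else 0)"
        using False by (simp add: fps_sum_nth H_def)
      also have "\<dots> = (\<Sum>i | i \<le> n \<and> Suc i dvd k. int (Suc i))"
        by (intro sum.mono_neutral_cong_right) auto
      also have "\<dots> = (\<Sum>d | d dvd k. int d)"
      proof (rule sum.reindex_bij_witness[of _ "\<lambda>d. d - 1" Suc])
        fix d assume "d \<in> {d. d dvd k}"
        hence "d dvd k" "d > 0" "d \<le> k" using False by (auto intro!: Nat.gr0I dest: dvd_imp_le)
        thus "Suc (d - 1) = d" "d - 1 \<in> {i. i \<le> n \<and> Suc i dvd k}"
          using that by auto
      qed auto
      finally show ?thesis by (simp add: sigma_int_fps_def)
    qed (auto simp: fps_sum_nth H_def sigma_int_fps_def)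
    have "fps_nth (fps_X * fps_deriv q_poch) n = fps_nth (fps_X * fps_deriv (P n)) n"
      by (cases n) (auto simp: coeff)
    also have "\<dots> = - (\<Sum>k=0..n. fps_nth (\<Sum>i\<le>n. H i) k * fps_nth (P n) (n - k))"
      unfolding der by (simp add: fps_mult_nth)
    also have "\<dots> = - (\<Sum>k=0..n. fps_nth sigma_int_fps k * fps_nth q_poch (n - k))"
      by (intro arg_cong[where f = uminus] sum.cong refl) (simp add: sig coeff)
    finally show "fps_nth (fps_X * fps_deriv q_poch) n = fps_nth (- (sigma_int_fps * q_poch)) n"
      by (simp add: fps_mult_nth)
  qed
qed

lemma X_deriv_q_poch_inv: "fps_X * fps_deriv q_poch_inv = sigma_int_fps * q_poch_inv"
proof -
  have "0 = fps_X * fps_deriv (q_poch * q_poch_inv)" by (simp add: q_poch_times_inv)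
  also have "\<dots> = (fps_X * fps_deriv q_poch) * q_poch_inv + q_poch * (fps_X * fps_deriv q_poch_inv)"
    by (simp add: algebra_simps)
  also have "\<dots> = q_poch * (fps_X * fps_deriv q_poch_inv - sigma_int_fps * q_poch_inv)"
    unfolding X_deriv_q_poch by (simp add: algebra_simps)
  finally have "q_poch_inv * (q_poch * (fps_X * fps_deriv q_poch_inv - sigma_int_fps * q_poch_inv)) = 0" by simp
  hence "(q_poch * q_poch_inv) * (fps_X * fps_deriv q_poch_inv - sigma_int_fps * q_poch_inv) = 0" by (simp add: mult_ac)
  thus ?thesis unfolding q_poch_times_inv by simp
qed

text \<open>In degree \<open>n\<close> the equation expresses \<open>n\<close> times the coefficient
  through coefficients of smaller index, because \<open>S\<close> has no constant term; so the
  constant term determines the solution.\<close>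

lemma log_ode_unique:
  fixes F G S :: "complex fps"
  assumes "fps_X * fps_deriv F = S * F" "fps_X * fps_deriv G = S * G" "fps_nth S 0 = 0"
    "fps_nth F 0 = fps_nth G 0"
  shows "F = G"
proof (rule fps_ext)
  fix n show "fps_nth F n = fps_nth G n"
  proof (induction n rule: less_induct)
    case (less n)
    show ?case
    proof (cases "n = 0")
      case False
      have rec: "of_nat n * fps_nth T n = (\<Sum>k=0..n. fps_nth S k * fps_nth T (n - k))"
        if "fps_X * fps_deriv T = S * T" for T
      proof -
        have "fps_nth (fps_X * fps_deriv T) n = of_nat n * fps_nth T n" using False by (cases n) auto
        thus ?thesis unfolding that fps_mult_nth by simp
      qed
      have "of_nat n * fps_nth F n = of_nat n * fps_nth G n"
        unfolding rec[OF assms(1)] rec[OF assms(2)]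
      proof (intro sum.cong refl)
        fix k assume "k \<in> {0..n}"
        thus "fps_nth S k * fps_nth F (n - k) = fps_nth S k * fps_nth G (n - k)"
          using less[of "n - k"] assms(3) False by (cases "k = 0") auto
      qed
      thus ?thesis using False by simp
    qed (use assms in auto)
  qed
qed

text \<open>Both series have the logarithmic derivative given by the divisor sums, and constant term
  1. This identifies the formal inverse of the Euler product with an analytic function on the
  disc.\<close>

lemma represents_q_poch_inv: "represents q_poch_inv (\<lambda>q. exp (eval_fps log_fps q))"
proof -
  define R where "R = (fps_exp 1 oo log_fps :: complex fps)"
  have s: "eval_fps log_fps has_fps_expansion log_fps"
    by (rule eval_fps_has_fps_expansion) (rule less_le_trans[OF _ fps_conv_radius_log_fps], simp)
  have "(exp \<circ> eval_fps log_fps) has_fps_expansion R"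
    unfolding R_def by (rule has_fps_expansion_compose[OF has_fps_expansion_exp1 s]) simp
  hence R: "(\<lambda>q. exp (eval_fps log_fps q)) has_fps_expansion R" by (simp add: o_def)
  have "fps_X * fps_deriv R = sigma_fps 1 * R"
    unfolding R_def X_deriv_log_fps[symmetric] by (simp add: fps_compose_deriv mult_ac)
  moreover have "fps_X * fps_deriv (complex_fps q_poch_inv) = sigma_fps 1 * complex_fps q_poch_inv"
  proof -
    have "complex_fps (fps_X * fps_deriv q_poch_inv) = fps_X * fps_deriv (complex_fps q_poch_inv)"
    proof (rule fps_ext)
      fix n show "fps_nth (complex_fps (fps_X * fps_deriv q_poch_inv)) n = fps_nth (fps_X * fps_deriv (complex_fps q_poch_inv)) n"
        by (cases n) (auto simp: complex_fps_def)
    qed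
    moreover have "complex_fps sigma_int_fps = sigma_fps 1"
      by (rule fps_ext) (simp add: complex_fps_def sigma_int_fps_def sigma_fps_def)
    ultimately show ?thesis using arg_cong[OF X_deriv_q_poch_inv, of complex_fps] by (simp add: complex_fps_mult)
  qed
  moreover have "fps_nth R 0 = fps_nth (complex_fps q_poch_inv) 0"
    by (simp add: R_def complex_fps_def q_poch_inv_def)
  ultimately have eq: "R = complex_fps q_poch_inv"
    by (intro log_ode_unique[of R "sigma_fps 1"]) (auto simp: sigma_fps_def)
  have hol: "(\<lambda>q. exp (eval_fps log_fps q)) holomorphic_on eball 0 1"
  proof -
    have "eball 0 1 \<subseteq> eball (0::complex) (fps_conv_radius log_fps)"
      by (rule eball_mono[OF fps_conv_radius_log_fps])
    thus ?thesis by (intro holomorphic_intros)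
  qed
  have "fps_conv_radius R \<ge> 1"
    by (rule holomorphic_on_imp_fps_conv_radius_ge[OF R hol])
  moreover have "eval_fps R q = exp (eval_fps log_fps q)" if "norm q < 1" for q
    using has_fps_expansion_imp_sums_complex[OF R hol, of q] that
    by (simp add: eval_fps_def sums_iff one_ereal_def)
  ultimately show ?thesis unfolding represents_def eq[symmetric] by auto
qed

lemma represents_imp_has_qexp:
  assumes "represents F f"
  shows "has_qexp (\<lambda>\<tau>. ee (- (\<tau> / 24)) * f (ee \<tau>) * inverse (ee \<tau> ^ m))
    (\<lambda>n. if n < - int m then 0 else of_int (fps_nth F (nat (n + int m))))"
  unfolding has_qexp_def
proof safe
  fix \<tau> assume t: "\<tau> \<in> uhp"
  have n: "norm (ee \<tau>) < 1" by (rule uhp_ee[OF t])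
  have less: "ereal (norm (ee \<tau>)) < fps_conv_radius (complex_fps F)"
    using assms n by (auto simp: represents_def intro: norm_less_conv_radius)
  have "((\<lambda>k. fps_nth (complex_fps F) k * ee \<tau> ^ k) has_sum f (ee \<tau>)) UNIV"
  proof (rule norm_summable_imp_has_sum)
    show "summable (\<lambda>k. norm (fps_nth (complex_fps F) k * ee \<tau> ^ k))" by (rule norm_summable_fps[OF less])
    show "(\<lambda>k. fps_nth (complex_fps F) k * ee \<tau> ^ k) sums f (ee \<tau>)"
      using sums_eval_fps[OF less] assms n by (simp add: represents_def)
  qed
  hence "((\<lambda>k. (ee (- (\<tau> / 24)) * inverse (ee \<tau> ^ m)) * (fps_nth (complex_fps F) k * ee \<tau> ^ k)) has_sum
     ((ee (- (\<tau> / 24)) * inverse (ee \<tau> ^ m)) * f (ee \<tau>))) UNIV"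
    by (rule has_sum_cmult_right)
  also have "?this \<longleftrightarrow> ((\<lambda>n. of_int (fps_nth F (nat (n + int m))) * ee ((of_int n - 1 / 24) * \<tau>)) has_sum
     ((ee (- (\<tau> / 24)) * inverse (ee \<tau> ^ m)) * f (ee \<tau>))) {- int m..}"
  proof (rule has_sum_reindex_bij_witness[of _ "\<lambda>n. nat (n + int m)" "\<lambda>k. int k - int m"])
    fix k :: nat
    have "(of_int (int k - int m) - 1 / 24) * \<tau> = - (\<tau> / 24) + (- (of_nat m * \<tau>) + of_nat k * \<tau>)"
      by (simp add: algebra_simps)
    hence "ee ((of_int (int k - int m) - 1 / 24) * \<tau>) = ee (- (\<tau> / 24)) * (inverse (ee \<tau> ^ m) * ee \<tau> ^ k)"
      by (simp only: ee_add ee_minus ee_of_nat_mult)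
    thus "of_int (fps_nth F (nat (int k - int m + int m))) * ee ((of_int (int k - int m) - 1 / 24) * \<tau>) =
      (ee (- (\<tau> / 24)) * inverse (ee \<tau> ^ m)) * (fps_nth (complex_fps F) k * ee \<tau> ^ k)"
      by (simp add: complex_fps_def)
  qed auto
  also have "\<dots> \<longleftrightarrow> ((\<lambda>n. (if n < - int m then 0 else of_int (fps_nth F (nat (n + int m)))) * ee ((of_int n - 1 / 24) * \<tau>)) has_sum
     ((ee (- (\<tau> / 24)) * inverse (ee \<tau> ^ m)) * f (ee \<tau>))) UNIV"
    by (rule has_sum_cong_neutral) auto
  finally show "((\<lambda>n. (if n < - int m then 0 else of_int (fps_nth F (nat (n + int m)))) * ee ((of_int n - 1 / 24) * \<tau>)) has_sum
     (ee (- (\<tau> / 24)) * f (ee \<tau>) * inverse (ee \<tau> ^ m))) UNIV"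
    by (simp add: mult_ac)
qed

text \<open>\<open>E6f ^ 2 / eta ^ 24\<close> is the modular function \<open>j - 1728\<close>, with
  a simple pole at infinity and leading coefficient 1.\<close>

definition basis_fun :: "nat \<Rightarrow> complex \<Rightarrow> complex" where
  "basis_fun m \<tau> = E6f (ee \<tau>) / eta \<tau> * (E6f (ee \<tau>) ^ 2 / eta \<tau> ^ 24) ^ m"

definition basis_fps :: "nat \<Rightarrow> int fps" where
  "basis_fps m = e6_fps * (E6 ^ 2 * q_poch_inv ^ 24) ^ m"

lemma holomorphic_E6f: "(\<lambda>\<tau>. E6f (ee \<tau>)) holomorphic_on uhp"
proof -
  have "eval_fps (complex_fps E6) holomorphic_on ball 0 1"
    by (rule holomorphic_on_eval_fps) (use represents_E6 in \<open>auto simp: represents_def intro: norm_less_conv_radius\<close>)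
  moreover have "ee holomorphic_on uhp" using holomorphic_on_ee[of "\<lambda>x. x"] by simp
  moreover have "ee ` uhp \<subseteq> ball 0 1" using uhp_ee by auto
  ultimately have "(eval_fps (complex_fps E6) \<circ> ee) holomorphic_on uhp" using holomorphic_on_compose_gen by blast
  thus ?thesis by (rule holomorphic_transform) (use represents_E6 uhp_ee in \<open>auto simp: represents_def\<close>)
qed

lemma weight_11_2_basis_fun: "weight_11_2 (basis_fun m)"
  unfolding weight_11_2_def
proof (intro conjI ballI)
  show "basis_fun m holomorphic_on uhp"
    unfolding basis_fun_def by (intro holomorphic_intros holomorphic_E6f holomorphic_eta) auto
  fix \<tau> assume t: "\<tau> \<in> uhp"
  have 1: "ee (1 / 24) ^ 24 = 1" unfolding ee_of_nat_mult[symmetric] by simp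
  have 2: "ee (- 1 / 24) = inverse (ee (1 / 24))" by (simp flip: ee_minus)
  show "basis_fun m (\<tau> + 1) = ee (- 1 / 24) * basis_fun m \<tau>"
    unfolding basis_fun_def eta_add_1 ee_add power_mult_distrib 1 2 by (simp add: field_simps)
  define c where "c = csqrt (- \<i> * \<tau>)"
  have c0: "c \<noteq> 0" using t by (auto simp: c_def)
  have c2: "\<tau> = \<i> * c ^ 2" by (simp add: c_def)
  have c12: "\<tau> ^ 6 = - (c ^ 12)" by (simp add: c2 power_mult_distrib flip: power_mult)
  have E: "E6f (ee (- 1 / \<tau>)) = - (c ^ 12) * E6f (ee \<tau>)"
    using E6f_transform[of \<tau>] t c12 by (simp add: uhp_def)
  have "(c ^ 12) ^ 2 = c ^ 24" by (simp flip: power_mult)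
  hence "(E6f (ee (- 1 / \<tau>)))\<^sup>2 / eta (- 1 / \<tau>) ^ 24 = (E6f (ee \<tau>))\<^sup>2 / eta \<tau> ^ 24"
    unfolding E eta_transform[OF t] c_def[symmetric] using c0 by (simp add: power_mult_distrib)
  moreover have "E6f (ee (- 1 / \<tau>)) / eta (- 1 / \<tau>) = - (c ^ 11) * (E6f (ee \<tau>) / eta \<tau>)"
  proof -
    have "c ^ 12 = c * c ^ 11" by (simp flip: power_Suc)
    thus ?thesis unfolding E eta_transform[OF t] c_def[symmetric] using c0 by simp
  qed
  ultimately show "basis_fun m (- 1 / \<tau>) = - (csqrt (- \<i> * \<tau>) ^ 11) * basis_fun m \<tau>"
    unfolding basis_fun_def c_def by (simp only: mult.assoc)
qed

lemma has_qexp_basis_fun: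
  "has_qexp (basis_fun m) (\<lambda>n. if n < - int m then 0 else of_int (fps_nth (basis_fps m) (nat (n + int m))))"
proof -
  define f where "f = (\<lambda>q. E6f q * exp (eval_fps log_fps q) * (E6f q ^ 2 * exp (eval_fps log_fps q) ^ 24) ^ m)"
  have "represents (basis_fps m) f"
    unfolding basis_fps_def e6_fps_eq f_def by (intro represents_mult represents_power represents_E6 represents_q_poch_inv)
  hence "has_qexp (\<lambda>\<tau>. ee (- (\<tau> / 24)) * f (ee \<tau>) * inverse (ee \<tau> ^ m))
    (\<lambda>n. if n < - int m then 0 else of_int (fps_nth (basis_fps m) (nat (n + int m))))"
    by (rule represents_imp_has_qexp)
  also have "(\<lambda>\<tau>. ee (- (\<tau> / 24)) * f (ee \<tau>) * inverse (ee \<tau> ^ m)) = basis_fun m"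
  proof
    fix \<tau>
    have 1: "ee \<tau> = ee (\<tau> / 24) ^ 24" unfolding ee_of_nat_mult[symmetric] by simp
    show "ee (- (\<tau> / 24)) * f (ee \<tau>) * inverse (ee \<tau> ^ m) = basis_fun m \<tau>"
      unfolding f_def basis_fun_def eta_def ee_minus exp_minus power_mult_distrib power_divide
      by (simp add: field_simps) (simp add: 1 power_mult_distrib)
  qed
  finally show ?thesis .
qed

lemma basis_fps_nth_0: "fps_nth (basis_fps m) 0 = 1"
  by (simp add: basis_fps_def e6_fps_eq q_poch_inv_def E6_def fps_power_zeroth)

section \<open>Forms with a single polar term\<close>

lemma weight_11_2_lincomb:
  assumes "weight_11_2 \<phi>" "weight_11_2 \<psi>"
  shows "weight_11_2 (\<lambda>\<tau>. c * \<phi> \<tau> + d * \<psi> \<tau>)"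
  using assms unfolding weight_11_2_def by (auto intro!: holomorphic_intros simp: algebra_simps)

lemma has_qexp_lincomb:
  assumes "has_qexp \<phi> a" "has_qexp \<psi> b"
  shows "has_qexp (\<lambda>\<tau>. c * \<phi> \<tau> + d * \<psi> \<tau>) (\<lambda>n. c * a n + d * b n)"
  unfolding has_qexp_def
proof
  fix \<tau> assume "\<tau> \<in> uhp"
  hence "((\<lambda>n. c * (a n * ee ((of_int n - 1 / 24) * \<tau>)) + d * (b n * ee ((of_int n - 1 / 24) * \<tau>)))
    has_sum (c * \<phi> \<tau> + d * \<psi> \<tau>)) UNIV"
    using assms unfolding has_qexp_def by (intro has_sum_add has_sum_cmult_right) auto
  thus "((\<lambda>n. (c * a n + d * b n) * ee ((of_int n - 1 / 24) * \<tau>)) has_sum (c * \<phi> \<tau> + d * \<psi> \<tau>)) UNIV"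
    by (simp add: algebra_simps)
qed

text \<open>Index 0 counts as polar, its exponent being \<open>- 1 / 24\<close>; thus
  \<open>m = 0\<close> describes E6 / eta itself.\<close>

definition reduced :: "nat \<Rightarrow> (complex \<Rightarrow> complex) \<Rightarrow> (int \<Rightarrow> complex) \<Rightarrow> bool" where
  "reduced m \<phi> a \<longleftrightarrow> weight_11_2 \<phi> \<and> has_qexp \<phi> a \<and> (\<forall>n. a n \<in> \<int>) \<and> (\<forall>n\<le>0. a n = (if n = - int m then 1 else 0))"

lemma reduced_0: "reduced 0 (basis_fun 0) (\<lambda>n. if n < 0 then 0 else of_int (e6 (nat n)))"
proof -
  have 0: "basis_fps 0 = e6_fps" by (simp add: basis_fps_def)
  have "has_qexp (basis_fun 0) (\<lambda>n. if n < 0 then 0 else of_int (e6 (nat n)))"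
    using has_qexp_basis_fun[of 0] unfolding 0 e6_def by (simp cong: if_cong)
  moreover have "e6 0 = 1" using basis_fps_nth_0[of 0] by (simp add: e6_def 0)
  ultimately show ?thesis
    using weight_11_2_basis_fun[of 0] by (auto simp: reduced_def)
qed

text \<open>Elimination on \<open>basis_fun m\<close>: multiples of the reduced forms of order
  \<open>i = 0, 1, ..., m - 1\<close> clear the polar coefficients one by one. Each such form has a
  single polar coefficient, equal to 1, so earlier zeros survive and no denominators arise.\<close>

lemma ex_reduced: "\<exists>\<phi> a. reduced m \<phi> a"
proof (induction m rule: less_induct)
  case (less m)
  have "\<exists>\<phi> a. weight_11_2 \<phi> \<and> has_qexp \<phi> a \<and> (\<forall>n. a n \<in> \<int>) \<and> (\<forall>n\<le>0. n < - int m \<longrightarrow> a n = 0) \<and> a (- int m) = 1 \<and>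
     (\<forall>n\<le>0. n > - int i \<longrightarrow> a n = 0)" if "i \<le> m" for i
    using that
  proof (induction i)
    case 0
    show ?case
      by (intro exI[of _ "basis_fun m"]
            exI[of _ "\<lambda>n. if n < - int m then 0 else of_int (fps_nth (basis_fps m) (nat (n + int m)))"] conjI weight_11_2_basis_fun has_qexp_basis_fun)
         (auto simp: basis_fps_nth_0)
  next
    case (Suc i)
    then obtain \<phi> a where IH: "weight_11_2 \<phi>" "has_qexp \<phi> a" "\<And>n. a n \<in> \<int>" "\<And>n. n < - int m \<Longrightarrow> a n = 0" "a (- int m) = 1"
      "\<And>n. n \<le> 0 \<Longrightarrow> n > - int i \<Longrightarrow> a n = 0" by auto
    have "i < m" using Suc.prems by simp
    with less.IH obtain \<psi> b where r: "reduced i \<psi> b" by blast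
    note rd = r[unfolded reduced_def]
    define c where "c = - a (- int i)"
    have "c \<in> \<int>" using IH(3) by (simp add: c_def)
    have "weight_11_2 (\<lambda>\<tau>. 1 * \<phi> \<tau> + c * \<psi> \<tau>)" by (rule weight_11_2_lincomb) (use IH rd in auto)
    moreover have "has_qexp (\<lambda>\<tau>. 1 * \<phi> \<tau> + c * \<psi> \<tau>) (\<lambda>n. 1 * a n + c * b n)" by (rule has_qexp_lincomb) (use IH rd in auto)
    moreover have "1 * a n + c * b n \<in> \<int>" for n
      using IH(3)[of n] rd \<open>c \<in> \<int>\<close> by (auto intro!: Ints_add Ints_mult)
    moreover have "1 * a n + c * b n = 0" if "n < - int m" for n
      using IH(4)[OF that] rd that \<open>i < m\<close> by auto
    moreover have "1 * a (- int m) + c * b (- int m) = 1"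
      using IH(5) rd \<open>i < m\<close> by auto
    moreover have "1 * a n + c * b n = 0" if "n \<le> 0" "n > - int (Suc i)" for n
    proof (cases "n = - int i")
      case True thus ?thesis using rd by (auto simp: c_def)
    next
      case False thus ?thesis using rd IH(6)[of n] that by auto
    qed
    ultimately show ?case by blast
  qed
  from this[of m] obtain \<phi> a where *: "weight_11_2 \<phi>" "has_qexp \<phi> a" "\<forall>n. a n \<in> \<int>" "\<forall>n\<le>0. n < - int m \<longrightarrow> a n = 0" "a (- int m) = 1"
     "\<forall>n\<le>0. n > - int m \<longrightarrow> a n = 0" by auto
  have "reduced m \<phi> a" unfolding reduced_def using * by (auto simp: not_less order.order_iff_strict)
  thus ?case by blast
qed

section \<open>The multiplier along words in the modular group\<close>

text \<open>The principal root maps the right half-plane into the sector of half-angle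
  \<open>pi / 4\<close> around the positive axis. A product of two such roots has positive real part
  and is therefore determined by its square.\<close>

lemma csqrt_Re_gt_Im: "Re x > 0 \<Longrightarrow> \<bar>Im (csqrt x)\<bar> < Re (csqrt x)"
proof -
  assume "Re x > 0"
  have "Re ((csqrt x)\<^sup>2) > 0" using \<open>Re x > 0\<close> by simp
  hence "(Im (csqrt x))\<^sup>2 < (Re (csqrt x))\<^sup>2" by (simp only: Re_power2)
  hence "\<bar>Im (csqrt x)\<bar> < \<bar>Re (csqrt x)\<bar>"
    using power2_less_imp_less[of "\<bar>Im (csqrt x)\<bar>" "\<bar>Re (csqrt x)\<bar>"] by (simp only: power2_abs abs_ge_zero)
  thus ?thesis using csqrt_principal[of x] by auto
qed

lemma Re_csqrt_mult_pos: "Re x > 0 \<Longrightarrow> Re y > 0 \<Longrightarrow> Re (csqrt x * csqrt y) > 0"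
proof -
  assume "Re x > 0" "Re y > 0"
  note * = csqrt_Re_gt_Im[OF this(1)] csqrt_Re_gt_Im[OF this(2)]
  have "Im (csqrt x) * Im (csqrt y) \<le> \<bar>Im (csqrt x)\<bar> * \<bar>Im (csqrt y)\<bar>"
    by (metis abs_ge_self abs_mult)
  also have "\<dots> < Re (csqrt x) * Re (csqrt y)"
    by (rule mult_strict_mono'[OF *]) auto
  finally show ?thesis by simp
qed

lemma square_eq_Re_pos:
  fixes u v :: complex
  assumes "u ^ 2 = v ^ 2" "Re u > 0" "Re v > 0"
  shows "u = v"
  using assms by (auto simp: power2_eq_iff)

lemma ee_eighth: "ee (- 1 / 8) = Complex (sqrt 2 / 2) (- (sqrt 2 / 2))"
proof -
  have "ee (- 1 / 8) = cis (- (pi / 4))"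
    by (simp add: ee_def cis_conv_exp mult_ac)
  thus ?thesis by (simp add: complex_eq_iff cos_45 sin_45)
qed

lemma ee_fourth: "ee (- 1 / 4) = - \<i>"
proof -
  have "ee (- 1 / 4) = cis (- (pi / 2))"
    by (simp add: ee_def cis_conv_exp mult_ac)
  thus ?thesis by (simp add: complex_eq_iff)
qed

lemma ee_half: "ee (1 / 2) = - 1"
proof -
  have "ee (1 / 2) = cis pi"
    by (simp add: ee_def cis_conv_exp mult_ac)
  thus ?thesis by (simp add: complex_eq_iff)
qed

text \<open>The two sides have equal squares, and both lie in the right half-plane: the left as a
  product of two roots from the sector, the right because \<open>ee (- 1 / 8)\<close> turns the
  sector by \<open>- pi / 4\<close>. Positivity of \<open>c\<close> puts
  \<open>d - c / \<tau>\<close> into the upper half-plane.\<close>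

lemma csqrt_cocycle:
  assumes \<tau>: "Im \<tau> > 0" and "c > 0" "d > 0"
  shows "csqrt (- \<i> * (of_real d - of_real c / \<tau>)) * csqrt (- \<i> * \<tau>) =
    ee (- 1 / 8) * csqrt (- \<i> * (of_real d * \<tau> - of_real c))"
proof (rule square_eq_Re_pos)
  have t0: "\<tau> \<noteq> 0" using \<tau> by auto
  have "ee (- 1 / 8) ^ 2 = ee (- 1 / 4)" unfolding ee_of_nat_mult[symmetric] by simp
  thus "(csqrt (- \<i> * (of_real d - of_real c / \<tau>)) * csqrt (- \<i> * \<tau>))\<^sup>2 =
    (ee (- 1 / 8) * csqrt (- \<i> * (of_real d * \<tau> - of_real c)))\<^sup>2"
    using t0 unfolding power_mult_distrib power2_csqrt ee_fourth by (simp add: field_simps)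
  show "Re (csqrt (- \<i> * (of_real d - of_real c / \<tau>)) * csqrt (- \<i> * \<tau>)) > 0"
  proof (rule Re_csqrt_mult_pos)
    have "Im (of_real c * w) = c * Im w" for w by simp
    moreover have "Im (- 1 / \<tau>) > 0" using \<tau> by (simp add: Im_divide power2_eq_square sum_squares_gt_zero_iff)
    ultimately have "Im (of_real c * (- 1 / \<tau>)) > 0" using \<open>c > 0\<close> by (metis mult_pos_pos)
    thus "0 < Re (- \<i> * (of_real d - of_real c / \<tau>))" by simp
  qed (use \<tau> in simp)
  have "\<bar>Im (csqrt (- \<i> * (of_real d * \<tau> - of_real c)))\<bar> < Re (csqrt (- \<i> * (of_real d * \<tau> - of_real c)))"
    by (rule csqrt_Re_gt_Im) (use \<tau> \<open>d > 0\<close> in simp)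
  hence "0 < sqrt 2 / 2 * (Re (csqrt (- \<i> * (of_real d * \<tau> - of_real c))) + Im (csqrt (- \<i> * (of_real d * \<tau> - of_real c))))"
    by (intro mult_pos_pos) auto
  thus "Re (ee (- 1 / 8) * csqrt (- \<i> * (of_real d * \<tau> - of_real c))) > 0"
    unfolding ee_eighth by (simp add: algebra_simps)
qed

text \<open>With \<open>x = csqrt (- \<i> * (c * \<tau> + d))\<close>, E6 has the factor
  \<open>(c * \<tau> + d) ^ 6 = - (x ^ 12)\<close> and eta the factor
  \<open>ee (k / 24) * x\<close>; their quotient is the factor here.\<close>

definition transforms_by :: "(complex \<Rightarrow> complex) \<Rightarrow> int \<Rightarrow> int \<Rightarrow> int \<Rightarrow> int \<Rightarrow> int \<Rightarrow> bool" where
  "transforms_by \<phi> a b c d k \<longleftrightarrow> (\<forall>\<tau>\<in>uhp. \<phi> ((of_int a * \<tau> + of_int b) / (of_int c * \<tau> + of_int d)) =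
     - ee (- of_int k / 24) * csqrt (- \<i> * (of_int c * \<tau> + of_int d)) ^ 11 * \<phi> \<tau>)"

lemma weight_11_2_shift:
  assumes "weight_11_2 \<phi>" "\<tau> \<in> uhp"
  shows "\<phi> (\<tau> + of_int m) = ee (- of_int m / 24) * \<phi> \<tau>"
proof (induction m rule: int_induct[where k = 0])
  case (step1 i)
  have "\<tau> + of_int i \<in> uhp" using assms by (simp add: uhp_def)
  hence "\<phi> (\<tau> + of_int i + 1) = ee (- 1 / 24) * \<phi> (\<tau> + of_int i)" using assms by (auto simp: weight_11_2_def)
  also have "\<dots> = ee (- 1 / 24 + - of_int i / 24) * \<phi> \<tau>" unfolding step1 ee_add by simp
  also have "- 1 / 24 + - of_int i / 24 = - of_int (i + 1) / (24 :: complex)" by (simp add: field_simps)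
  finally show ?case by (simp add: add_ac)
next
  case (step2 i)
  have "\<tau> + of_int (i - 1) \<in> uhp" using assms by (simp add: uhp_def)
  hence "\<phi> (\<tau> + of_int (i - 1) + 1) = ee (- 1 / 24) * \<phi> (\<tau> + of_int (i - 1))" using assms by (auto simp: weight_11_2_def)
  hence "ee (1 / 24) * (ee (- 1 / 24) * \<phi> (\<tau> + of_int (i - 1))) = ee (1 / 24) * (ee (- of_int i / 24) * \<phi> \<tau>)"
    using step2 by (simp add: add_ac)
  hence "ee (1 / 24 + - 1 / 24) * \<phi> (\<tau> + of_int (i - 1)) = ee (1 / 24 + - of_int i / 24) * \<phi> \<tau>"
    by (simp only: ee_add mult.assoc)
  moreover have "1 / 24 + - of_int i / 24 = - of_int (i - 1) / (24 :: complex)" by (simp add: field_simps)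
  moreover have "1 / 24 + - 1 / 24 = (0 :: complex)" by simp
  ultimately show ?case by (simp only: ee_0 mult_1_left)
qed auto

lemma transforms_by_TS:
  assumes "weight_11_2 \<phi>"
  shows "transforms_by \<phi> m (- 1) 1 0 m"
  unfolding transforms_by_def
proof
  fix \<tau> assume t: "\<tau> \<in> uhp"
  have "(of_int m * \<tau> + of_int (- 1)) / (of_int 1 * \<tau> + of_int 0) = - 1 / \<tau> + of_int m"
    using t by (simp add: field_simps)
  moreover have "\<phi> (- 1 / \<tau> + of_int m) = ee (- of_int m / 24) * \<phi> (- 1 / \<tau>)"
    by (rule weight_11_2_shift[OF assms uhp_inv[OF t]])
  moreover have "\<phi> (- 1 / \<tau>) = - (csqrt (- \<i> * \<tau>) ^ 11) * \<phi> \<tau>" using assms t by (auto simp: weight_11_2_def)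
  ultimately show "\<phi> ((of_int m * \<tau> + of_int (- 1)) / (of_int 1 * \<tau> + of_int 0)) =
     - ee (- of_int m / 24) * csqrt (- \<i> * (of_int 1 * \<tau> + of_int 0)) ^ 11 * \<phi> \<tau>"
    by simp
qed

lemma transforms_by_T:
  assumes "weight_11_2 \<phi>" "transforms_by \<phi> a b c d k"
  shows "transforms_by \<phi> a (b + m * a) c (d + m * c) (k + m)"
  unfolding transforms_by_def
proof
  fix \<tau> assume t: "\<tau> \<in> uhp"
  have t': "\<tau> + of_int m \<in> uhp" using t by (simp add: uhp_def)
  have 1: "of_int a * \<tau> + of_int (b + m * a) = of_int a * (\<tau> + of_int m) + of_int b"
       "of_int c * \<tau> + of_int (d + m * c) = of_int c * (\<tau> + of_int m) + of_int d"
    by (simp_all add: algebra_simps)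
  have 2: "ee (- of_int (k + m) / 24) = ee (- of_int k / 24) * ee (- of_int m / 24)"
    unfolding ee_add[symmetric] by (rule arg_cong[where f = ee]) (simp add: field_simps)
  show "\<phi> ((of_int a * \<tau> + of_int (b + m * a)) / (of_int c * \<tau> + of_int (d + m * c))) =
     - ee (- of_int (k + m) / 24) * csqrt (- \<i> * (of_int c * \<tau> + of_int (d + m * c))) ^ 11 * \<phi> \<tau>"
    unfolding 1 2 using assms(2) t' weight_11_2_shift[OF assms(1) t, of m] unfolding transforms_by_def by simp
qed

text \<open>The minus signs of the two laws cancel, and
  \<open>ee (- 1 / 8) ^ 11 = - ee (1 / 8)\<close> from the cocycle restores one; the remaining
  \<open>ee (1 / 8)\<close> lowers \<open>k\<close> by 3.\<close>

lemma transforms_by_S: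
  assumes "weight_11_2 \<phi>" "transforms_by \<phi> a b c d k" "c > 0" "d > 0"
  shows "transforms_by \<phi> b (- a) d (- c) (k - 3)"
  unfolding transforms_by_def
proof
  fix \<tau> assume t: "\<tau> \<in> uhp"
  have t0: "\<tau> \<noteq> 0" using t by simp
  define x where "x = csqrt (- \<i> * (of_int d * \<tau> + of_int (- c)))"
  have "(of_int a * (- 1 / \<tau>) + of_int b) / (of_int c * (- 1 / \<tau>) + of_int d) =
     ((of_int a * (- 1 / \<tau>) + of_int b) * \<tau>) / ((of_int c * (- 1 / \<tau>) + of_int d) * \<tau>)"
    using t0 by simp
  also have "\<dots> = (of_int b * \<tau> + of_int (- a)) / (of_int d * \<tau> + of_int (- c))"
    using t0 by (simp add: ring_distribs)
  finally have 1: "(of_int b * \<tau> + of_int (- a)) / (of_int d * \<tau> + of_int (- c)) =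
     (of_int a * (- 1 / \<tau>) + of_int b) / (of_int c * (- 1 / \<tau>) + of_int d)" ..
  have 2: "\<phi> (- 1 / \<tau>) = - (csqrt (- \<i> * \<tau>) ^ 11) * \<phi> \<tau>" using assms t by (auto simp: weight_11_2_def)
  have 3: "csqrt (- \<i> * (of_int c * (- 1 / \<tau>) + of_int d)) * csqrt (- \<i> * \<tau>) = ee (- 1 / 8) * x"
    using csqrt_cocycle[of \<tau> "of_int c" "of_int d"] t assms(3,4) by (simp add: uhp_def x_def)
  have 4: "ee (- 1 / 8) ^ 11 = - ee (1 / 8)"
  proof -
    have "ee (- 1 / 8) ^ 11 = ee (of_nat 11 * (- 1 / 8))" by (simp only: ee_of_nat_mult)
    also have "of_nat 11 * (- 1 / 8) = 1 / 8 + (of_int (- 2) + 1 / 2 :: complex)" by simp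
    also have "ee \<dots> = - ee (1 / 8)" unfolding ee_add ee_half ee_of_int by simp
    finally show ?thesis .
  qed
  have 5: "ee (- of_int (k - 3) / 24) = ee (- of_int k / 24) * ee (1 / 8)"
    unfolding ee_add[symmetric] by (rule arg_cong[where f = ee]) (simp add: field_simps)
  have "\<phi> ((of_int b * \<tau> + of_int (- a)) / (of_int d * \<tau> + of_int (- c))) =
    - ee (- of_int k / 24) * csqrt (- \<i> * (of_int c * (- 1 / \<tau>) + of_int d)) ^ 11 * \<phi> (- 1 / \<tau>)"
    unfolding 1 using assms(2) uhp_inv[OF t] unfolding transforms_by_def by blast
  also have "\<dots> = ee (- of_int k / 24) * (csqrt (- \<i> * (of_int c * (- 1 / \<tau>) + of_int d)) * csqrt (- \<i> * \<tau>)) ^ 11 * \<phi> \<tau>"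
    unfolding 2 power_mult_distrib by simp
  also have "\<dots> = - ee (- of_int (k - 3) / 24) * x ^ 11 * \<phi> \<tau>"
    unfolding 3 power_mult_distrib 4 5 by simp
  finally show "\<phi> ((of_int b * \<tau> + of_int (- a)) / (of_int d * \<tau> + of_int (- c))) =
     - ee (- of_int (k - 3) / 24) * csqrt (- \<i> * (of_int d * \<tau> + of_int (- c))) ^ 11 * \<phi> \<tau>"
    unfolding x_def .
qed

text \<open>
  A list \<open>[m\<^sub>0, m\<^sub>1, \<dots>, m\<^sub>r]\<close> stands for the matrix \<open>T\<^bsup>m\<^sub>0\<^esup> S T\<^bsup>m\<^sub>1\<^esup> S \<dots> S T\<^bsup>m\<^sub>r\<^esup>\<close>. The fifth component counts the factors
  \<open>ee (- 1 / 24)\<close> of the multiplier; it is well defined along the word because the lower right entry is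
  positive before each further \<open>S\<close>, so that the principal square roots multiply without a sign change.
\<close>

fun run_word :: "int \<Rightarrow> int \<Rightarrow> int \<Rightarrow> int \<Rightarrow> int \<Rightarrow> int list \<Rightarrow> (int \<times> int \<times> int \<times> int \<times> int) option" where
  "run_word a b c d k [] = Some (a, b, c, d, k)"
| "run_word a b c d k (m # ms) = (if d > 0 then run_word b (m * b - a) d (m * d - c) (k - 3 + m) ms else None)"

fun eval_word :: "int list \<Rightarrow> (int \<times> int \<times> int \<times> int \<times> int) option" where
  "eval_word (m # n # ms) = run_word m (n * m - 1) 1 n (m + n) ms"
| "eval_word _ = None"

lemma transforms_by_run_word:
  assumes "weight_11_2 \<phi>" "transforms_by \<phi> a b c d k" "c > 0" "run_word a b c d k ms = Some (a', b', c', d', k')"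
  shows "transforms_by \<phi> a' b' c' d' k'"
  using assms(2-)
proof (induction ms arbitrary: a b c d k)
  case (Cons m ms)
  have d: "d > 0" using Cons.prems(3) by (auto split: if_splits)
  have "transforms_by \<phi> b (- a + m * b) d (- c + m * d) (k - 3 + m)"
    by (intro transforms_by_T transforms_by_S assms Cons.prems d)
  hence "transforms_by \<phi> b (m * b - a) d (m * d - c) (k - 3 + m)" by (simp add: algebra_simps)
  moreover have "run_word b (m * b - a) d (m * d - c) (k - 3 + m) ms = Some (a', b', c', d', k')"
    using Cons.prems(3) d by simp
  ultimately show ?case using Cons.IH d by blast
qed auto

lemma transforms_by_eval_word:
  assumes "weight_11_2 \<phi>" "eval_word w = Some (a, b, c, d, k)"
  shows "transforms_by \<phi> a b c d k"
  using assms(2)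
proof (induction w rule: eval_word.induct)
  case (1 m n ms)
  have "transforms_by \<phi> m (- 1 + n * m) 1 (0 + n * 1) (m + n)"
    by (intro transforms_by_T transforms_by_TS assms)
  hence "transforms_by \<phi> m (n * m - 1) 1 n (m + n)" by (simp add: algebra_simps)
  thus ?case using transforms_by_run_word[OF assms(1)] 1 by (metis eval_word.simps(1) zero_less_one)
qed auto

lemma ee_mod_24: "k mod 24 = r \<Longrightarrow> ee (- of_int k / 24) = ee (- of_int r / 24)"
proof -
  assume "k mod 24 = r"
  hence "k = 24 * (k div 24) + r" by (metis mult_div_mod_eq)
  hence "(of_int k :: complex) = of_int (24 * (k div 24) + r)" by (rule arg_cong)
  hence "- of_int k / 24 = - of_int r / 24 + (of_int (- (k div 24)) :: complex)"
    by (simp add: field_simps)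
  thus ?thesis by (simp only: ee_add ee_of_int mult_1_right)
qed

text \<open>
  An entry \<open>(b, b', w)\<close> has \<open>576 b b' \<equiv> - 1\<close> modulo \<open>49\<close> (below: modulo \<open>7\<close>), and \<open>w\<close> is the continued fraction
  word of the matrix with rows \<open>(24 b, -(1 + 576 b b') / 49)\<close> and \<open>(49, - 24 b')\<close> (below: with \<open>7\<close> for \<open>49\<close>), which
  carries \<open>(\<tau> + 24 b') / 49\<close> to \<open>(- 1 / \<tau> + 24 b) / 49\<close>. The words of the second table
  carry \<open>\<tau> + 24 b' / 7\<close> to \<open>(- 1 / \<tau> + 168 b) / 49\<close>. In the first table all multipliers are trivial.
\<close>

definition table_49 :: "(int \<times> int \<times> int list) list" where
  "table_49 = [(1, 45, [1, 2, 25, -22]),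
    (2, 47, [1, 49, -23]),
    (3, 15, [2, 2, 9, 3, -7]),
    (4, 48, [2, 25, 2, -23]),
    (5, 9, [3, 2, 6, 2, 3, -4]),
    (6, 32, [3, 17, 2, 2, -15]),
    (8, 24, [4, 13, 2, 2, 2, -11]),
    (9, 5, [5, 2, 4, 2, 2, 2, 3, -2]),
    (10, 29, [5, 10, 5, -14]),
    (11, 13, [6, 2, 3, 4, 3, -6]),
    (12, 16, [6, 9, 2, 2, 2, 2, 2, -7]),
    (13, 11, [7, 2, 3, 2, 3, 3, -5]),
    (15, 3, [8, 2, 3, 2, 2, 2, 2, 2, 2, 3, -1]),
    (16, 12, [8, 7, 2, 2, 2, 2, 2, 2, 2, -5]),
    (17, 43, [9, 2, 2, 17, -21]),
    (18, 27, [9, 6, 2, 5, -13]),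
    (19, 23, [10, 2, 2, 5, 4, -11]),
    (20, 39, [10, 5, 10, -19]),
    (22, 31, [11, 5, 2, 6, -15]),
    (23, 19, [12, 2, 2, 3, 2, 2, 4, -9]),
    (24, 8, [12, 5, 2, 2, 2, 2, 2, 2, 2, 2, 2, 2, 2, -3]),
    (25, 41, [13, 2, 2, 2, 13, -20]),
    (26, 30, [13, 4, 5, 2, 2, -14]),
    (27, 18, [14, 2, 2, 2, 4, 2, 2, 2, 2, -8]),
    (29, 10, [15, 2, 2, 2, 3, 2, 2, 2, 2, 2, 2, 2, 2, -4]),
    (30, 26, [15, 4, 2, 2, 3, 2, 2, -12]),
    (31, 22, [16, 2, 2, 2, 2, 4, 2, 2, 2, -10]),
    (32, 6, [16, 4, 2, 2, 2, 2, 2, 2, 2, 2, 2, 2, 2, 2, 2, 2, 2, -2]),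
    (33, 37, [17, 2, 2, 2, 2, 2, 9, -18]),
    (34, 46, [17, 3, 9, 2, -22]),
    (36, 38, [18, 3, 4, 3, 2, -18]),
    (37, 33, [19, 2, 2, 2, 2, 2, 2, 2, 7, -16]),
    (38, 36, [19, 3, 3, 2, 3, 2, -17]),
    (39, 20, [20, 2, 2, 2, 2, 2, 2, 2, 2, 3, 2, 2, 2, -9]),
    (40, 44, [20, 3, 2, 6, 2, -21]),
    (41, 25, [21, 2, 2, 2, 2, 2, 2, 2, 2, 2, 2, 2, 5, -12]),
    (43, 17, [22, 2, 2, 2, 2, 2, 2, 2, 2, 2, 2, 2, 2, 2, 2, 2, 4, -8]),
    (44, 40, [22, 3, 2, 2, 2, 4, 2, -19]),
    (45, 1, [23, 2, 2, 2, 2, 2, 2, 2, 2, 2, 2, 2, 2, 2, 2, 2, 2, 2, 2, 2, 2, 2, 2, 2, 3, 0]),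
    (46, 34, [23, 3, 2, 2, 2, 2, 2, 2, 3, 2, -16]),
    (47, 2, [24, 2, 2, 2, 2, 2, 2, 2, 2, 2, 2, 2, 2, 2, 2, 2, 2, 2, 2, 2, 2, 2, 2, 2, 2, 2, 2, 2, 2, 2, 2, 2, 2, 2, 2, 2, 2, 2, 2, 2, 2, 2, 2, 2, 2, 2, 2, 2, 2, 0]),
    (48, 4, [24, 3, 2, 2, 2, 2, 2, 2, 2, 2, 2, 2, 2, 2, 2, 2, 2, 2, 2, 2, 2, 2, 2, 2, 2, -1])]"

definition table_7 :: "(int \<times> int \<times> int list) list" where
  "table_7 = [(1, 3, [4, 2, 4, -10]),
    (2, 5, [7, 7, -17]),
    (3, 1, [11, 2, 2, 3, -3]),
    (4, 6, [14, 4, 2, -20]),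
    (5, 2, [18, 2, 2, 2, 2, 2, 2, -6]),
    (6, 4, [21, 3, 2, 2, -13])]"

text \<open>The case split is whether \<open>b\<close> is a square modulo 7; 6/24 and 18/24 differ
  by one half, hence the roots of unity by a sign.\<close>

definition mult_7 :: "int \<Rightarrow> int" where
  "mult_7 b = (if b \<in> {1, 2, 4} then 6 else 18)"

definition units_49 :: "int set" where "units_49 = {b\<in>{0..48}. b mod 7 \<noteq> 0}"

text \<open>The equation for \<open>x\<close> says that the matrix has determinant 1. All conditions
  are checked by evaluating the word.\<close>

definition entry_49 :: "int \<times> int \<times> int list \<Rightarrow> bool" where
  "entry_49 = (\<lambda>(b, b', w). b \<in> units_49 \<and> b' \<in> units_49 \<and>
     (\<exists>x k. eval_word w = Some (24 * b, x, 49, - 24 * b', k) \<and> 49 * x = - (1 + 576 * b * b') \<and> k mod 24 = 0))"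

definition entry_7 :: "int \<times> int \<times> int list \<Rightarrow> bool" where
  "entry_7 = (\<lambda>(b, b', w). b \<in> {1..6} \<and> b' \<in> {1..6} \<and>
     (\<exists>x k. eval_word w = Some (24 * b, x, 7, - 24 * b', k) \<and> 7 * x = - (1 + 576 * b * b') \<and> k mod 24 = mult_7 b'))"

lemma table_49_entries: "list_all entry_49 table_49"
  by (simp add: table_49_def entry_49_def units_49_def)

lemma table_7_entries: "list_all entry_7 table_7"
  by (simp add: table_7_def entry_7_def mult_7_def)

lemma table_49_distinct: "distinct (map fst table_49)" "distinct (map (fst \<circ> snd) table_49)"
  by (simp_all add: table_49_def)

lemma table_7_distinct: "distinct (map fst table_7)" "distinct (map (fst \<circ> snd) table_7)"
  by (simp_all add: table_7_def)

section \<open>Sums over residues, reindexed by the tables\<close>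

lemma units_49_split:
  "{0..48} = (\<lambda>b. 7 * b) ` {0..6} \<union> units_49" "(\<lambda>b. 7 * b) ` {0..6} \<inter> units_49 = {}" "finite units_49"
proof -
  show "{0..48} = (\<lambda>b. 7 * b) ` {0..6} \<union> units_49"
    unfolding units_49_def
  proof (intro equalityI subsetI)
    fix x :: int assume x: "x \<in> {0..48}"
    show "x \<in> (\<lambda>b. 7 * b) ` {0..6} \<union> {b\<in>{0..48}. b mod 7 \<noteq> 0}"
    proof (cases "x mod 7 = 0")
      case True
      then obtain y where "x = 7 * y" by (auto elim!: dvdE)
      thus ?thesis using x by auto
    qed (use x in auto)
  qed auto
  show "(\<lambda>b. 7 * b) ` {0..6} \<inter> units_49 = {}" by (auto simp: units_49_def)
  show "finite units_49" by (rule finite_subset[of _ "{0..48}"]) (auto simp: units_49_def)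
qed

lemma card_units_49: "card units_49 = 42"
proof -
  have "card {0..48::int} = card ((\<lambda>b. 7 * b) ` {0..6::int}) + card units_49"
    unfolding units_49_split(1) by (rule card_Un_disjoint) (use units_49_split(2,3) in auto)
  moreover have "card ((\<lambda>b. 7 * b) ` {0..6::int}) = card {0..6::int}"
    by (rule card_image) (auto simp: inj_on_def)
  ultimately show ?thesis by simp
qed

lemma sum_table:
  assumes "distinct (map h t)" "h ` set t \<subseteq> A" "finite A" "card A = length t"
  shows "(\<Sum>b\<in>A. f b) = (\<Sum>e\<in>set t. f (h e))"
proof -
  have inj: "inj_on h (set t)" using assms(1) by (simp add: distinct_map)
  have "card (h ` set t) = length t" using assms(1) distinct_card[OF assms(1)] by simp
  hence "A = h ` set t" using assms(2-4) by (metis card_subset_eq)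
  thus ?thesis using inj by (simp add: sum.reindex)
qed

text \<open>Both columns enumerate the units, so \<open>b\<close> and \<open>b'\<close> are paired
  by a permutation; passing through the rows converts a sum over \<open>b\<close> into one over
  \<open>b'\<close>.\<close>

lemma sum_table_49:
  "(\<Sum>b\<in>units_49. f b) = (\<Sum>e\<in>set table_49. f (fst e))"
  "(\<Sum>b\<in>units_49. f b) = (\<Sum>e\<in>set table_49. f (fst (snd e)))"
proof -
  have len: "card units_49 = length table_49" by (simp add: card_units_49 table_49_def)
  have sub: "fst ` set table_49 \<subseteq> units_49" "(fst \<circ> snd) ` set table_49 \<subseteq> units_49"
    using table_49_entries by (auto simp: list_all_iff entry_49_def)
  show "(\<Sum>b\<in>units_49. f b) = (\<Sum>e\<in>set table_49. f (fst e))"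
    by (rule sum_table[OF table_49_distinct(1) sub(1) units_49_split(3) len])
  show "(\<Sum>b\<in>units_49. f b) = (\<Sum>e\<in>set table_49. f (fst (snd e)))"
    using sum_table[OF table_49_distinct(2) sub(2) units_49_split(3) len, of f] by simp
qed

lemma sum_table_7:
  "(\<Sum>b\<in>{1..6}. f b) = (\<Sum>e\<in>set table_7. f (fst e))"
  "(\<Sum>b\<in>{1..6}. f b) = (\<Sum>e\<in>set table_7. f (fst (snd e)))"
proof -
  have len: "card {1..6::int} = length table_7" by (simp add: table_7_def)
  have sub: "fst ` set table_7 \<subseteq> {1..6}" "(fst \<circ> snd) ` set table_7 \<subseteq> {1..6}"
    using table_7_entries by (auto simp: list_all_iff entry_7_def)
  show "(\<Sum>b\<in>{1..6}. f b) = (\<Sum>e\<in>set table_7. f (fst e))"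
    by (rule sum_table[OF table_7_distinct(1) sub(1) _ len]) simp
  show "(\<Sum>b\<in>{1..6}. f b) = (\<Sum>e\<in>set table_7. f (fst (snd e)))"
    using sum_table[OF table_7_distinct(2) sub(2) _ len, of f] by simp
qed

text \<open>For \<open>z = (\<tau> + 24 * b') / 49\<close> the denominator
  \<open>49 * z - 24 * b'\<close> is \<open>\<tau>\<close>, so the automorphy factor is that of the
  plain inversion.\<close>

lemma transform_shift_49:
  assumes e: "e \<in> set table_49" and st: "weight_11_2 \<phi>" and t: "\<tau> \<in> uhp"
  shows "\<phi> ((- 1 / \<tau> + 24 * of_int (fst e)) / 49) =
      - (csqrt (- \<i> * \<tau>) ^ 11) * \<phi> ((\<tau> + 24 * of_int (fst (snd e))) / 49)"
proof -
  obtain b b' w where ebw: "e = (b, b', w)" by (cases e) auto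
  obtain x k where *: "eval_word w = Some (24 * b, x, 49, - 24 * b', k)" "49 * x = - (1 + 576 * b * b')" "k mod 24 = 0"
    using bspec[OF table_49_entries[unfolded list_all_iff] e] unfolding ebw entry_49_def prod.case by (elim conjE exE) (rule that)
  define z where "z = (\<tau> + 24 * of_int b') / 49"
  have z: "z \<in> uhp" using t by (simp add: z_def uhp_def)
  have t0: "\<tau> \<noteq> 0" using t by simp
  have m: "transforms_by \<phi> (24 * b) x 49 (- 24 * b') k" by (rule transforms_by_eval_word[OF st *(1)])
  have e: "ee (- of_int k / 24) = 1" using ee_mod_24[OF *(3)] by simp
  have den: "of_int 49 * z + of_int (- 24 * b') = \<tau>" by (simp add: z_def field_simps)
  have x: "of_int x = - (1 + 576 * of_int b * of_int b') / (49 :: complex)"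
  proof -
    have "of_int (49 * x) = (of_int (- (1 + 576 * b * b')) :: complex)" using *(2) by simp
    thus ?thesis by (simp add: field_simps)
  qed
  have num: "of_int (24 * b) * z + of_int x = \<tau> * ((- 1 / \<tau> + 24 * of_int b) / 49)"
    unfolding x z_def using t0 by (simp add: field_simps)
  show ?thesis
    unfolding ebw fst_conv snd_conv
    using m[unfolded transforms_by_def, rule_format, OF z] t0 unfolding den num e z_def[symmetric] by simp
qed

lemma csqrt_of_real_mult: "r > 0 \<Longrightarrow> csqrt (of_real r * z) = of_real (sqrt r) * csqrt z"
proof -
  assume r: "r > 0"
  have "csqrt (of_real r * z) = csqrt ((of_real (sqrt r) * csqrt z)\<^sup>2)"
    using r by (simp add: power_mult_distrib flip: of_real_power)
  also have "\<dots> = of_real (sqrt r) * csqrt z"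
    using csqrt_principal[of z] r by (intro csqrt_unique) (auto simp: mult_less_0_iff)
  finally show ?thesis .
qed

text \<open>For \<open>z = \<tau> + 24 * b' / 7\<close> the denominator
  \<open>7 * z - 24 * b'\<close> is \<open>7 * \<tau>\<close>, whence the factor
  \<open>sqrt 7\<close>.\<close>

lemma transform_shift_7:
  assumes e: "e \<in> set table_7" and st: "weight_11_2 \<phi>" and t: "\<tau> \<in> uhp"
  shows "\<phi> ((- 1 / \<tau> + 168 * of_int (fst e)) / 49) =
      - ee (- of_int (mult_7 (fst (snd e))) / 24) * (of_real (sqrt 7) * csqrt (- \<i> * \<tau>)) ^ 11 *
        \<phi> (\<tau> + 24 * of_int (fst (snd e)) / 7)"
proof -
  obtain b b' w where ebw: "e = (b, b', w)" by (cases e) auto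
  obtain x k where *: "eval_word w = Some (24 * b, x, 7, - 24 * b', k)" "7 * x = - (1 + 576 * b * b')" "k mod 24 = mult_7 b'"
    using bspec[OF table_7_entries[unfolded list_all_iff] e] unfolding ebw entry_7_def prod.case by (elim conjE exE) (rule that)
  define z where "z = \<tau> + 24 * of_int b' / 7"
  have z: "z \<in> uhp" using t by (simp add: z_def uhp_def)
  have t0: "\<tau> \<noteq> 0" using t by simp
  have m: "transforms_by \<phi> (24 * b) x 7 (- 24 * b') k" by (rule transforms_by_eval_word[OF st *(1)])
  have e: "ee (- of_int k / 24) = ee (- of_int (mult_7 b') / 24)" by (rule ee_mod_24[OF *(3)])
  have den: "of_int 7 * z + of_int (- 24 * b') = 7 * \<tau>" by (simp add: z_def)
  have x: "of_int x = - (1 + 576 * of_int b * of_int b') / (7 :: complex)"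
  proof -
    have "of_int (7 * x) = (of_int (- (1 + 576 * b * b')) :: complex)" using *(2) by simp
    thus ?thesis by (simp add: field_simps)
  qed
  have num: "of_int (24 * b) * z + of_int x = (7 * \<tau>) * ((- 1 / \<tau> + 168 * of_int b) / 49)"
    unfolding x z_def using t0 by (simp add: field_simps)
  have sq: "csqrt (- \<i> * (7 * \<tau>)) = of_real (sqrt 7) * csqrt (- \<i> * \<tau>)"
    using csqrt_of_real_mult[of 7 "- \<i> * \<tau>"] by (simp add: mult_ac)
  show ?thesis
    unfolding ebw fst_conv snd_conv
    using m[unfolded transforms_by_def, rule_format, OF z] t0 unfolding den num e sq z_def[symmetric] by simp
qed

section \<open>The Hecke operator for 7^2\<close>

text \<open>
  The translations are by multiples of \<open>24\<close>, under which forms of weight \<open>11/2\<close> are invariant. The constants are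
  \<open>7\<^sup>9 = 7\<^sup>1\<^sup>1 / 49\<close> and \<open>343 \<surd>7 = \<surd>7\<^sup>1\<^sup>1 / 49\<close>, the powers being the scalings of the automorphy factor; the roots of
  unity in the last sum are \<open>- i\<close> times the Legendre symbol of \<open>b\<close> modulo \<open>7\<close>.
\<close>

definition hecke :: "(complex \<Rightarrow> complex) \<Rightarrow> complex \<Rightarrow> complex" where
  "hecke \<phi> \<tau> = (\<Sum>b\<in>{0..48::int}. \<phi> ((\<tau> + 24 * of_int b) / 49)) / 49 + 7 ^ 9 * \<phi> (49 * \<tau>) +
     343 * of_real (sqrt 7) * (\<Sum>b\<in>{1..6::int}. ee (- of_int (mult_7 b) / 24) * \<phi> (\<tau> + 24 * of_int b / 7))"

lemma sum_mod_7_split: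
  "(\<Sum>b\<in>{0..48::int}. f b) = f 0 + (\<Sum>b\<in>{1..6}. f (7 * b)) + (\<Sum>b\<in>units_49. (f b :: complex))"
proof -
  have "(\<Sum>b\<in>{0..48::int}. f b) = (\<Sum>b\<in>(\<lambda>b. 7 * b) ` {0..6}. f b) + (\<Sum>b\<in>units_49. f b)"
    unfolding units_49_split(1) by (rule sum.union_disjoint) (use units_49_split(2,3) in auto)
  also have "(\<Sum>b\<in>(\<lambda>b. 7 * b) ` {0..6::int}. f b) = (\<Sum>b\<in>{0..6::int}. f (7 * b))"
    by (subst sum.reindex) (auto simp: inj_on_def)
  also have "{0..6::int} = insert 0 {1..6}" by auto
  finally show ?thesis by simp
qed

text \<open>Inversion exchanges \<open>\<phi> (\<tau> / 49)\<close> with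
  \<open>\<phi> (49 * \<tau>)\<close> and the translates by multiples of 7 with the twisted sum, and
  it permutes the translates by units. The constants in \<open>hecke\<close> balance the
  scalings.\<close>

lemma hecke_inv:
  assumes st: "weight_11_2 \<phi>" and t: "\<tau> \<in> uhp"
  shows "hecke \<phi> (- 1 / \<tau>) = - (csqrt (- \<i> * \<tau>) ^ 11) * hecke \<phi> \<tau>"
proof -
  define s where "s = csqrt (- \<i> * \<tau>)"
  define R where "R = (of_real (sqrt 7) :: complex)"
  define X where "X = (\<lambda>b. ee (- of_int (mult_7 b) / 24))"
  have t0: "\<tau> \<noteq> 0" using t by simp
  have s0: "s \<noteq> 0" using t0 by (simp add: s_def)
  have R2: "R ^ 2 = 7" unfolding R_def by (simp flip: of_real_power)
  have R0: "R \<noteq> 0" unfolding R_def by simp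
  have R11: "R ^ 11 = 49 * (343 * R)"
  proof -
    have "R ^ 11 = (R ^ 2) ^ 5 * R" by (simp flip: power_mult power_Suc2)
    thus ?thesis unfolding R2 by simp
  qed
  have phiS: "\<phi> (- 1 / \<sigma>) = - (csqrt (- \<i> * \<sigma>) ^ 11) * \<phi> \<sigma>" if "\<sigma> \<in> uhp" for \<sigma>
    using st that by (auto simp: weight_11_2_def)
  have A: "\<phi> (- 1 / \<tau> / 49) = - (7 ^ 11) * s ^ 11 * \<phi> (49 * \<tau>)"
  proof -
    have "csqrt (- \<i> * (49 * \<tau>)) = 7 * s"
      using csqrt_of_real_mult[of 49 "- \<i> * \<tau>"] by (simp add: mult_ac s_def real_sqrt_unique)
    moreover have eq: "- 1 / \<tau> / 49 = - 1 / (49 * \<tau>)" by simp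
    moreover have "49 * \<tau> \<in> uhp" using t by (simp add: uhp_def)
    ultimately show ?thesis unfolding eq by (subst phiS) (simp_all add: power_mult_distrib)
  qed
  have B: "7 ^ 11 * \<phi> (49 * (- 1 / \<tau>)) = - (s ^ 11) * \<phi> (\<tau> / 49)"
  proof -
    have sqrt49: "sqrt (1 / 49) = 1 / 7" by (simp add: real_sqrt_divide real_sqrt_unique)
    have c: "csqrt (- \<i> * (\<tau> / 49)) = s / 7"
      using csqrt_of_real_mult[of "1 / 49" "- \<i> * \<tau>", unfolded sqrt49] by (simp add: mult_ac s_def)
    have eq: "49 * (- 1 / \<tau>) = - 1 / (\<tau> / 49)" by simp
    have "\<tau> / 49 \<in> uhp" using t by (simp add: uhp_def)
    thus ?thesis unfolding eq by (subst phiS) (simp_all only: c power_divide, simp)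
  qed
  have C: "(\<Sum>b\<in>units_49. \<phi> ((- 1 / \<tau> + 24 * of_int b) / 49)) = - (s ^ 11) * (\<Sum>b\<in>units_49. \<phi> ((\<tau> + 24 * of_int b) / 49))"
  proof -
    have "(\<Sum>b\<in>units_49. \<phi> ((- 1 / \<tau> + 24 * of_int b) / 49)) =
        (\<Sum>e\<in>set table_49. - (s ^ 11) * \<phi> ((\<tau> + 24 * of_int (fst (snd e))) / 49))"
      unfolding s_def sum_table_49(1) by (intro sum.cong refl transform_shift_49 st t)
    also have "\<dots> = (\<Sum>b\<in>units_49. - (s ^ 11) * \<phi> ((\<tau> + 24 * of_int b) / 49))"
      by (rule sum_table_49(2)[symmetric])
    finally show ?thesis by (simp add: sum_distrib_left)
  qed
  have D: "(\<Sum>b\<in>{1..6}. \<phi> ((- 1 / \<tau> + 24 * of_int (7 * b)) / 49)) =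
      - (s ^ 11) * (49 * (343 * R) * (\<Sum>b\<in>{1..6}. X b * \<phi> (\<tau> + 24 * of_int b / 7)))"
  proof -
    have "(\<Sum>b\<in>{1..6}. \<phi> ((- 1 / \<tau> + 24 * of_int (7 * b)) / 49)) =
        (\<Sum>e\<in>set table_7. - X (fst (snd e)) * (R * s) ^ 11 * \<phi> (\<tau> + 24 * of_int (fst (snd e)) / 7))"
      unfolding s_def R_def X_def sum_table_7(1)
      by (intro sum.cong refl, subst transform_shift_7[OF _ st t, symmetric]) auto
    also have "\<dots> = (\<Sum>b\<in>{1..6}. - X b * (R * s) ^ 11 * \<phi> (\<tau> + 24 * of_int b / 7))"
      by (rule sum_table_7(2)[symmetric])
    finally show ?thesis unfolding power_mult_distrib R11 by (simp add: sum_distrib_left mult_ac sum_negf)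
  qed
  have E: "49 * (343 * R) * (\<Sum>b\<in>{1..6}. X b * \<phi> (- 1 / \<tau> + 24 * of_int b / 7)) =
     - (s ^ 11) * (\<Sum>b\<in>{1..6}. \<phi> ((\<tau> + 24 * of_int (7 * b)) / 49))"
  proof -
    have t': "- 1 / \<tau> \<in> uhp" using t by (rule uhp_inv)
    \<comment> \<open>The square roots at \<open>\<tau>\<close> and \<open>- 1 / \<tau>\<close> are
      inverse to each other, so \<open>transform_shift_7\<close> taken at
      \<open>- 1 / \<tau>\<close> also gives the exchange in the opposite direction.\<close>
    have ss: "csqrt (- \<i> * (- 1 / \<tau>)) * s = 1"
    proof (rule square_eq_Re_pos)
      show "(csqrt (- \<i> * (- 1 / \<tau>)) * s)\<^sup>2 = 1\<^sup>2"
        unfolding power_mult_distrib s_def power2_csqrt using t0 by simp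
      show "0 < Re (csqrt (- \<i> * (- 1 / \<tau>)) * s)"
        unfolding s_def by (rule Re_csqrt_mult_pos) (use t t' in \<open>simp_all only: uhp_def mem_Collect_eq Re_minus_i_mult\<close>)
    qed auto
    have "X (fst (snd e)) * R ^ 11 * \<phi> (- 1 / \<tau> + 24 * of_int (fst (snd e)) / 7) =
        - (s ^ 11) * \<phi> ((\<tau> + 24 * of_int (7 * fst e)) / 49)" if e: "e \<in> set table_7" for e
    proof -
      have "\<phi> ((- 1 / (- 1 / \<tau>) + 168 * of_int (fst e)) / 49) =
          - X (fst (snd e)) * (R * csqrt (- \<i> * (- 1 / \<tau>))) ^ 11 * \<phi> (- 1 / \<tau> + 24 * of_int (fst (snd e)) / 7)"
        unfolding X_def R_def by (rule transform_shift_7[OF e st t'])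
      hence "- (s ^ 11) * \<phi> ((- 1 / (- 1 / \<tau>) + 168 * of_int (fst e)) / 49) =
          X (fst (snd e)) * (R * (csqrt (- \<i> * (- 1 / \<tau>)) * s)) ^ 11 * \<phi> (- 1 / \<tau> + 24 * of_int (fst (snd e)) / 7)"
        by (simp add: power_mult_distrib mult_ac)
      thus ?thesis unfolding ss using t0 by simp
    qed
    hence "(\<Sum>e\<in>set table_7. X (fst (snd e)) * R ^ 11 * \<phi> (- 1 / \<tau> + 24 * of_int (fst (snd e)) / 7)) =
      (\<Sum>e\<in>set table_7. - (s ^ 11) * \<phi> ((\<tau> + 24 * of_int (7 * fst e)) / 49))"
      by (intro sum.cong refl)
    hence "(\<Sum>b\<in>{1..6}. X b * R ^ 11 * \<phi> (- 1 / \<tau> + 24 * of_int b / 7)) =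
      (\<Sum>b\<in>{1..6}. - (s ^ 11) * \<phi> ((\<tau> + 24 * of_int (7 * b)) / 49))"
      unfolding sum_table_7(1)[of "\<lambda>b. - (s ^ 11) * \<phi> ((\<tau> + 24 * of_int (7 * b)) / 49)"]
        sum_table_7(2)[of "\<lambda>b. X b * R ^ 11 * \<phi> (- 1 / \<tau> + 24 * of_int b / 7)"] .
    thus ?thesis unfolding R11 by (simp add: sum_distrib_left mult_ac)
  qed
  define S0 S7 SC M V where "S0 = \<phi> (\<tau> / 49)" and "S7 = (\<Sum>b\<in>{1..6::int}. \<phi> ((\<tau> + 24 * of_int (7 * b)) / 49))"
    and "SC = (\<Sum>b\<in>units_49. \<phi> ((\<tau> + 24 * of_int b) / 49))"
    and "M = (\<Sum>b\<in>{1..6::int}. X b * \<phi> (\<tau> + 24 * of_int b / 7))" and "V = \<phi> (49 * \<tau>)"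
  have h1: "hecke \<phi> \<tau> = (S0 + S7 + SC) / 49 + 7 ^ 9 * V + 343 * R * M"
    unfolding hecke_def sum_mod_7_split by (simp add: S0_def S7_def SC_def M_def V_def X_def R_def)
  have h2: "hecke \<phi> (- 1 / \<tau>) = (- (7 ^ 11) * s ^ 11 * V + - (s ^ 11) * (49 * (343 * R) * M) + - (s ^ 11) * SC) / 49 +
      (- (s ^ 11) * S0) / 49 + (- (s ^ 11) * S7) / 49"
  proof -
    have div49: "p = y / 49" if "49 * p = y" for p y :: complex using that by (simp add: field_simps)
    have "49 * (7 ^ 9 * \<phi> (49 * (- 1 / \<tau>))) = 7 ^ 11 * \<phi> (49 * (- 1 / \<tau>))" by simp
    hence "7 ^ 9 * \<phi> (49 * (- 1 / \<tau>)) = (- (s ^ 11) * S0) / 49"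
      unfolding B S0_def[symmetric] by (rule div49)
    moreover have "343 * R * (\<Sum>b\<in>{1..6}. X b * \<phi> (- 1 / \<tau> + 24 * of_int b / 7)) = (- (s ^ 11) * S7) / 49"
      unfolding S7_def by (rule div49) (use E in \<open>simp only: mult.assoc\<close>)
    moreover have "\<phi> ((- 1 / \<tau> + 24 * of_int 0) / 49) = - (7 ^ 11) * s ^ 11 * V" using A by (simp add: V_def)
    moreover have X: "ee (- of_int (mult_7 b) / 24) = X b" for b by (simp add: X_def)
    ultimately show ?thesis
      unfolding hecke_def sum_mod_7_split C D X R_def[symmetric] SC_def[symmetric] M_def[symmetric] by simp
  qed
  show ?thesis unfolding h1 h2 s_def[symmetric] by (simp add: field_simps)
qed

section \<open>Action of the operator on coefficients\<close>

lemma has_sum_finite_sum: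
  fixes f :: "'a \<Rightarrow> 'b \<Rightarrow> complex"
  assumes "\<And>i. i \<in> A \<Longrightarrow> (f i has_sum s i) B"
  shows "((\<lambda>x. \<Sum>i\<in>A. f i x) has_sum (\<Sum>i\<in>A. s i)) B"
  using assms
  by (induction A rule: infinite_finite_induct) (auto intro: has_sum_add)

text \<open>All exponents \<open>n - 1 / 24\<close> agree modulo 1, so the translation law comes
  with the expansion.\<close>

lemma has_qexp_add_1:
  assumes "has_qexp \<psi> t" "\<tau> \<in> uhp"
  shows "\<psi> (\<tau> + 1) = ee (- 1 / 24) * \<psi> \<tau>"
proof -
  have 1: "((\<lambda>n. t n * ee ((of_int n - 1 / 24) * (\<tau> + 1))) has_sum \<psi> (\<tau> + 1)) UNIV"
    using assms by (auto simp: has_qexp_def uhp_def)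
  have "((\<lambda>n. ee (- 1 / 24) * (t n * ee ((of_int n - 1 / 24) * \<tau>))) has_sum (ee (- 1 / 24) * \<psi> \<tau>)) UNIV"
    using assms by (intro has_sum_cmult_right) (auto simp: has_qexp_def)
  also have "(\<lambda>n. ee (- 1 / 24) * (t n * ee ((of_int n - 1 / 24) * \<tau>))) = (\<lambda>n. t n * ee ((of_int n - 1 / 24) * (\<tau> + 1)))"
  proof
    fix n :: int
    have "(of_int n - 1 / 24) * (\<tau> + 1) = of_int n + (- 1 / 24 + (of_int n - 1 / 24) * \<tau>)" by (simp add: algebra_simps)
    thus "ee (- 1 / 24) * (t n * ee ((of_int n - 1 / 24) * \<tau>)) = t n * ee ((of_int n - 1 / 24) * (\<tau> + 1))"
      by (simp only: ee_add ee_of_int) simp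
  qed
  finally show ?thesis using 1 has_sum_unique by blast
qed

lemma sum_roots_of_unity_49: "(\<Sum>b\<in>{0..48::int}. ee (of_int k * of_int b / 49)) = (if 49 dvd k then 49 else 0)"
proof -
  define x where "x = ee (of_int k / 49)"
  have "(\<Sum>b\<in>{0..48::int}. ee (of_int k * of_int b / 49)) = (\<Sum>n<49. x ^ n)"
  proof (rule sum.reindex_bij_witness[of _ int nat])
    fix b :: int assume "b \<in> {0..48}"
    hence "of_int b = (of_nat (nat b) :: complex)" by simp
    thus "x ^ nat b = ee (of_int k * of_int b / 49)"
      unfolding x_def ee_of_nat_mult[symmetric] by (simp add: mult_ac)
  qed auto
  also have "\<dots> = (if 49 dvd k then 49 else 0)"
  proof (cases "x = 1")
    case True
    hence "of_int k / 49 \<in> (\<int> :: complex set)" by (simp add: x_def ee_eq_1_iff)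
    then obtain m where "of_int k / 49 = (of_int m :: complex)" by (auto elim: Ints_cases)
    hence "(of_int k :: complex) = of_int (49 * m)" by (simp add: field_simps)
    hence "k = 49 * m" by (simp only: of_int_eq_iff)
    thus ?thesis using True by simp
  next
    case False
    have "\<not> 49 dvd k"
    proof
      assume "49 dvd k"
      then obtain m where "k = 49 * m" by (auto elim: dvdE)
      hence "x = ee (of_int m)" by (simp add: x_def)
      thus False using False by simp
    qed
    moreover have "x ^ 49 = ee (of_nat 49 * (of_int k / 49))" unfolding x_def ee_of_nat_mult ..
    hence "x ^ 49 = 1" by simp
    ultimately show ?thesis using False by (simp add: sum_gp_strict)
  qed
  finally show ?thesis .
qed

definition hecke_mult :: "int \<Rightarrow> complex" where
  "hecke_mult n = 343 * of_real (sqrt 7) * (\<Sum>b\<in>{1..6::int}. ee (- of_int (mult_7 b) / 24) * ee ((24 * of_int n - 1) * of_int b / 7))"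

text \<open>Multiplying the exponent \<open>n - 1 / 24\<close> by 49 leads to the index
  \<open>49 * n - 2\<close>, as \<open>49 / 24 = 2 + 1 / 24\<close>; dividing by 49 leads to
  \<open>(n + 2) div 49\<close> when this is exact.\<close>

definition hecke_coeff :: "(int \<Rightarrow> complex) \<Rightarrow> int \<Rightarrow> complex" where
  "hecke_coeff a n = a (49 * n - 2) + 7 ^ 9 * (if 49 dvd n + 2 then a ((n + 2) div 49) else 0) + hecke_mult n * a n"

lemma has_qexp_hecke:
  assumes "has_qexp \<phi> a"
  shows "has_qexp (hecke \<phi>) (hecke_coeff a)"
  unfolding has_qexp_def
proof
  fix \<tau> assume t: "\<tau> \<in> uhp"
  have hs: "((\<lambda>n. a n * ee ((of_int n - 1 / 24) * \<sigma>)) has_sum \<phi> \<sigma>) UNIV" if "\<sigma> \<in> uhp" for \<sigma>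
    using assms that by (auto simp: has_qexp_def)
  define f where "f = (\<lambda>n::int. ee ((of_int n - 1 / 24) * \<tau>))"
  \<comment> \<open>Averaging over the 49 translates retains exactly the exponents with
    \<open>49 dvd 24 * n - 1\<close>, equivalently \<open>49 dvd n + 2\<close>.\<close>
  have 1: "((\<lambda>n. a (49 * n - 2) * f n) has_sum (\<Sum>b\<in>{0..48::int}. \<phi> ((\<tau> + 24 * of_int b) / 49)) / 49) UNIV"
  proof -
    have "((\<lambda>n. \<Sum>b\<in>{0..48::int}. a n * ee ((of_int n - 1 / 24) * ((\<tau> + 24 * of_int b) / 49))) has_sum
        (\<Sum>b\<in>{0..48::int}. \<phi> ((\<tau> + 24 * of_int b) / 49))) UNIV"
      using t by (intro has_sum_finite_sum hs) (simp add: uhp_def)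
    hence "((\<lambda>n. (\<Sum>b\<in>{0..48::int}. a n * ee ((of_int n - 1 / 24) * ((\<tau> + 24 * of_int b) / 49))) * (1 / 49)) has_sum
        (\<Sum>b\<in>{0..48::int}. \<phi> ((\<tau> + 24 * of_int b) / 49)) * (1 / 49)) UNIV"
      by (rule has_sum_cmult_left)
    also have "(\<lambda>n. (\<Sum>b\<in>{0..48::int}. a n * ee ((of_int n - 1 / 24) * ((\<tau> + 24 * of_int b) / 49))) * (1 / 49)) =
      (\<lambda>n. if 49 dvd 24 * n - 1 then a n * ee ((of_int n - 1 / 24) * (\<tau> / 49)) else 0)"
    proof
      fix n :: int
      have "ee ((of_int n - 1 / 24) * ((\<tau> + 24 * of_int b) / 49)) = ee ((of_int n - 1 / 24) * (\<tau> / 49)) * ee (of_int (24 * n - 1) * of_int b / 49)" for b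
        unfolding ee_add[symmetric] by (rule arg_cong[where f = ee]) (simp add: field_simps)
      hence "(\<Sum>b\<in>{0..48::int}. a n * ee ((of_int n - 1 / 24) * ((\<tau> + 24 * of_int b) / 49))) =
        a n * ee ((of_int n - 1 / 24) * (\<tau> / 49)) * (\<Sum>b\<in>{0..48::int}. ee (of_int (24 * n - 1) * of_int b / 49))"
        by (simp add: sum_distrib_left mult_ac)
      thus "(\<Sum>b\<in>{0..48::int}. a n * ee ((of_int n - 1 / 24) * ((\<tau> + 24 * of_int b) / 49))) * (1 / 49) =
        (if 49 dvd 24 * n - 1 then a n * ee ((of_int n - 1 / 24) * (\<tau> / 49)) else 0)"
        unfolding sum_roots_of_unity_49 by simp
    qed
    also have "((\<lambda>n. if 49 dvd 24 * n - 1 then a n * ee ((of_int n - 1 / 24) * (\<tau> / 49)) else 0) has_sum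
        (\<Sum>b\<in>{0..48::int}. \<phi> ((\<tau> + 24 * of_int b) / 49)) * (1 / 49)) UNIV \<longleftrightarrow>
      ((\<lambda>n. a n * ee ((of_int n - 1 / 24) * (\<tau> / 49))) has_sum
        (\<Sum>b\<in>{0..48::int}. \<phi> ((\<tau> + 24 * of_int b) / 49)) * (1 / 49)) {n. 49 dvd 24 * n - 1}"
      by (rule has_sum_cong_neutral) auto
    also have "\<dots> \<longleftrightarrow> ((\<lambda>n. a (49 * n - 2) * f n) has_sum (\<Sum>b\<in>{0..48::int}. \<phi> ((\<tau> + 24 * of_int b) / 49)) * (1 / 49)) UNIV"
    proof (rule has_sum_reindex_bij_witness[of _ "\<lambda>n. 49 * n - 2" "\<lambda>n. (n + 2) div 49"])
      fix n :: int assume "n \<in> {n. 49 dvd 24 * n - 1}"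
      hence "49 dvd 24 * n - 1" by simp
      hence "49 dvd 49 * n - 2 * (24 * n - 1)" using dvd_diff[OF dvd_triv_left dvd_mult] by blast
      hence "49 dvd n + 2" by simp
      then obtain m where m: "n + 2 = 49 * m" by (auto elim: dvdE)
      hence n: "n = 49 * m - 2" by simp
      show "49 * ((n + 2) div 49) - 2 = n" by (simp add: n)
      show "a (49 * ((n + 2) div 49) - 2) * f ((n + 2) div 49) = a n * ee ((of_int n - 1 / 24) * (\<tau> / 49))"
      proof -
        have "(of_int (49 * m - 2) - 1 / 24) * (\<tau> / 49) = (of_int m - 1 / 24) * \<tau>" by (simp add: field_simps)
        moreover have "(n + 2) div 49 = m" "49 * m - 2 = n" by (simp_all add: n)
        ultimately show ?thesis by (simp only: f_def)
      qed
    next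
      fix n :: int
      have "24 * (49 * n - 2) - 1 = 49 * (24 * n - 1)" by simp
      thus "49 * n - 2 \<in> {n. 49 dvd 24 * n - 1}" by (metis dvd_triv_left mem_Collect_eq)
    qed auto
    finally show ?thesis by simp
  qed
  have 2: "((\<lambda>n. (if 49 dvd n + 2 then a ((n + 2) div 49) else 0) * f n) has_sum \<phi> (49 * \<tau>)) UNIV"
  proof -
    have "((\<lambda>n. a n * ee ((of_int n - 1 / 24) * (49 * \<tau>))) has_sum \<phi> (49 * \<tau>)) UNIV"
      using t by (intro hs) (simp add: uhp_def)
    also have "?this \<longleftrightarrow> ((\<lambda>n. a ((n + 2) div 49) * f n) has_sum \<phi> (49 * \<tau>)) {n. 49 dvd n + 2}"
    proof (rule has_sum_reindex_bij_witness[of _ "\<lambda>n. (n + 2) div 49" "\<lambda>n. 49 * n - 2"])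
      fix n :: int
      have "(of_int (49 * n - 2) - 1 / 24) * \<tau> = (of_int n - 1 / 24) * (49 * \<tau>)" by (simp add: algebra_simps)
      moreover have "(49 * n - 2 + 2) div 49 = n" by simp
      ultimately show "a ((49 * n - 2 + 2) div 49) * f (49 * n - 2) = a n * ee ((of_int n - 1 / 24) * (49 * \<tau>))"
        by (simp only: f_def)
    qed auto
    also have "\<dots> \<longleftrightarrow> ?thesis" by (rule has_sum_cong_neutral) auto
    finally show ?thesis .
  qed
  have 3: "((\<lambda>n. (\<Sum>b\<in>{1..6::int}. ee (- of_int (mult_7 b) / 24) * ee ((24 * of_int n - 1) * of_int b / 7)) * a n * f n) has_sum
     (\<Sum>b\<in>{1..6::int}. ee (- of_int (mult_7 b) / 24) * \<phi> (\<tau> + 24 * of_int b / 7))) UNIV"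
  proof -
    have "((\<lambda>n. \<Sum>b\<in>{1..6::int}. ee (- of_int (mult_7 b) / 24) * (a n * ee ((of_int n - 1 / 24) * (\<tau> + 24 * of_int b / 7)))) has_sum
     (\<Sum>b\<in>{1..6::int}. ee (- of_int (mult_7 b) / 24) * \<phi> (\<tau> + 24 * of_int b / 7))) UNIV"
      using t by (intro has_sum_finite_sum has_sum_cmult_right hs) (simp add: uhp_def)
    also have "(\<lambda>n. \<Sum>b\<in>{1..6::int}. ee (- of_int (mult_7 b) / 24) * (a n * ee ((of_int n - 1 / 24) * (\<tau> + 24 * of_int b / 7)))) =
      (\<lambda>n. (\<Sum>b\<in>{1..6::int}. ee (- of_int (mult_7 b) / 24) * ee ((24 * of_int n - 1) * of_int b / 7)) * a n * f n)"
    proof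
      fix n :: int
      have "ee ((of_int n - 1 / 24) * (\<tau> + 24 * of_int b / 7)) = ee ((24 * of_int n - 1) * of_int b / 7) * f n" for b
        unfolding f_def ee_add[symmetric] by (rule arg_cong[where f = ee]) (simp add: field_simps)
      thus "(\<Sum>b\<in>{1..6::int}. ee (- of_int (mult_7 b) / 24) * (a n * ee ((of_int n - 1 / 24) * (\<tau> + 24 * of_int b / 7)))) =
         (\<Sum>b\<in>{1..6::int}. ee (- of_int (mult_7 b) / 24) * ee ((24 * of_int n - 1) * of_int b / 7)) * a n * f n"
        by (simp add: sum_distrib_left sum_distrib_right mult_ac)
    qed
    finally show ?thesis .
  qed
  have "((\<lambda>n. a (49 * n - 2) * f n + 7 ^ 9 * ((if 49 dvd n + 2 then a ((n + 2) div 49) else 0) * f n) +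
      343 * of_real (sqrt 7) * ((\<Sum>b\<in>{1..6::int}. ee (- of_int (mult_7 b) / 24) * ee ((24 * of_int n - 1) * of_int b / 7)) * a n * f n))
      has_sum hecke \<phi> \<tau>) UNIV"
    unfolding hecke_def by (intro has_sum_add has_sum_cmult_right 1 2 3)
  also have "(\<lambda>n. a (49 * n - 2) * f n + 7 ^ 9 * ((if 49 dvd n + 2 then a ((n + 2) div 49) else 0) * f n) +
      343 * of_real (sqrt 7) * ((\<Sum>b\<in>{1..6::int}. ee (- of_int (mult_7 b) / 24) * ee ((24 * of_int n - 1) * of_int b / 7)) * a n * f n))
     = (\<lambda>n. hecke_coeff a n * ee ((of_int n - 1 / 24) * \<tau>))"
    by (rule ext) (simp only: hecke_coeff_def hecke_mult_def f_def ring_distribs mult.assoc)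
  finally show "((\<lambda>n. hecke_coeff a n * ee ((of_int n - 1 / 24) * \<tau>)) has_sum hecke \<phi> \<tau>) UNIV" .
qed

lemma weight_11_2_hecke:
  assumes "weight_11_2 \<phi>" "has_qexp \<phi> a"
  shows "weight_11_2 (hecke \<phi>)"
  unfolding weight_11_2_def
proof (intro conjI ballI)
  have hol: "\<phi> holomorphic_on uhp" using assms by (simp add: weight_11_2_def)
  have comp: "(\<lambda>\<tau>. \<phi> (g \<tau>)) holomorphic_on uhp" if "g holomorphic_on uhp" "\<And>\<tau>. \<tau> \<in> uhp \<Longrightarrow> g \<tau> \<in> uhp" for g
    using holomorphic_on_compose_gen[OF that(1) hol] that(2) by (auto simp: o_def)
  show "hecke \<phi> holomorphic_on uhp"
    unfolding hecke_def[abs_def] by (intro holomorphic_intros comp) (auto simp: uhp_def)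
qed (use has_qexp_add_1[OF has_qexp_hecke[OF assms(2)]] hecke_inv[OF assms(1)] in auto)

text \<open>
  The sum is, up to a factor, the quadratic Gauss sum modulo \<open>7\<close>, whose square is \<open>- 7\<close>.
\<close>

lemma hecke_mult_square: "hecke_mult n ^ 2 = 0 \<or> hecke_mult n ^ 2 = 7 ^ 8"
proof -
  define z where "z = ee ((24 * of_int n - 1) / 7)"
  have z7: "z ^ 7 = 1"
  proof -
    have "z ^ 7 = ee (of_nat 7 * ((24 * of_int n - 1) / 7))" unfolding z_def ee_of_nat_mult ..
    also have "of_nat 7 * ((24 * of_int n - 1) / 7) = (of_int (24 * n - 1) :: complex)" by simp
    finally show ?thesis by (simp only: ee_of_int)
  qed
  have zp: "ee ((24 * of_int n - 1) * of_nat k / 7) = z ^ k" for k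
    unfolding z_def ee_of_nat_mult[symmetric] by (simp add: mult_ac)
  have e6: "ee (- 6 / 24) = - \<i>" using ee_fourth by simp
  have e18: "ee (- 18 / 24) = \<i>"
  proof -
    have "ee (- 18 / 24) = ee (1 / 2 + (- 1 / 4) + of_int (- 1))" by simp
    also have "\<dots> = \<i>" unfolding ee_add ee_half ee_fourth ee_of_int by simp
    finally show ?thesis .
  qed
  have set: "{1..6::int} = {1, 2, 3, 4, 5, 6}" by auto
  define D where "D = z + z ^ 2 + z ^ 4 - z ^ 3 - z ^ 5 - z ^ 6"
  have w: "hecke_mult n = 343 * of_real (sqrt 7) * (- \<i> * D)"
    unfolding hecke_mult_def set D_def
    using zp[of 1] zp[of 2] zp[of 3] zp[of 4] zp[of 5] zp[of 6]
    by (simp add: mult_7_def e6[simplified] e18[simplified] algebra_simps)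
  have "D ^ 2 = 0 \<or> D ^ 2 = - 7"
  proof (cases "z = 1")
    case False
    have "(z - 1) * (1 + z + z^2 + z^3 + z^4 + z^5 + z^6) = z ^ 7 - 1" by (simp add: algebra_simps eval_nat_numeral)
    hence s: "1 + z + z^2 + z^3 + z^4 + z^5 + z^6 = 0" using False z7 by simp
    have r: "z ^ 8 = z" "z ^ 9 = z ^ 2" "z ^ 10 = z ^ 3" "z ^ 11 = z ^ 4" "z ^ 12 = z ^ 5"
      using z7 power_add[of z 7 1] power_add[of z 7 2] power_add[of z 7 3] power_add[of z 7 4] power_add[of z 7 5] by simp_all
    have "D ^ 2 = z^2 + z^4 + z^8 + z^6 + z^10 + z^12 + 2 * (z^3 + z^5 - z^4 - z^6 - z^7 + z^6 - z^5 - z^7 - z^8 - z^7 - z^9 - z^10 + z^8 + z^9 + z^11)"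
      unfolding D_def power2_eq_square by (simp add: algebra_simps flip: power_add power_Suc power_Suc2)
        (simp add: eval_nat_numeral algebra_simps)
    also have "\<dots> = (1 + z + z^2 + z^3 + z^4 + z^5 + z^6) - 7"
      unfolding r z7 by simp
    finally show ?thesis using s by simp
  qed (simp add: D_def)
  moreover have "hecke_mult n ^ 2 = - (343 ^ 2 * 7) * D ^ 2"
  proof -
    have "(of_real (sqrt 7) :: complex) ^ 2 = 7" by (simp flip: of_real_power)
    thus ?thesis unfolding w power_mult_distrib by simp
  qed
  ultimately show ?thesis by auto
qed

lemma hecke_mult_int: "\<exists>g::int. hecke_mult n = of_int (7 ^ 4 * g)"
proof -
  have "hecke_mult n ^ 2 = 7 ^ 8 \<Longrightarrow> hecke_mult n = 7 ^ 4 \<or> hecke_mult n = - (7 ^ 4)"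
    using power2_eq_iff[of "hecke_mult n" "7 ^ 4"] by simp
  with hecke_mult_square[of n] have "hecke_mult n = of_int (7 ^ 4 * 0) \<or> hecke_mult n = of_int (7 ^ 4 * 1) \<or> hecke_mult n = of_int (7 ^ 4 * (- 1))"
    by auto
  thus ?thesis by blast
qed

section \<open>Divisibility\<close>

text \<open>
  \<open>24 pole_order j + 1 = 49\<^sup>j\<close>
\<close>

fun pole_order :: "nat \<Rightarrow> nat" where
  "pole_order 0 = 0"
| "pole_order (Suc j) = 49 * pole_order j + 2"

lemma hecke_recurrence:
  assumes r: "reduced (pole_order j) \<phi> a" and r': "reduced (pole_order (Suc j)) \<phi>' a'"
    and r'': "j > 0 \<Longrightarrow> reduced (pole_order (j - 1)) \<phi>'' a''"
  shows "hecke_coeff a n = (if j > 0 then a'' n else 0) + hecke_mult (- int (pole_order j)) * a n + 7 ^ 9 * a' n"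
proof -
  define \<delta> :: complex where "\<delta> = (if j > 0 then 1 else 0)"
  define \<epsilon> where "\<epsilon> = hecke_mult (- int (pole_order j))"
  \<comment> \<open>For \<open>j = 0\<close> there is no lower form; \<open>\<phi>\<close> then
    serves as a placeholder with coefficient \<open>\<delta> = 0\<close>.\<close>
  define \<psi> b where "\<psi> = (if j > 0 then \<phi>'' else \<phi>)" and "b = (if j > 0 then a'' else a)"
  have psi: "weight_11_2 \<psi>" "has_qexp \<psi> b" using r r'' by (auto simp: \<psi>_def b_def reduced_def)
  have R: "weight_11_2 \<phi>" "has_qexp \<phi> a" "weight_11_2 \<phi>'" "has_qexp \<phi>' a'" using r r' by (auto simp: reduced_def)
  define g where "g = (\<lambda>\<tau>. 1 * (1 * hecke \<phi> \<tau> + (- \<epsilon>) * \<phi> \<tau>) + (- 1) * (\<delta> * \<psi> \<tau> + 7 ^ 9 * \<phi>' \<tau>))"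
  define t where "t = (\<lambda>n. 1 * (1 * hecke_coeff a n + (- \<epsilon>) * a n) + (- 1) * (\<delta> * b n + 7 ^ 9 * a' n))"
  have "weight_11_2 g" unfolding g_def by (intro weight_11_2_lincomb weight_11_2_hecke[OF R(1,2)] R psi)
  moreover have "has_qexp g t" unfolding g_def t_def by (intro has_qexp_lincomb has_qexp_hecke R psi)
  moreover have "t n = 0" if n: "n \<le> 0" for n
  proof -
    have a: "a m = (if m = - int (pole_order j) then 1 else 0)" if "m \<le> 0" for m
      using r that by (simp add: reduced_def)
    have a': "a' n = (if n = - int (pole_order (Suc j)) then 1 else 0)"
      using r' n by (simp add: reduced_def)
    have b: "\<delta> * b n = (if j > 0 \<and> n = - int (pole_order (j - 1)) then 1 else 0)"
      using r'' n by (auto simp: reduced_def \<delta>_def b_def)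
    have 1: "a (49 * n - 2) = \<delta> * b n"
    proof -
      have "a (49 * n - 2) = (if 49 * n - 2 = - int (pole_order j) then 1 else 0)" using n by (intro a) simp
      \<comment> \<open>For \<open>j = 0\<close> the equation \<open>49 * n = 2\<close> has no
        integer solution; for \<open>j > 0\<close> the recursion of \<open>pole_order\<close> is
        inverted.\<close>
      also have "49 * n - 2 = - int (pole_order j) \<longleftrightarrow> j > 0 \<and> n = - int (pole_order (j - 1))"
        using n by (cases j) auto
      finally show ?thesis unfolding b .
    qed
    have 2: "(if 49 dvd n + 2 then a ((n + 2) div 49) else 0) = a' n"
    proof (cases "49 dvd n + 2")
      case True
      then obtain m where m: "n + 2 = 49 * m" by (auto elim: dvdE)
      hence "m \<le> 0" using n by linarith
      moreover have "m = - int (pole_order j) \<longleftrightarrow> n = - int (pole_order (Suc j))" using m by auto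
      ultimately show ?thesis using True m a[of m] a' by simp
    next
      case False
      have "n \<noteq> - int (pole_order (Suc j))"
      proof
        assume "n = - int (pole_order (Suc j))"
        hence "n + 2 = 49 * (- int (pole_order j))" by simp
        thus False using False by (metis dvd_triv_left)
      qed
      thus ?thesis using False a' by simp
    qed
    \<comment> \<open>Among \<open>n <= 0\<close> the coefficient \<open>a n\<close> is nonzero only
      at the pole, so the multiplier may be frozen at its value there.\<close>
    have 3: "hecke_mult n * a n = \<epsilon> * a n" using a[OF n] by (simp add: \<epsilon>_def)
    show ?thesis unfolding t_def hecke_coeff_def 1 2 3 by simp
  qed
  ultimately have "t n = 0" by (rule weight_11_2_zero)
  thus ?thesis unfolding t_def by (auto simp: \<delta>_def \<epsilon>_def b_def algebra_simps)
qed

section \<open>The 7-adic induction\<close>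

fun shift49 :: "nat \<Rightarrow> int \<Rightarrow> int" where
  "shift49 0 n = n"
| "shift49 (Suc k) n = 49 * shift49 k n - 2"

lemma shift49_eq: "24 * shift49 k n - 1 = 49 ^ k * (24 * n - 1)"
  by (induction k) (auto simp: algebra_simps)

text \<open>Truncated subtraction makes the claim empty for \<open>j >= k\<close>. Put
  \<open>e = 2 * k - 2 * j\<close>. The hypothesis at \<open>k - 1\<close> supplies \<open>e\<close>
  for \<open>j - 1\<close>, \<open>e - 2\<close> for \<open>j\<close> against a factor
  \<open>7 ^ 4\<close>, and \<open>e - 4\<close> for \<open>j + 1\<close> against
  \<open>7 ^ 9\<close>. The last term goes back to \<open>k - 2\<close>, hence the strong induction,
  and also lacks only 4.\<close>

lemma recurrence_valuation:
  fixes A :: "nat \<Rightarrow> int \<Rightarrow> int" and w :: "nat \<Rightarrow> int \<Rightarrow> int"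
  assumes rec: "\<And>j n. A j (49 * n - 2) = (if j > 0 then A (j - 1) n else 0) + 7 ^ 4 * w j n * A j n
       + 7 ^ 9 * A (Suc j) n - 7 ^ 9 * (if 49 dvd n + 2 then A j ((n + 2) div 49) else 0)"
  shows "7 ^ (2 * k - 2 * j) dvd A j (shift49 k n)"
proof (induction k arbitrary: j rule: less_induct)
  case (less k)
  show ?case
  proof (cases k)
    case (Suc l)
    define e where "e = 2 * k - 2 * j"
    have dv: "(7::int) ^ e dvd 7 ^ p * x" if "7 ^ r dvd x" "e \<le> p + r" for p r x
    proof -
      have "(7::int) ^ e dvd 7 ^ (p + r)" by (rule le_imp_power_dvd) fact
      also have "\<dots> dvd 7 ^ p * x" unfolding power_add using that(1) by (rule mult_dvd_mono[OF dvd_refl])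
      finally show ?thesis .
    qed
    define m where "m = shift49 l n"
    have IH: "7 ^ (2 * l - 2 * i) dvd A i m" for i using less[of l i] Suc by (simp add: m_def)
    have 1: "7 ^ e dvd (if j > 0 then A (j - 1) m else 0)"
    proof (cases "j > 0")
      case True
      hence "2 * l - 2 * (j - 1) = e" using Suc by (simp add: e_def)
      thus ?thesis using IH[of "j - 1"] True by simp
    qed auto
    have 2: "7 ^ e dvd 7 ^ 4 * w j m * A j m"
      using dv[of "2 * l - 2 * j" "w j m * A j m" 4] IH[of j] Suc by (simp add: e_def mult.assoc)
    have 3: "7 ^ e dvd 7 ^ 9 * A (Suc j) m"
      by (rule dv[OF IH]) (use Suc in \<open>simp add: e_def\<close>)
    have 4: "7 ^ e dvd 7 ^ 9 * (if 49 dvd m + 2 then A j ((m + 2) div 49) else 0)"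
    proof (cases l)
      case 0
      \<comment> \<open>Here \<open>k = 1\<close>, so \<open>e <= 2\<close> and the factor
        \<open>7 ^ 9\<close> alone suffices.\<close>
      thus ?thesis using Suc by (intro dv[of 0]) (auto simp: e_def)
    next
      case (Suc l')
      have "m = 49 * shift49 l' n - 2" by (simp add: m_def Suc)
      moreover have "7 ^ (2 * l' - 2 * j) dvd A j (shift49 l' n)"
        using less[of l' j] Suc \<open>k = Suc l\<close> by simp
      ultimately show ?thesis using Suc \<open>k = Suc l\<close> by (intro dv[of "2 * l' - 2 * j"]) (auto simp: e_def)
    qed
    have "A j (shift49 k n) = A j (49 * m - 2)" by (simp add: Suc m_def)
    thus ?thesis unfolding rec e_def[symmetric] using 1 2 3 4 by (auto intro!: dvd_add dvd_diff)
  qed auto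
qed

theorem e6_valuation:
  assumes N: "int N = shift49 k n"
  shows "7 ^ (2 * k) dvd e6 N"
proof -
  define a0 :: "int \<Rightarrow> complex" where "a0 = (\<lambda>n. if n < 0 then 0 else of_int (e6 (nat n)))"
  \<comment> \<open>The member of order 0 is taken to be E6 / eta itself, so that its coefficients
    are the numbers \<open>e6\<close>.\<close>
  have "\<exists>\<phi> a. reduced (pole_order j) \<phi> a \<and> (j = 0 \<longrightarrow> a = a0)" for j
    using reduced_0 ex_reduced[of "pole_order j"] unfolding a0_def by (cases j) auto
  then obtain \<Phi> a where r: "\<And>j. reduced (pole_order j) (\<Phi> j) (a j)" and a: "a 0 = a0" by metis
  have "\<exists>z. a j n = of_int z" for j n
  proof -
    have "a j n \<in> \<int>" using r[of j] by (simp add: reduced_def)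
    thus ?thesis by (rule Ints_cases) auto
  qed
  then obtain A where A: "\<And>j n. a j n = of_int (A j n)" by metis
  obtain g where g: "\<And>n. hecke_mult n = of_int (7 ^ 4 * g n)" using hecke_mult_int by metis
  define w where "w = (\<lambda>j n. g (- int (pole_order j)) - g n)"
  have "A j (49 * n - 2) = (if j > 0 then A (j - 1) n else 0) + 7 ^ 4 * w j n * A j n
       + 7 ^ 9 * A (Suc j) n - 7 ^ 9 * (if 49 dvd n + 2 then A j ((n + 2) div 49) else 0)" for j n
  proof -
    have "hecke_coeff (a j) n = (if j > 0 then a (j - 1) n else 0) + hecke_mult (- int (pole_order j)) * a j n + 7 ^ 9 * a (Suc j) n"
      by (rule hecke_recurrence[OF r r r])
    hence "(of_int (A j (49 * n - 2) + 7 ^ 9 * (if 49 dvd n + 2 then A j ((n + 2) div 49) else 0) + 7 ^ 4 * g n * A j n) :: complex) =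
      of_int ((if j > 0 then A (j - 1) n else 0) + 7 ^ 4 * g (- int (pole_order j)) * A j n + 7 ^ 9 * A (Suc j) n)"
      unfolding hecke_coeff_def A g by (cases "j > 0"; cases "49 dvd n + 2"; simp)
    hence "A j (49 * n - 2) + 7 ^ 9 * (if 49 dvd n + 2 then A j ((n + 2) div 49) else 0) + 7 ^ 4 * g n * A j n =
      (if j > 0 then A (j - 1) n else 0) + 7 ^ 4 * g (- int (pole_order j)) * A j n + 7 ^ 9 * A (Suc j) n"
      by (simp only: of_int_eq_iff)
    thus ?thesis by (simp add: w_def algebra_simps)
  qed
  hence "7 ^ (2 * k - 2 * 0) dvd A 0 (shift49 k n)" by (rule recurrence_valuation)
  moreover have "A 0 (int N) = e6 N"
    using A[of 0 "int N"] a by (simp add: a0_def)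
  ultimately show ?thesis using N by simp
qed

theorem theorem5p11:
  fixes k n :: nat
  assumes "k \<ge> 1"
  shows "[e6 (7 ^ (2 * k) * n + delta 7 (2 * k)) = 0] (mod 7 ^ (2 * k))"
proof -
  define N where "N = 7 ^ (2 * k) * n + delta 7 (2 * k)"
  have p49: "(7::int) ^ (2 * k) = 49 ^ k" by (simp add: power_mult)
  have "[24 * delta 7 (2 * k) = 1] (mod 7 ^ (2 * k))"
    using delta_props[of 7 "2 * k"] assms by simp
  hence "[int (24 * delta 7 (2 * k)) = int 1] (mod int (7 ^ (2 * k)))"
    by (simp only: cong_int_iff)
  hence "49 ^ k dvd 24 * int (delta 7 (2 * k)) - 1"
    by (simp add: cong_iff_dvd_diff p49)
  hence "49 ^ k dvd 49 ^ k * (24 * int n) + (24 * int (delta 7 (2 * k)) - 1)"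
    by (intro dvd_add) auto
  also have "49 ^ k * (24 * int n) + (24 * int (delta 7 (2 * k)) - 1) = 24 * int N - 1"
    unfolding N_def of_nat_add of_nat_mult of_nat_power of_nat_numeral p49 by (simp add: algebra_simps)
  finally obtain m where m: "24 * int N - 1 = 49 ^ k * m" by (auto elim: dvdE)
  \<comment> \<open>As 49 is 1 modulo 24, the cofactor \<open>m\<close> is -1 modulo 24 like
    \<open>24 * N - 1\<close>; so \<open>m = 24 * n' - 1\<close>, and \<open>N\<close> is
    \<open>shift49 k n'\<close>.\<close>
  have "[(49::int) ^ k = 1 ^ k] (mod 24)" by (rule cong_pow) (simp add: cong_def)
  hence "[49 ^ k * m = 1 * m] (mod 24)" by (intro cong_mult cong_refl) simp
  hence "[24 * int N - 1 = m] (mod 24)" using m by simp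
  hence "24 dvd 24 * int N - 1 - m" by (simp add: cong_iff_dvd_diff)
  hence "24 dvd 24 * int N - (24 * int N - 1 - m)" using dvd_diff[OF dvd_triv_left] by blast
  hence "24 dvd m + 1" by (simp add: add.commute)
  then obtain n' where "m + 1 = 24 * n'" by (auto elim: dvdE)
  hence "m = 24 * n' - 1" by simp
  hence "24 * int N - 1 = 24 * shift49 k n' - 1" unfolding shift49_eq m by simp
  hence "7 ^ (2 * k) dvd e6 N" by (intro e6_valuation) simp
  thus ?thesis by (simp add: N_def cong_0_iff)
qed

end
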